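(* Let $N\ge1$, let $\mathcal{A}\subset\{1,\ldots,N\}^2$ be a symmetric set of ordered pairs $(i,j)$ with $i\neq j$ such that for each $i$ there is at most one $j$ with $(i,j)\in\mathcal{A}$, let $\mathcal{A}'$ be the set of indices $i$ belonging to no pair of $\mathcal{A}$, and let $\alpha=(\alpha_i)_{1\le i\le N}$ be real with $|\alpha_i|\le1$ and $\alpha_i=\alpha_j$ whenever $(i,j)\in\mathcal{A}$. Let $f\in\ell^2(\mathbb{Z}^N)$ be real valued. Then for every $x\in\mathbb{Z}^N$ $$R_{\alpha,\mathcal{A}}^2f(x)=-\lim_{T\to\infty}\mathbb{E}\bigl[M^{\alpha,\mathcal{A},f}_T\bigm|\widetilde{X}_T=x\bigr].$$ In particular, for $N=2$, $\mathcal{A}=\{(1,2),(2,1)\}$, $\alpha=(-1,-1)$, one has $R_{\alpha,\mathcal{A}}^2=B_{\mathfrak{i}}:=-R_1^+R_2^--R_1^-R_2^+$ and $M^{\{1,2\},f}=-M^{\alpha,\mathcal{A},f}$.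
   Context: **Operators.** For $f:\mathbb{Z}^N\to\mathbb{R}$, $\partial_i^+f(x)=f(x+e_i)-f(x)$, $\partial_i^-f(x)=f(x)-f(x-e_i)$, $\partial_i^2=\partial_i^+-\partial_i^-$, $\partial_i^0=\partial_i^++\partial_i^-$, $\Delta=\sum_i\partial_i^2$. $R_i^\pm=\partial_i^\pm\circ(-\Delta)^{-1/2}$ as Fourier multipliers on $\ell^2(\mathbb{Z}^N)$; $R_{(i,j)}^2=\frac14(R_i^+R_j^-+R_j^+R_i^-+R_i^-R_j^++R_j^-R_i^+)$ (so $R_{(i,i)}^2=R_i^+R_i^-$); $R_{\alpha,\mathcal{A}}^2=\sum_{i\in\mathcal{A}'}\alpha_iR_{(i,i)}^2+\sum_{\{i,j\}\in\mathcal{A}}2\alpha_iR_{(i,j)}^2$, the last sum over unordered pairs, each counted once. Heat extension: $\widetilde f(t,\cdot)=e^{t\Delta}f$. Write $\widetilde\nabla^2\varphi=(\partial_1^2\varphi,\ldots,\partial_N^2\varphi)$ and $\widetilde\nabla^0\varphi=(\partial_1^0\varphi,\ldots,\partial_N^0\varphi)$. **Process.** $\mathcal{N}^1,\ldots,\mathcal{N}^N$ are independent Poisson processes of intensity $2$, $\widetilde{\mathcal{N}}=(\mathcal{N}^1,\ldots,\mathcal{N}^N)$, $\mathcal{N}_t=\sum_i\mathcal{N}^i_t$; $(\tau_k)_{k\ge1}$ are i.i.d. signs with $\mathbb{P}(\tau_k=\pm1)=\frac12$, independent of $\widetilde{\mathcal{N}}$. The $\mathbb{Z}^N$-valued process $\widetilde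 X=(X^1,\ldots,X^N)$ satisfies $\mathrm{d}X^i_s=\tau_{\mathcal{N}_s}\,\mathrm{d}\mathcal{N}^i_s$ (a jump of $\mathcal{N}^i$ at time $s$ moves $\widetilde X$ by $\tau_{\mathcal{N}_s}e_i$). $\mathbb{P}_{x_0},\mathbb{E}_{x_0}$ denote law and expectation with $\widetilde X_0=x_0$. The unqualified $\mathbb{E}:=\sum_{x_0\in\mathbb{Z}^N}\mathbb{E}_{x_0}$ sums over all starting points (a $\sigma$-finite measure). Since $\sum_{x_0}\mathbb{P}_{x_0}(\widetilde X_T=x)=1$ for every $x$, $\mathbb{E}[Y\mid\widetilde X_T=x]=\sum_{x_0}\mathbb{E}_{x_0}[Y\mathbf{1}_{\{\widetilde X_T=x\}}]$. **Martingale transforms.** For an $N\times N$ matrix $A$ and $T>0$, define for $0\le t\le T$ $$M_t=\tfrac12\int_0^t\Bigl(\bigl\langle A\widetilde\nabla^2\widetilde f(T-s,\widetilde X_{s-}),\mathrm{d}(\widetilde{\mathcal{N}}_s-2s\mathbf{1})\bigr\rangle+\bigl\langle A\widetilde\nabla^0\widetilde f(T-s,\widetilde X_{s-}),\mathrm{d}\widetilde X_s\bigr\rangle\Bigr),\qquad \mathbf{1}=(1,\ldots,1),$$ with Euclidean pairings on $\mathbb{R}^N$. With $\mathbf e_1,\ldots,\mathbf e_N$ the canonical basis of $\mathbb{R}^N$, $A_{i,i}=\mathbf e_i\mathbf e_i^\top$ and, for $i\ne j$, $A_{i,j}=\mathbf e_i\mathbf e_j^\top+\mathbf e_j\mathbf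 e_i^\top$. $M^{\alpha,\mathcal{A},f}$ is this process for $A=\sum_{i\in\mathcal{A}'}\alpha_iA_{i,i}+\sum_{\{i,j\}\in\mathcal{A}}\alpha_iA_{i,j}$ (unordered pairs), and $M^{\{i,j\},f}$ is this process for $A=A_{i,j}$. These processes depend on $T$. *)

theory Defs
  imports "HOL-Probability.Probability"
begin

section \<open>Discrete calculus and the heat extension\<close>

text \<open>The lattice is \<open>int ^ 'n\<close>, with \<open>N = CARD('n)\<close>, and \<open>e\<^sub>i = axis i 1\<close>.\<close>

definition diff_plus :: "'n \<Rightarrow> (int ^ 'n \<Rightarrow> 'a::ab_group_add) \<Rightarrow> int ^ 'n \<Rightarrow> 'a" where
  "diff_plus i f x = f (x + axis i 1) - f x"

definition diff_minus :: "'n \<Rightarrow> (int ^ 'n \<Rightarrow> 'a::ab_group_add) \<Rightarrow> int ^ 'n \<Rightarrow> 'a" where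
  "diff_minus i f x = f x - f (x - axis i 1)"

definition diff_two :: "'n \<Rightarrow> (int ^ 'n \<Rightarrow> 'a::ab_group_add) \<Rightarrow> int ^ 'n \<Rightarrow> 'a" where
  "diff_two i f x = diff_plus i f x - diff_minus i f x"

definition diff_zero :: "'n \<Rightarrow> (int ^ 'n \<Rightarrow> 'a::ab_group_add) \<Rightarrow> int ^ 'n \<Rightarrow> 'a" where
  "diff_zero i f x = diff_plus i f x + diff_minus i f x"

definition laplacian :: "(int ^ 'n \<Rightarrow> 'a::ab_group_add) \<Rightarrow> int ^ 'n \<Rightarrow> 'a" where
  "laplacian f x = (\<Sum>i\<in>UNIV. diff_two i f x)"

definition grad_two :: "(int ^ 'n \<Rightarrow> real) \<Rightarrow> int ^ 'n \<Rightarrow> real ^ 'n" where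
  "grad_two f x = (\<chi> i. diff_two i f x)"

definition grad_zero :: "(int ^ 'n \<Rightarrow> real) \<Rightarrow> int ^ 'n \<Rightarrow> real ^ 'n" where
  "grad_zero f x = (\<chi> i. diff_zero i f x)"

text \<open>The Laplacian is a bounded operator on \<open>\<ell>\<^sup>2\<close>, so its semigroup is given by the
  exponential series, evaluated here at each point.\<close>

definition heat :: "real \<Rightarrow> (int ^ 'n \<Rightarrow> real) \<Rightarrow> int ^ 'n \<Rightarrow> real" where
  "heat t f x = (\<Sum>k. t ^ k / fact k * (laplacian ^^ k) f x)"

definition in_l2 :: "('b \<Rightarrow> 'a::real_normed_vector) \<Rightarrow> bool" where
  "in_l2 g \<longleftrightarrow> (\<lambda>x. (norm (g x))\<^sup>2) summable_on UNIV"


section \<open>Fourier multipliers and Riesz transforms\<close>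

definition torus :: "(real ^ 'n) measure" where
  "torus = restrict_space lborel (cbox 0 1)"

definition character :: "int ^ 'n \<Rightarrow> real ^ 'n \<Rightarrow> complex" where
  "character x \<xi> = cis (2 * pi * (\<Sum>i\<in>UNIV. of_int (x $ i) * \<xi> $ i))"

text \<open>The Fourier transform of \<open>g \<in> \<ell>\<^sup>2\<close> is the limit in \<open>L\<^sup>2\<close> of the torus of the finite
  partial sums of \<open>\<Sum>\<^sub>y g(y) exp (- 2 \<pi> i y \<cdot> \<xi>)\<close>. It exists by completeness and is unique
  up to a null set.\<close>

definition is_fourier :: "(int ^ 'n \<Rightarrow> complex) \<Rightarrow> (real ^ 'n \<Rightarrow> complex) \<Rightarrow> bool" where
  "is_fourier g F \<longleftrightarrow>
     F \<in> borel_measurable torus \<and> integrable torus (\<lambda>\<xi>. (cmod (F \<xi>))\<^sup>2) \<and>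
     ((\<lambda>S. \<integral>\<xi>. (cmod (F \<xi> - (\<Sum>y\<in>S. g y * cnj (character y \<xi>))))\<^sup>2 \<partial>torus) \<longlongrightarrow> 0)
       (finite_subsets_at_top UNIV)"

definition fourier :: "(int ^ 'n \<Rightarrow> complex) \<Rightarrow> real ^ 'n \<Rightarrow> complex" where
  "fourier g = (SOME F. is_fourier g F)"

definition multiplier ::
  "(real ^ 'n \<Rightarrow> complex) \<Rightarrow> (int ^ 'n \<Rightarrow> complex) \<Rightarrow> int ^ 'n \<Rightarrow> complex" where
  "multiplier m g x = (\<integral>\<xi>. m \<xi> * fourier g \<xi> * character x \<xi> \<partial>torus)"

text \<open>Symbols of \<open>\<partial>\<^sub>i\<^sup>+\<close>, \<open>\<partial>\<^sub>i\<^sup>-\<close> and \<open>-\<Delta>\<close>; the last one vanishes only on a null set of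
  the torus.\<close>

definition plus_symbol :: "'n \<Rightarrow> real ^ 'n \<Rightarrow> complex" where
  "plus_symbol i \<xi> = cis (2 * pi * \<xi> $ i) - 1"

definition minus_symbol :: "'n \<Rightarrow> real ^ 'n \<Rightarrow> complex" where
  "minus_symbol i \<xi> = 1 - cis (- (2 * pi * \<xi> $ i))"

definition neg_laplacian_symbol :: "real ^ 'n \<Rightarrow> real" where
  "neg_laplacian_symbol \<xi> = (\<Sum>j\<in>UNIV. 2 - 2 * cos (2 * pi * \<xi> $ j))"

definition riesz_plus :: "'n \<Rightarrow> (int ^ 'n \<Rightarrow> complex) \<Rightarrow> int ^ 'n \<Rightarrow> complex" where
  "riesz_plus i =
     multiplier (\<lambda>\<xi>. plus_symbol i \<xi> / complex_of_real (sqrt (neg_laplacian_symbol \<xi>)))"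

definition riesz_minus :: "'n \<Rightarrow> (int ^ 'n \<Rightarrow> complex) \<Rightarrow> int ^ 'n \<Rightarrow> complex" where
  "riesz_minus i =
     multiplier (\<lambda>\<xi>. minus_symbol i \<xi> / complex_of_real (sqrt (neg_laplacian_symbol \<xi>)))"

definition riesz2 :: "'n \<Rightarrow> 'n \<Rightarrow> (int ^ 'n \<Rightarrow> complex) \<Rightarrow> int ^ 'n \<Rightarrow> complex" where
  "riesz2 i j g x = 1/4 *
     (riesz_plus i (riesz_minus j g) x + riesz_plus j (riesz_minus i g) x
      + riesz_minus i (riesz_plus j g) x + riesz_minus j (riesz_plus i g) x)"

text \<open>Sum over the unordered pairs \<open>{i, j}\<close> with \<open>(i, j) \<in> A\<close>, each counted once. It is meant
  for symmetric \<open>A\<close> and for \<open>h\<close> symmetric on \<open>A\<close>, where the enumeration \<open>(i, j)\<close> chosen for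
  each pair is irrelevant.\<close>

definition sum_unordered :: "('n \<times> 'n) set \<Rightarrow> ('n \<Rightarrow> 'n \<Rightarrow> 'b::comm_monoid_add) \<Rightarrow> 'b" where
  "sum_unordered A h =
     (\<Sum>e\<in>(\<lambda>(i, j). {i, j}) ` A. case_prod h (SOME p. {fst p, snd p} = e))"

text \<open>The index set of those \<open>i\<close> that belong to no pair of \<open>A\<close> is \<open>- Field A\<close>.\<close>

definition riesz2_comb ::
  "real ^ 'n \<Rightarrow> ('n \<times> 'n) set \<Rightarrow> (int ^ 'n \<Rightarrow> complex) \<Rightarrow> int ^ 'n \<Rightarrow> complex" where
  "riesz2_comb \<alpha> A g x =
     (\<Sum>i\<in>- Field A. complex_of_real (\<alpha> $ i) * riesz2 i i g x)
     + sum_unordered A (\<lambda>i j. 2 * complex_of_real (\<alpha> $ i) * riesz2 i j g x)"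


section \<open>The driving noise and the random walk\<close>

definition poisson_process :: "'w measure \<Rightarrow> real \<Rightarrow> (real \<Rightarrow> 'w \<Rightarrow> nat) \<Rightarrow> bool" where
  "poisson_process \<Omega> r P \<longleftrightarrow>
     (\<forall>t\<ge>0. P t \<in> measurable \<Omega> (count_space UNIV)) \<and>
     (\<forall>\<omega>\<in>space \<Omega>. P 0 \<omega> = 0 \<and> mono_on {0..} (\<lambda>t. P t \<omega>) \<and>
        (\<forall>t\<ge>0. continuous (at_right t) (\<lambda>s. P s \<omega>))) \<and>
     (\<forall>t. mono t \<longrightarrow> 0 \<le> t 0 \<longrightarrow>
        prob_space.indep_vars \<Omega> (\<lambda>_. count_space UNIV)
          (\<lambda>k \<omega>. P (t (Suc k)) \<omega> - P (t k) \<omega>) (UNIV :: nat set)) \<and>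
     (\<forall>s t. 0 \<le> s \<longrightarrow> s < t \<longrightarrow>
        distr \<Omega> (count_space UNIV) (\<lambda>\<omega>. P t \<omega> - P s \<omega>) = measure_pmf (poisson_pmf (r * (t - s))))"

locale walk_noise = prob_space \<Omega>
  for \<Omega> :: "'w measure"
    and \<N> :: "'n::finite \<Rightarrow> real \<Rightarrow> 'w \<Rightarrow> nat"
    and \<tau> :: "nat \<Rightarrow> 'w \<Rightarrow> int" +
  assumes poisson: "\<And>i. poisson_process \<Omega> 2 (\<N> i)"
    and indep_poisson:
      "indep_vars (\<lambda>_. Pi\<^sub>M {0..} (\<lambda>_. count_space UNIV)) (\<lambda>i \<omega>. \<lambda>t\<in>{0..}. \<N> i t \<omega>) UNIV"
    and indep_signs: "indep_vars (\<lambda>_. count_space UNIV) \<tau> {1..}"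
    and sign_plus: "\<And>k. 1 \<le> k \<Longrightarrow> prob {\<omega> \<in> space \<Omega>. \<tau> k \<omega> = 1} = 1/2"
    and sign_minus: "\<And>k. 1 \<le> k \<Longrightarrow> prob {\<omega> \<in> space \<Omega>. \<tau> k \<omega> = -1} = 1/2"
    and indep_signs_poisson:
      "indep_set
         (sets (vimage_algebra (space \<Omega>) (\<lambda>\<omega>. \<lambda>k\<in>{1..}. \<tau> k \<omega>)
                  (Pi\<^sub>M {1..} (\<lambda>_. count_space UNIV))))
         (sets (vimage_algebra (space \<Omega>) (\<lambda>\<omega>. \<lambda>(i, t)\<in>UNIV \<times> {0..}. \<N> i t \<omega>)
                  (Pi\<^sub>M (UNIV \<times> {0..}) (\<lambda>_. count_space UNIV))))"

text \<open>\<open>stieltjes_int g H t\<close> is the Lebesgue--Stieltjes integral of \<open>H\<close> over \<open>(0, t]\<close> against a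
  piecewise constant right-continuous integer-valued path \<open>g\<close> with finitely many jumps on bounded
  intervals. All paths integrated against below are of this kind.\<close>

definition jump :: "(real \<Rightarrow> int) \<Rightarrow> real \<Rightarrow> int" where
  "jump g s = g s - Lim (at_left s) g"

definition stieltjes_int :: "(real \<Rightarrow> int) \<Rightarrow> (real \<Rightarrow> 'a::ring_1) \<Rightarrow> real \<Rightarrow> 'a" where
  "stieltjes_int g H t = (\<Sum>s\<in>{s\<in>{0<..t}. jump g s \<noteq> 0}. H s * of_int (jump g s))"

text \<open>The walk started at \<open>x\<^sub>0\<close>. The law \<open>P\<^sub>x\<^sub>0\<close> is realised on the fixed space carrying the
  noise by varying \<open>x\<^sub>0\<close> here.\<close>

definition walk ::
  "('n::finite \<Rightarrow> real \<Rightarrow> 'w \<Rightarrow> nat) \<Rightarrow> (nat \<Rightarrow> 'w \<Rightarrow> int) \<Rightarrow> int ^ 'n \<Rightarrow> real \<Rightarrow> 'w \<Rightarrow> int ^ 'n" where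
  "walk \<N> \<tau> x\<^sub>0 t \<omega> =
     (\<chi> i. x\<^sub>0 $ i + stieltjes_int (\<lambda>s. int (\<N> i s \<omega>)) (\<lambda>s. \<tau> (\<Sum>j\<in>UNIV. \<N> j s \<omega>) \<omega>) t)"

definition walk_left ::
  "('n::finite \<Rightarrow> real \<Rightarrow> 'w \<Rightarrow> nat) \<Rightarrow> (nat \<Rightarrow> 'w \<Rightarrow> int) \<Rightarrow> int ^ 'n \<Rightarrow> real \<Rightarrow> 'w \<Rightarrow> int ^ 'n" where
  "walk_left \<N> \<tau> x\<^sub>0 s \<omega> = (\<chi> i. Lim (at_left s) (\<lambda>u. walk \<N> \<tau> x\<^sub>0 u \<omega> $ i))"


section \<open>Martingale transforms\<close>

definition mtransform ::
  "('n::finite \<Rightarrow> real \<Rightarrow> 'w \<Rightarrow> nat) \<Rightarrow> (nat \<Rightarrow> 'w \<Rightarrow> int) \<Rightarrow> real ^ 'n ^ 'n \<Rightarrow> (int ^ 'n \<Rightarrow> real)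
     \<Rightarrow> real \<Rightarrow> int ^ 'n \<Rightarrow> real \<Rightarrow> 'w \<Rightarrow> real" where
  "mtransform \<N> \<tau> A f T x\<^sub>0 t \<omega> =
     (let H2 = (\<lambda>i s. (A *v grad_two (heat (T - s) f) (walk_left \<N> \<tau> x\<^sub>0 s \<omega>)) $ i);
          H0 = (\<lambda>i s. (A *v grad_zero (heat (T - s) f) (walk_left \<N> \<tau> x\<^sub>0 s \<omega>)) $ i)
      in 1/2 * (\<Sum>i\<in>UNIV.
           stieltjes_int (\<lambda>s. int (\<N> i s \<omega>)) (H2 i) t - 2 * (LBINT s:{0..t}. H2 i s)
           + stieltjes_int (\<lambda>s. walk \<N> \<tau> x\<^sub>0 s \<omega> $ i) (H0 i) t))"

definition outer :: "real ^ 'n \<Rightarrow> real ^ 'n \<Rightarrow> real ^ 'n ^ 'n" where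
  "outer u v = (\<chi> k l. u $ k * v $ l)"

definition pair_matrix :: "'n::finite \<Rightarrow> 'n \<Rightarrow> real ^ 'n ^ 'n" where
  "pair_matrix i j =
     (if i = j then outer (axis i 1) (axis i 1)
      else outer (axis i 1) (axis j 1) + outer (axis j 1) (axis i 1))"

definition comb_matrix :: "real ^ 'n \<Rightarrow> ('n \<times> 'n) set \<Rightarrow> real ^ 'n ^ 'n" where
  "comb_matrix \<alpha> A =
     (\<Sum>i\<in>- Field A. \<alpha> $ i *\<^sub>R pair_matrix i i)
     + sum_unordered A (\<lambda>i j. \<alpha> $ i *\<^sub>R pair_matrix i j)"

text \<open>\<open>cond_expect \<Omega> Y X x\<close> is \<open>E[Y | X = x] = \<Sum>\<^sub>x\<^sub>0 E\<^sub>x\<^sub>0[Y 1\<^bsub>{X = x}\<^esub>]\<close> for the \<open>\<sigma>\<close>-finite measure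
  that sums over all starting points. \<open>cond_expect_exists\<close> says that the expectations and the
  series are well-defined, so that no default value of a diverging integral or sum is used.\<close>

definition cond_expect ::
  "'w measure \<Rightarrow> (int ^ 'n \<Rightarrow> 'w \<Rightarrow> real) \<Rightarrow> (int ^ 'n \<Rightarrow> 'w \<Rightarrow> int ^ 'n) \<Rightarrow> int ^ 'n \<Rightarrow> real" where
  "cond_expect \<Omega> Y X x =
     (\<Sum>\<^sub>\<infinity>x\<^sub>0\<in>UNIV. \<integral>\<omega>. Y x\<^sub>0 \<omega> * indicator {\<omega>. X x\<^sub>0 \<omega> = x} \<omega> \<partial>\<Omega>)"

definition cond_expect_exists ::
  "'w measure \<Rightarrow> (int ^ 'n \<Rightarrow> 'w \<Rightarrow> real) \<Rightarrow> (int ^ 'n \<Rightarrow> 'w \<Rightarrow> int ^ 'n) \<Rightarrow> int ^ 'n \<Rightarrow> bool" where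
  "cond_expect_exists \<Omega> Y X x \<longleftrightarrow>
     (\<forall>x\<^sub>0. integrable \<Omega> (\<lambda>\<omega>. Y x\<^sub>0 \<omega> * indicator {\<omega>. X x\<^sub>0 \<omega> = x} \<omega>)) \<and>
     (\<lambda>x\<^sub>0. \<integral>\<omega>. Y x\<^sub>0 \<omega> * indicator {\<omega>. X x\<^sub>0 \<omega> = x} \<omega> \<partial>\<Omega>) summable_on UNIV"

end

theory Submission
  imports Defs
begin

text \<open>
  Everything is computed in Fourier space, where \<open>e\<^bsup>t\<Delta>\<^esup>\<close> acts by \<open>e\<^bsup>-tL\<^esup>\<close> with
  \<open>L(\<xi>) = \<Sum>\<^sub>j (2 - 2 cos (2 \<pi> \<xi>\<^sub>j))\<close>, and \<open>\<partial>\<^sub>i\<^sup>2\<close>, \<open>\<partial>\<^sub>i\<^sup>0\<close> act by \<open>2 cos \<theta>\<^sub>i - 2\<close>, \<open>2 i sin \<theta>\<^sub>i\<close>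
  with \<open>\<theta>\<^sub>i = 2 \<pi> \<xi>\<^sub>i\<close>. Summing over the starting points replaces \<open>x\<^sub>0\<close> by \<open>x - W\<^sub>T\<close>, where \<open>W\<close> is
  the walk from the origin, so the conditional expectation is \<open>E[M\<^sub>T]\<close> for this random starting
  point. On dyadic grids the stochastic integral is a pathwise limit of Riemann sums, and each of
  them is an integral over \<open>\<xi>\<close> of increments of the noise times the character of \<open>W\<^sub>t - W\<^sub>T\<close>.
  As long as no cell of the grid contains two jumps, the walk increments are noise increments times
  distinct signs, and averaging over the signs turns the character into a product of powers of
  \<open>cos \<theta>\<^sub>j\<close> whose Poisson expectation is explicit; two jumps in one cell have probability
  tending to \<open>0\<close>. Per unit of time the jumps in direction \<open>i\<close> contribute \<open>2 cos \<theta>\<^sub>i - 2\<close> (after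
  compensation) to the \<open>\<partial>\<^sup>2\<close> part and \<open>- 2 i sin \<theta>\<^sub>i\<close> to the \<open>\<partial>\<^sup>0\<close> part, so the time integral has the density
  \<open>1/2 \<Sum>\<^sub>i\<^sub>j A\<^sub>i\<^sub>j (\<partial>\<^sub>i\<^sup>2 \<partial>\<^sub>j\<^sup>2 - \<partial>\<^sub>i\<^sup>0 \<partial>\<^sub>j\<^sup>0) e\<^bsup>2t\<Delta>\<^esup>\<close>. Integrating over \<open>t\<close> produces
  \<open>(1 - e\<^bsup>-2TL\<^esup>) / (2 L)\<close>, and \<open>T \<rightarrow> \<infinity>\<close> leaves the symbol of the second order Riesz transform.
\<close>

text \<open>For a fixed starting point the transform is a martingale and its mean vanishes. The
  starting point \<open>x - W T\<close> looks into the future, so the increment over a cell is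
  correlated with the character of W_t - W_T, and this correlation is the whole answer: a jump of
  sign s in direction i has weight B_i + C_i s and phase e^(-i s theta_i), with average B_i cos
  theta_i - i C_i sin theta_i. As adaptedness is lost, the expectations are computed by hand on
  finite Riemann sums. The signs are indexed by the total number of jumps, which is itself random;
  they turn into independent factors only once the noise is frozen. One factor e^(t Delta) of e^(2t
  Delta) is the heat extension, the other is the average of the character over the remaining time.
  On the analytic side \<open>fourier\<close> is a choice up to null sets and the Riesz transforms
  are iterated multipliers, so the transform of \<open>multiplier m g\<close> must be identified;
  this happens inside the closed span of the characters, which the symbols in question
  preserve.\<close>

section \<open>Square-integrable complex functions\<close>

definition square_integrable :: "'a measure \<Rightarrow> ('a \<Rightarrow> complex) \<Rightarrow> bool" where
  "square_integrable M F \<longleftrightarrow> F \<in> borel_measurable M \<and> integrable M (\<lambda>x. (cmod (F x))\<^sup>2)"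

lemma cmod_add_square_le: "(cmod (a + b))\<^sup>2 \<le> 2 * (cmod a)\<^sup>2 + 2 * (cmod b)\<^sup>2"
proof -
  have "(cmod (a + b))\<^sup>2 \<le> (cmod a + cmod b)\<^sup>2"
    by (intro power_mono norm_triangle_ineq norm_ge_zero)
  also have "\<dots> \<le> 2 * (cmod a)\<^sup>2 + 2 * (cmod b)\<^sup>2"
    using sum_squares_bound[of "cmod a" "cmod b"] by (simp add: power2_sum)
  finally show ?thesis .
qed

lemma square_integrable_add:
  assumes "square_integrable M F" "square_integrable M G"
  shows "square_integrable M (\<lambda>x. F x + G x)"
    and "(\<integral>x. (cmod (F x + G x))\<^sup>2 \<partial>M) \<le> 2 * (\<integral>x. (cmod (F x))\<^sup>2 \<partial>M) + 2 * (\<integral>x. (cmod (G x))\<^sup>2 \<partial>M)"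
proof -
  have [measurable]: "F \<in> borel_measurable M" "G \<in> borel_measurable M"
    using assms by (auto simp: square_integrable_def)
  have int: "integrable M (\<lambda>x. 2 * (cmod (F x))\<^sup>2 + 2 * (cmod (G x))\<^sup>2)"
    using assms by (auto simp: square_integrable_def)
  have "integrable M (\<lambda>x. (cmod (F x + G x))\<^sup>2)"
    by (rule Bochner_Integration.integrable_bound[OF int]) (auto intro!: AE_I2 order_trans[OF cmod_add_square_le])
  then show si: "square_integrable M (\<lambda>x. F x + G x)"
    by (simp add: square_integrable_def)
  have "(\<integral>x. (cmod (F x + G x))\<^sup>2 \<partial>M) \<le> (\<integral>x. 2 * (cmod (F x))\<^sup>2 + 2 * (cmod (G x))\<^sup>2 \<partial>M)"
    using si int by (intro integral_mono cmod_add_square_le) (auto simp: square_integrable_def)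
  also have "\<dots> = 2 * (\<integral>x. (cmod (F x))\<^sup>2 \<partial>M) + 2 * (\<integral>x. (cmod (G x))\<^sup>2 \<partial>M)"
    using assms by (subst Bochner_Integration.integral_add) (auto simp: square_integrable_def)
  finally show "(\<integral>x. (cmod (F x + G x))\<^sup>2 \<partial>M) \<le> 2 * (\<integral>x. (cmod (F x))\<^sup>2 \<partial>M) + 2 * (\<integral>x. (cmod (G x))\<^sup>2 \<partial>M)" .
qed

lemma square_integrable_bounded_mult:
  assumes "square_integrable M F" "m \<in> borel_measurable M" "\<And>x. x \<in> space M \<Longrightarrow> cmod (m x) \<le> B"
  shows "square_integrable M (\<lambda>x. m x * F x)"
    and "(\<integral>x. (cmod (m x * F x))\<^sup>2 \<partial>M) \<le> B\<^sup>2 * (\<integral>x. (cmod (F x))\<^sup>2 \<partial>M)"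
proof -
  have [measurable]: "F \<in> borel_measurable M" "m \<in> borel_measurable M"
    using assms by (auto simp: square_integrable_def)
  have int: "integrable M (\<lambda>x. B\<^sup>2 * (cmod (F x))\<^sup>2)"
    using assms by (auto simp: square_integrable_def)
  have le: "(cmod (m x * F x))\<^sup>2 \<le> B\<^sup>2 * (cmod (F x))\<^sup>2" if "x \<in> space M" for x
    using assms(3)[OF that] by (auto simp: norm_mult power_mult_distrib intro!: mult_right_mono power_mono)
  have "integrable M (\<lambda>x. (cmod (m x * F x))\<^sup>2)"
    by (rule Bochner_Integration.integrable_bound[OF int]) (use le in \<open>auto intro!: AE_I2\<close>)
  then show si: "square_integrable M (\<lambda>x. m x * F x)"
    by (simp add: square_integrable_def)
  have "(\<integral>x. (cmod (m x * F x))\<^sup>2 \<partial>M) \<le> (\<integral>x. B\<^sup>2 * (cmod (F x))\<^sup>2 \<partial>M)"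
    using si int by (intro integral_mono le) (auto simp: square_integrable_def)
  then show "(\<integral>x. (cmod (m x * F x))\<^sup>2 \<partial>M) \<le> B\<^sup>2 * (\<integral>x. (cmod (F x))\<^sup>2 \<partial>M)" by simp
qed

lemma square_integrable_cmult:
  "square_integrable M F \<Longrightarrow> square_integrable M (\<lambda>x. c * F x)"
  using square_integrable_bounded_mult(1)[of M F "\<lambda>_. c" "cmod c"] by simp

lemma square_integrable_diff:
  assumes "square_integrable M F" "square_integrable M G"
  shows "square_integrable M (\<lambda>x. F x - G x)"
  using square_integrable_add(1)[OF assms(1) square_integrable_cmult[OF assms(2), of "-1"]] by simp

lemma square_integrable_sum:
  assumes "\<And>i. i \<in> I \<Longrightarrow> square_integrable M (F i)"
  shows "square_integrable M (\<lambda>x. \<Sum>i\<in>I. F i x)"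
  using assms
proof (induction I rule: infinite_finite_induct)
  case (insert i I)
  then show ?case using square_integrable_add(1)[of M "F i" "\<lambda>x. \<Sum>i\<in>I. F i x"] by simp
qed (auto simp: square_integrable_def)

lemma integral_cmod_diff_square:
  assumes "integrable M (\<lambda>x. (cmod (G x))\<^sup>2)" "integrable M (\<lambda>x. (cmod (P x))\<^sup>2)"
    and "integrable M (\<lambda>x. G x * cnj (P x))"
  shows "(\<integral>x. (cmod (G x - P x))\<^sup>2 \<partial>M) = (\<integral>x. (cmod (G x))\<^sup>2 \<partial>M)
    - 2 * Re (\<integral>x. G x * cnj (P x) \<partial>M) + (\<integral>x. (cmod (P x))\<^sup>2 \<partial>M)"
proof -
  have "(cmod (G x - P x))\<^sup>2 = (cmod (G x))\<^sup>2 - 2 * Re (G x * cnj (P x)) + (cmod (P x))\<^sup>2" for x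
    unfolding cmod_power2 by (simp add: power2_eq_square algebra_simps)
  then have "(\<integral>x. (cmod (G x - P x))\<^sup>2 \<partial>M)
      = (\<integral>x. (cmod (G x))\<^sup>2 - 2 * Re (G x * cnj (P x)) + (cmod (P x))\<^sup>2 \<partial>M)"
    by (simp only:)
  also have "\<dots> = (\<integral>x. (cmod (G x))\<^sup>2 \<partial>M) - (\<integral>x. 2 * Re (G x * cnj (P x)) \<partial>M)
      + (\<integral>x. (cmod (P x))\<^sup>2 \<partial>M)"
    using assms(1,2) integrable_Re[OF assms(3)]
    by (simp only: Bochner_Integration.integral_add Bochner_Integration.integral_diff
        Bochner_Integration.integrable_diff integrable_mult_right)
  also have "(\<integral>x. 2 * Re (G x * cnj (P x)) \<partial>M) = 2 * Re (\<integral>x. G x * cnj (P x) \<partial>M)"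
    using assms(3) by (simp only: integral_mult_right_zero integral_Re)
  finally show ?thesis .
qed

lemma (in finite_measure) square_integrable_bounded:
  assumes "F \<in> borel_measurable M" "\<And>x. x \<in> space M \<Longrightarrow> cmod (F x) \<le> B"
  shows "square_integrable M F"
proof -
  have "square_integrable M (\<lambda>x. F x * 1)"
    by (rule square_integrable_bounded_mult(1)[OF _ assms]) (auto simp: square_integrable_def)
  then show ?thesis by simp
qed

lemma (in finite_measure) square_integrable_imp_integrable_complex:
  assumes "square_integrable M F" shows "integrable M F"
proof (rule Bochner_Integration.integrable_bound)
  show "integrable M (\<lambda>x. 1 + (cmod (F x))\<^sup>2)" "F \<in> borel_measurable M"
    using assms by (auto simp: square_integrable_def)
  show "AE x in M. norm (F x) \<le> norm (1 + (cmod (F x))\<^sup>2)"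
  proof (intro AE_I2)
    fix x
    have "cmod (F x) \<le> 1 + (cmod (F x))\<^sup>2"
      using sum_squares_bound[of "cmod (F x)" 1] norm_ge_zero[of "F x"] by (simp only: power_one)
    then show "norm (F x) \<le> norm (1 + (cmod (F x))\<^sup>2)" by simp
  qed
qed

text \<open>The variance of \<open>cmod (F x)\<close> under a probability measure is
  nonnegative.\<close>

lemma (in prob_space) integral_cmod_square_le:
  assumes "square_integrable M F"
  shows "(\<integral>x. cmod (F x) \<partial>M)\<^sup>2 \<le> (\<integral>x. (cmod (F x))\<^sup>2 \<partial>M)"
proof -
  let ?c = "\<integral>x. cmod (F x) \<partial>M"
  have int: "integrable M (\<lambda>x. cmod (F x))" "integrable M (\<lambda>x. (cmod (F x))\<^sup>2)"
    using square_integrable_imp_integrable_complex[OF assms] assms by (auto simp: square_integrable_def)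
  have "0 \<le> (\<integral>x. (cmod (F x) - ?c)\<^sup>2 \<partial>M)" by simp
  also have "(\<integral>x. (cmod (F x) - ?c)\<^sup>2 \<partial>M) = (\<integral>x. (cmod (F x))\<^sup>2 - 2 * ?c * cmod (F x) + ?c\<^sup>2 \<partial>M)"
    by (simp add: power2_diff algebra_simps)
  also have "\<dots> = (\<integral>x. (cmod (F x))\<^sup>2 \<partial>M) - 2 * ?c * ?c + ?c\<^sup>2"
    using int by (simp add: prob_space)
  finally show ?thesis by (simp add: power2_eq_square)
qed

section \<open>Fourier series on the torus\<close>

lemma space_torus: "space (torus :: (real ^ 'n::finite) measure) = cbox 0 1"
  by (simp add: torus_def space_restrict_space)

lemma measurable_torus [measurable (raw)]:
  "f \<in> borel_measurable borel \<Longrightarrow> f \<in> borel_measurable (torus :: (real ^ 'n::finite) measure)"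
  unfolding torus_def by (intro measurable_restrict_space1) simp

lemma emeasure_cube: "emeasure lborel (cbox 0 (1 :: real ^ 'n::finite)) = 1"
proof -
  have "emeasure lborel (cbox 0 (1 :: real ^ 'n)) = (\<Prod>b\<in>Basis. ((1 :: real ^ 'n) - 0) \<bullet> b)"
    by (subst emeasure_lborel_cbox) (auto simp: Basis_vec_def inner_axis)
  also have "(\<Prod>b\<in>Basis. ((1 :: real ^ 'n) - 0) \<bullet> b) = 1"
    by (intro prod.neutral) (auto simp: Basis_vec_def inner_axis)
  finally show ?thesis by simp
qed

lemma prob_space_torus: "prob_space (torus :: (real ^ 'n::finite) measure)"
  by (rule prob_spaceI) (simp add: space_torus emeasure_cube torus_def emeasure_restrict_space)

interpretation torus: prob_space "torus :: (real ^ 'n::finite) measure"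
  by (rule prob_space_torus)

lemma borel_measurable_vec_component [measurable (raw)]:
  "f \<in> borel_measurable M \<Longrightarrow> (\<lambda>x. (f x :: real ^ 'n::finite) $ i) \<in> borel_measurable M"
  by (rule measurable_compose[of f M borel "\<lambda>x. x $ i"])
     (auto intro!: borel_measurable_continuous_onI continuous_intros)

lemma borel_measurable_cis [measurable (raw)]:
  "f \<in> borel_measurable M \<Longrightarrow> (\<lambda>x. cis (f x)) \<in> borel_measurable M"
  using measurable_compose[of f M borel cis borel] 
  by (simp add: borel_measurable_continuous_onI continuous_on_cis)

lemma character_measurable [measurable]: "character x \<in> borel_measurable borel"
  unfolding character_def by measurable

lemma character_torus [measurable]: "character x \<in> borel_measurable torus"
  by (rule measurable_torus) measurable

lemma norm_character [simp]: "cmod (character x \<xi>) = 1"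
  by (simp add: character_def)

lemma cnj_character: "cnj (character x \<xi>) = character (- x) \<xi>"
  by (simp add: character_def cis_cnj sum_negf)

lemma character_add: "character (x + y) \<xi> = character x \<xi> * character y \<xi>"
  by (simp add: character_def cis_mult sum.distrib algebra_simps)

lemma character_0 [simp]: "character 0 \<xi> = 1"
  by (simp add: character_def)

lemma character_axis: "character (axis i 1) \<xi> = cis (2 * pi * \<xi> $ i)"
proof -
  have "(\<Sum>j\<in>UNIV. real_of_int (axis i 1 $ j) * \<xi> $ j) = (\<Sum>j\<in>UNIV. if j = i then \<xi> $ j else 0)"
    by (intro sum.cong) (auto simp: axis_def)
  then show ?thesis by (simp add: character_def)
qed

lemma integral_cis_unit_interval:
  assumes "k \<in> \<int>"
  shows "has_bochner_integral lborel (\<lambda>t. indicator {0..1} t *\<^sub>R cis (2 * pi * (k * t))) (if k = 0 then 1 else 0)"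
proof (cases "k = 0")
  case True
  have "has_bochner_integral lborel (\<lambda>t::real. indicator {0..1} t *\<^sub>R (1::complex)) 1"
  proof (intro has_bochner_integral_FTC_Icc[of 0 1 complex_of_real "\<lambda>_. 1", simplified])
    show "(complex_of_real has_vector_derivative 1) (at t within {0..1})" for t
      unfolding has_vector_derivative_def
      by (auto intro!: derivative_eq_intros simp: scaleR_conv_of_real)
  qed
  with True show ?thesis by simp
next
  case False
  let ?F = "\<lambda>t. cis (2 * pi * (k * t)) / (\<i> * of_real (2 * pi * k))"
  have "has_bochner_integral lborel (\<lambda>t. indicator {0..1} t *\<^sub>R cis (2 * pi * (k * t))) (?F 1 - ?F 0)"
  proof (intro has_bochner_integral_FTC_Icc)
    fix t :: real
    define c where "c = \<i> * complex_of_real (2 * pi * k)"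
    have "c \<noteq> 0" using False by (simp add: c_def)
    then have "((\<lambda>z. exp (c * z) / c) has_field_derivative exp (c * of_real t)) (at (of_real t))"
      by (auto intro!: derivative_eq_intros)
    from has_vector_derivative_real_field[OF this]
    have "((\<lambda>t. exp (c * of_real t) / c) has_vector_derivative exp (c * of_real t)) (at t within {0..1})" .
    then show "(?F has_vector_derivative cis (2 * pi * (k * t))) (at t within {0..1})"
      by (simp add: cis_conv_exp c_def mult_ac)
  qed (auto intro!: continuous_intros)
  moreover have "cis (2 * pi * k) = 1"
    using assms cis_multiple_2pi[of k] by (simp add: mult_ac)
  ultimately show ?thesis using False by simp
qed

text \<open>Orthogonality of the characters. Lebesgue measure is the image of a product measure
  indexed by \<open>Basis\<close>, so the integral over the cube splits into one-dimensional
  integrals, each of which sees a single integer frequency.\<close>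

lemma integral_character:
  "(\<integral>\<xi>. character x \<xi> \<partial>torus) = (if x = (0 :: int ^ 'n::finite) then 1 else 0)"
proof -
  interpret P: product_sigma_finite "\<lambda>_ :: real ^ 'n. lborel :: real measure" ..
  define X :: "real ^ 'n" where "X = (\<chi> i. real_of_int (x $ i))"
  have XI: "X \<bullet> b \<in> \<int>" if "b \<in> Basis" for b
    using that by (auto simp: X_def Basis_vec_def inner_axis)
  have ch: "character x \<xi> = cis (2 * pi * (X \<bullet> \<xi>))" for \<xi>
    by (simp add: character_def X_def inner_vec_def)
  let ?g = "\<lambda>b t. indicator {0..1} t *\<^sub>R cis (2 * pi * (X \<bullet> b * t))"
  have prod_cis: "(\<Prod>b\<in>S. cis (h b)) = cis (sum h S)" if "finite S" for S :: "(real^'n) set" and h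
    using that by induction (auto simp: cis_mult)
  have eq: "indicator (cbox 0 1) (\<Sum>b\<in>Basis. f b *\<^sub>R b) *\<^sub>R character x (\<Sum>b\<in>Basis. f b *\<^sub>R b)
        = (\<Prod>b\<in>Basis. ?g b (f b))" for f :: "real ^ 'n \<Rightarrow> real"
  proof -
    let ?v = "\<Sum>b\<in>Basis. f b *\<^sub>R b"
    have "?v \<in> cbox 0 1 \<longleftrightarrow> (\<forall>b\<in>Basis. f b \<in> {0..1})"
      by (auto simp: mem_box inner_sum_left_Basis) (auto simp: Basis_vec_def inner_axis)
    then have ind: "indicator (cbox 0 1) ?v = (\<Prod>b\<in>Basis. indicator {0..1} (f b) :: real)"
      by (auto simp: indicator_def prod_zero_iff intro!: prod.neutral[symmetric])
    have "X \<bullet> ?v = (\<Sum>b\<in>Basis. X \<bullet> b * f b)"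
      by (simp add: inner_sum_right mult.commute)
    then have "character x ?v = (\<Prod>b\<in>Basis. cis (2 * pi * (X \<bullet> b * f b)))"
      by (simp add: ch prod_cis sum_distrib_left)
    then show ?thesis unfolding ind by (simp only: scaleR_conv_of_real of_real_prod prod.distrib)
  qed
  have "(\<integral>\<xi>. character x \<xi> \<partial>torus) = (\<integral>\<xi>. indicator (cbox 0 1) \<xi> *\<^sub>R character x \<xi> \<partial>lborel)"
    unfolding torus_def by (subst integral_restrict_space) auto
  also have "\<dots> = (\<integral>f. indicator (cbox 0 1) (\<Sum>b\<in>Basis. f b *\<^sub>R b) *\<^sub>R character x (\<Sum>b\<in>Basis. f b *\<^sub>R b)
                     \<partial>(\<Pi>\<^sub>M b\<in>(Basis :: (real^'n) set). lborel))"
    by (subst lborel_eq, subst integral_distr) auto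
  also have "\<dots> = (\<integral>f. (\<Prod>b\<in>Basis. ?g b (f b)) \<partial>(\<Pi>\<^sub>M b\<in>(Basis :: (real^'n) set). lborel))"
    by (simp only: eq)
  also have "\<dots> = (\<Prod>b\<in>Basis. \<integral>t. ?g b t \<partial>lborel)"
    using integral_cis_unit_interval[OF XI]
    by (intro P.product_integral_prod) (auto simp: has_bochner_integral_iff)
  also have "\<dots> = (\<Prod>b\<in>Basis. if X \<bullet> b = 0 then 1 else 0)"
    using integral_cis_unit_interval[OF XI]
    by (intro prod.cong) (auto simp: has_bochner_integral_iff)
  also have "\<dots> = (if \<forall>b\<in>Basis. X \<bullet> b = 0 then 1 else 0)"
    by (auto intro!: prod.neutral)
  also have "(\<forall>b\<in>Basis. X \<bullet> b = 0) \<longleftrightarrow> x = 0"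
    by (auto simp: X_def Basis_vec_def inner_axis vec_eq_iff)
  finally show ?thesis .
qed


text \<open>Since \<open>is_fourier\<close> expands in \<open>cnj (character y)\<close>, integrating
  against \<open>character x\<close> picks out the coefficient at x. This is the inverse Fourier
  transform, and \<open>multiplier m g\<close> is the \<open>fourier_coeff\<close> of the product of
  m and \<open>fourier g\<close>.\<close>

definition fourier_coeff :: "(real ^ 'n::finite \<Rightarrow> complex) \<Rightarrow> int ^ 'n \<Rightarrow> complex" where
  "fourier_coeff G x = (\<integral>\<xi>. G \<xi> * character x \<xi> \<partial>torus)"

lemma cnj_character_torus [measurable]: "(\<lambda>\<xi>. cnj (character x \<xi>)) \<in> borel_measurable torus"
  by (simp add: cnj_character)

abbreviation trig_sum :: "(int ^ 'n::finite) set \<Rightarrow> (int ^ 'n \<Rightarrow> complex) \<Rightarrow> real ^ 'n \<Rightarrow> complex" where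
  "trig_sum S c \<xi> \<equiv> \<Sum>y\<in>S. c y * cnj (character y \<xi>)"

lemma square_integrable_trig_sum:
  "square_integrable torus (\<lambda>\<xi>. trig_sum S c \<xi>)"
  by (intro square_integrable_sum square_integrable_cmult torus.square_integrable_bounded[where B = 1]) auto

lemma integral_trig_sum_square:
  assumes "finite S"
  shows "(\<integral>\<xi>. (cmod (trig_sum S c \<xi>))\<^sup>2 \<partial>torus) = (\<Sum>y\<in>S. (cmod (c y))\<^sup>2)"
proof -
  have int: "integrable torus (\<lambda>\<xi>. c y * cnj (c z) * character (z - y) \<xi>)" for y z
    by (intro torus.square_integrable_imp_integrable_complex square_integrable_cmult
          torus.square_integrable_bounded[where B = 1]) auto
  have eq: "complex_of_real ((cmod (trig_sum S c \<xi>))\<^sup>2)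
      = (\<Sum>y\<in>S. \<Sum>z\<in>S. c y * cnj (c z) * character (z - y) \<xi>)" for \<xi>
  proof -
    have "complex_of_real ((cmod (trig_sum S c \<xi>))\<^sup>2)
      = trig_sum S c \<xi> * (\<Sum>z\<in>S. cnj (c z) * character z \<xi>)"
      unfolding complex_norm_square by simp
    also have "\<dots> = (\<Sum>y\<in>S. \<Sum>z\<in>S. c y * cnj (character y \<xi>) * (cnj (c z) * character z \<xi>))"
      by (rule sum_product)
    also have "\<dots> = (\<Sum>y\<in>S. \<Sum>z\<in>S. c y * cnj (c z) * character (z - y) \<xi>)"
      by (intro sum.cong refl)
         (simp only: diff_conv_add_uminus character_add cnj_character mult_ac)
    finally show ?thesis .
  qed
  have "complex_of_real (\<integral>\<xi>. (cmod (trig_sum S c \<xi>))\<^sup>2 \<partial>torus)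
      = (\<integral>\<xi>. (\<Sum>y\<in>S. \<Sum>z\<in>S. c y * cnj (c z) * character (z - y) \<xi>) \<partial>torus)"
    by (subst integral_complex_of_real[symmetric]) (simp only: eq)
  also have "\<dots> = (\<Sum>y\<in>S. \<Sum>z\<in>S. \<integral>\<xi>. c y * cnj (c z) * character (z - y) \<xi> \<partial>torus)"
    using int by (subst Bochner_Integration.integral_sum; simp)+
  also have "\<dots> = (\<Sum>y\<in>S. \<Sum>z\<in>S. if z = y then c y * cnj (c z) else 0)"
    by (intro sum.cong refl) (simp add: integral_character)
  also have "\<dots> = complex_of_real (\<Sum>y\<in>S. (cmod (c y))\<^sup>2)"
    using assms by (simp add: sum.delta complex_norm_square del: of_real_power)
  finally show ?thesis by (simp only: of_real_eq_iff)
qed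

text \<open>Completing the square in each coefficient. Bessel's inequality, Fourier inversion and
  the optimality of the Fourier coefficients are all read off from this identity.\<close>

lemma integral_diff_trig_sum_square:
  assumes G: "square_integrable torus G" and "finite S"
  shows "(\<integral>\<xi>. (cmod (G \<xi> - trig_sum S c \<xi>))\<^sup>2 \<partial>torus)
    = (\<integral>\<xi>. (cmod (G \<xi>))\<^sup>2 \<partial>torus) - (\<Sum>y\<in>S. (cmod (fourier_coeff G y))\<^sup>2)
      + (\<Sum>y\<in>S. (cmod (c y - fourier_coeff G y))\<^sup>2)"
proof -
  let ?P = "\<lambda>\<xi>. trig_sum S c \<xi>"
  have [measurable]: "G \<in> borel_measurable torus"
    using G by (simp add: square_integrable_def)
  have iG: "integrable torus (\<lambda>\<xi>. (cmod (G \<xi>))\<^sup>2)" and iP: "integrable torus (\<lambda>\<xi>. (cmod (?P \<xi>))\<^sup>2)"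
    using G square_integrable_trig_sum by (auto simp: square_integrable_def)
  have int: "integrable torus (\<lambda>\<xi>. cnj (c y) * (G \<xi> * character y \<xi>))" for y
  proof -
    have "square_integrable torus (\<lambda>\<xi>. character y \<xi> * G \<xi>)"
      by (rule square_integrable_bounded_mult(1)[OF G, where B = 1]) auto
    then show ?thesis
      by (auto intro: torus.square_integrable_imp_integrable_complex simp: mult.commute)
  qed
  have GP: "G \<xi> * cnj (?P \<xi>) = (\<Sum>y\<in>S. cnj (c y) * (G \<xi> * character y \<xi>))" for \<xi>
    by (simp add: sum_distrib_left mult_ac)
  have iGP: "integrable torus (\<lambda>\<xi>. G \<xi> * cnj (?P \<xi>))"
    unfolding GP using int by auto
  have "(\<integral>\<xi>. (cmod (G \<xi> - ?P \<xi>))\<^sup>2 \<partial>torus)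
     = (\<integral>\<xi>. (cmod (G \<xi>))\<^sup>2 \<partial>torus) - 2 * Re (\<integral>\<xi>. G \<xi> * cnj (?P \<xi>) \<partial>torus)
      + (\<integral>\<xi>. (cmod (?P \<xi>))\<^sup>2 \<partial>torus)"
    by (rule integral_cmod_diff_square) (fact iG iP iGP)+
  also have "(\<integral>\<xi>. G \<xi> * cnj (?P \<xi>) \<partial>torus) = (\<Sum>y\<in>S. cnj (c y) * fourier_coeff G y)"
    unfolding GP fourier_coeff_def using int by (subst Bochner_Integration.integral_sum) auto
  also have "(\<integral>\<xi>. (cmod (?P \<xi>))\<^sup>2 \<partial>torus) = (\<Sum>y\<in>S. (cmod (c y))\<^sup>2)"
    by (rule integral_trig_sum_square) fact
  also have "Re (\<Sum>y\<in>S. cnj (c y) * fourier_coeff G y) = (\<Sum>y\<in>S. Re (cnj (c y) * fourier_coeff G y))"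
    by (rule Re_sum)
  finally have "(\<integral>\<xi>. (cmod (G \<xi> - ?P \<xi>))\<^sup>2 \<partial>torus) = (\<integral>\<xi>. (cmod (G \<xi>))\<^sup>2 \<partial>torus)
      + (\<Sum>y\<in>S. (cmod (c y))\<^sup>2 - 2 * Re (cnj (c y) * fourier_coeff G y))"
    by (simp add: sum_subtractf sum_distrib_left)
  also have "(\<Sum>y\<in>S. (cmod (c y))\<^sup>2 - 2 * Re (cnj (c y) * fourier_coeff G y))
     = (\<Sum>y\<in>S. (cmod (c y - fourier_coeff G y))\<^sup>2 - (cmod (fourier_coeff G y))\<^sup>2)"
    unfolding cmod_power2 by (intro sum.cong refl) (simp add: power2_eq_square algebra_simps)
  finally show ?thesis by (simp add: sum_subtractf)
qed

text \<open>The closed span of the characters in L^2. Fourier transforms lie in it by definition,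
  and whatever lies in it is the transform of its own coefficients; this is what allows multipliers
  to be composed.\<close>

definition trig_approximable :: "(real ^ 'n::finite \<Rightarrow> complex) \<Rightarrow> bool" where
  "trig_approximable G \<longleftrightarrow> (\<forall>\<epsilon>>0. \<exists>S c. finite S \<and>
     (\<integral>\<xi>. (cmod (G \<xi> - trig_sum S c \<xi>))\<^sup>2 \<partial>torus) < \<epsilon>)"

text \<open>Among the trigonometric sums over a given set the one with coefficients
  \<open>fourier_coeff G\<close> is nearest to G, and its error decreases as the set grows. So one
  good approximation over \<open>S0\<close>, with any coefficients, controls all finite sets above
  \<open>S0\<close>.\<close>

lemma is_fourier_fourier_coeff:
  assumes G: "square_integrable torus G" and "trig_approximable G"
  shows "is_fourier (fourier_coeff G) G"
  unfolding is_fourier_def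
proof (intro conjI)
  show "G \<in> borel_measurable torus" "integrable torus (\<lambda>\<xi>. (cmod (G \<xi>))\<^sup>2)"
    using G by (auto simp: square_integrable_def)
  show "((\<lambda>S. \<integral>\<xi>. (cmod (G \<xi> - trig_sum S (fourier_coeff G) \<xi>))\<^sup>2 \<partial>torus) \<longlongrightarrow> 0)
       (finite_subsets_at_top UNIV)"
  proof (rule tendstoI)
    fix e :: real assume "e > 0"
    then obtain S0 c where S0: "finite S0"
        "(\<integral>\<xi>. (cmod (G \<xi> - trig_sum S0 c \<xi>))\<^sup>2 \<partial>torus) < e"
      using assms(2) unfolding trig_approximable_def by blast
    show "\<forall>\<^sub>F S in finite_subsets_at_top UNIV.
        dist (\<integral>\<xi>. (cmod (G \<xi> - trig_sum S (fourier_coeff G) \<xi>))\<^sup>2 \<partial>torus) 0 < e"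
      unfolding eventually_finite_subsets_at_top
    proof (intro exI[of _ S0] conjI allI impI)
      fix S assume S: "finite S \<and> S0 \<subseteq> S \<and> S \<subseteq> UNIV"
      have "(\<integral>\<xi>. (cmod (G \<xi> - trig_sum S (fourier_coeff G) \<xi>))\<^sup>2 \<partial>torus)
         = (\<integral>\<xi>. (cmod (G \<xi>))\<^sup>2 \<partial>torus) - (\<Sum>y\<in>S. (cmod (fourier_coeff G y))\<^sup>2)"
        using S by (subst integral_diff_trig_sum_square[OF G]) auto
      also have "\<dots> \<le> (\<integral>\<xi>. (cmod (G \<xi>))\<^sup>2 \<partial>torus) - (\<Sum>y\<in>S0. (cmod (fourier_coeff G y))\<^sup>2)"
        using S by (intro diff_left_mono sum_mono2) auto
      also have "\<dots> \<le> (\<integral>\<xi>. (cmod (G \<xi> - trig_sum S0 c \<xi>))\<^sup>2 \<partial>torus)"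
        using S0 by (subst integral_diff_trig_sum_square[OF G]) (auto intro: sum_nonneg)
      finally show "dist (\<integral>\<xi>. (cmod (G \<xi> - trig_sum S (fourier_coeff G) \<xi>))\<^sup>2 \<partial>torus) 0 < e"
        using S0 by simp
    qed (use S0 in auto)
  qed
qed

lemma is_fourierD:
  assumes "is_fourier g F"
  shows "square_integrable torus F" and "trig_approximable F"
proof -
  show "square_integrable torus F"
    using assms by (simp add: is_fourier_def square_integrable_def)
  show "trig_approximable F"
    unfolding trig_approximable_def
  proof (intro allI impI)
    fix e :: real assume "e > 0"
    have "((\<lambda>S. \<integral>\<xi>. (cmod (F \<xi> - trig_sum S g \<xi>))\<^sup>2 \<partial>torus) \<longlongrightarrow> 0)
       (finite_subsets_at_top UNIV)" using assms by (simp add: is_fourier_def)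
    from order_tendstoD(2)[OF this \<open>e > 0\<close>]
    obtain S0 where "finite S0" "\<And>S. finite S \<Longrightarrow> S0 \<subseteq> S \<Longrightarrow>
       (\<integral>\<xi>. (cmod (F \<xi> - trig_sum S g \<xi>))\<^sup>2 \<partial>torus) < e"
      unfolding eventually_finite_subsets_at_top by auto
    then show "\<exists>S c. finite S \<and>
       (\<integral>\<xi>. (cmod (F \<xi> - trig_sum S c \<xi>))\<^sup>2 \<partial>torus) < e"
      by blast
  qed
qed

lemma bessel:
  assumes G: "square_integrable torus G" and "finite S"
  shows "(\<Sum>y\<in>S. (cmod (fourier_coeff G y))\<^sup>2) \<le> (\<integral>\<xi>. (cmod (G \<xi>))\<^sup>2 \<partial>torus)"
proof -
  have "0 \<le> (\<integral>\<xi>. (cmod (G \<xi> - trig_sum S (fourier_coeff G) \<xi>))\<^sup>2 \<partial>torus)"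
    by simp
  then show ?thesis by (subst (asm) integral_diff_trig_sum_square[OF assms]) simp
qed

text \<open>Fourier inversion. By Bessel the first two terms of
  \<open>integral_diff_trig_sum_square\<close> have a nonnegative difference, so the squared
  discrepancy at x is at most the L^2 error of every partial sum containing x.\<close>

lemma fourier_coeff_is_fourier:
  assumes "is_fourier g F"
  shows "fourier_coeff F x = g x"
proof -
  let ?d = "\<lambda>S. \<integral>\<xi>. (cmod (F \<xi> - trig_sum S g \<xi>))\<^sup>2 \<partial>torus"
  have F: "square_integrable torus F" by (rule is_fourierD) fact
  have "(?d \<longlongrightarrow> 0) (finite_subsets_at_top UNIV)"
    using assms by (simp add: is_fourier_def)
  moreover have "\<forall>\<^sub>F S in finite_subsets_at_top UNIV. (cmod (g x - fourier_coeff F x))\<^sup>2 \<le> ?d S"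
    unfolding eventually_finite_subsets_at_top
  proof (intro exI[of _ "{x}"] conjI allI impI)
    fix S assume S: "finite S \<and> {x} \<subseteq> S \<and> S \<subseteq> UNIV"
    have "(cmod (g x - fourier_coeff F x))\<^sup>2 \<le> (\<Sum>y\<in>S. (cmod (g y - fourier_coeff F y))\<^sup>2)"
      using S by (intro member_le_sum) auto
    also have "\<dots> \<le> ?d S"
      using S bessel[OF F, of S] by (subst integral_diff_trig_sum_square[OF F]) auto
    finally show "(cmod (g x - fourier_coeff F x))\<^sup>2 \<le> ?d S" .
  qed auto
  ultimately have "(cmod (g x - fourier_coeff F x))\<^sup>2 \<le> 0"
    by (intro tendsto_lowerbound) auto
  then show ?thesis by simp
qed

text \<open>\<open>fourier\<close> is an arbitrary choice, so identities between transforms hold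
  almost everywhere only; that suffices under the integral in \<open>multiplier\<close>.\<close>

lemma is_fourier_unique:
  assumes "is_fourier g F" "is_fourier g G"
  shows "AE \<xi> in torus. F \<xi> = G \<xi>"
proof -
  let ?P = "\<lambda>S \<xi>. \<Sum>y\<in>S. g y * cnj (character y \<xi>)"
  let ?d = "\<lambda>F S. \<integral>\<xi>. (cmod (F \<xi> - ?P S \<xi>))\<^sup>2 \<partial>torus"
  have F: "square_integrable torus F" and G: "square_integrable torus G"
    using assms by (auto dest: is_fourierD)
  have P: "square_integrable torus (?P S)" for S
    by (rule square_integrable_trig_sum)
  have "((\<lambda>S. 2 * ?d F S + 2 * ?d G S) \<longlongrightarrow> 2 * 0 + 2 * 0) (finite_subsets_at_top UNIV)"
    using assms by (intro tendsto_intros) (auto simp: is_fourier_def)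
  moreover have "(\<integral>\<xi>. (cmod (F \<xi> - G \<xi>))\<^sup>2 \<partial>torus) \<le> 2 * ?d F S + 2 * ?d G S" for S
    using square_integrable_add(2)[OF square_integrable_diff[OF F P] square_integrable_diff[OF P G], of S S]
    by (simp add: norm_minus_commute)
  ultimately have "(\<integral>\<xi>. (cmod (F \<xi> - G \<xi>))\<^sup>2 \<partial>torus) \<le> 2 * 0 + 2 * 0"
    by (intro tendsto_lowerbound) auto
  then have "(\<integral>\<xi>. (cmod (F \<xi> - G \<xi>))\<^sup>2 \<partial>torus) = 0"
    by (intro antisym) auto
  then have "AE \<xi> in torus. (cmod (F \<xi> - G \<xi>))\<^sup>2 = 0"
    using square_integrable_diff[OF F G]
    by (subst (asm) integral_nonneg_eq_0_iff_AE) (auto simp: square_integrable_def)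
  then show ?thesis by simp
qed


section \<open>Existence of the Fourier transform\<close>

lemma integral_trig_sum_diff_square:
  assumes "finite S" "finite U"
  shows "(\<integral>\<xi>. (cmod (trig_sum S g \<xi> - trig_sum U g \<xi>))\<^sup>2 \<partial>torus)
     = (\<Sum>y\<in>(S - U) \<union> (U - S). (cmod (g y))\<^sup>2)"
proof -
  define d where "d y = (if y \<in> S then g y else 0) - (if y \<in> U then g y else 0)" for y
  have "trig_sum S g \<xi> = (\<Sum>y\<in>S \<union> U. (if y \<in> S then g y else 0) * cnj (character y \<xi>))" for \<xi>
    using assms by (intro sum.mono_neutral_cong_left) auto
  moreover have "trig_sum U g \<xi> = (\<Sum>y\<in>S \<union> U. (if y \<in> U then g y else 0) * cnj (character y \<xi>))" for \<xi>
    using assms by (intro sum.mono_neutral_cong_left) auto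
  ultimately have "trig_sum S g \<xi> - trig_sum U g \<xi>
      = trig_sum (S \<union> U) d \<xi>" for \<xi>
    by (simp only: sum_subtractf[symmetric] left_diff_distrib[symmetric] d_def)
  then have "(\<integral>\<xi>. (cmod (trig_sum S g \<xi> - trig_sum U g \<xi>))\<^sup>2 \<partial>torus)
     = (\<Sum>y\<in>S \<union> U. (cmod (d y))\<^sup>2)"
    using integral_trig_sum_square[of "S \<union> U" d] assms by simp
  also have "\<dots> = (\<Sum>y\<in>(S - U) \<union> (U - S). (cmod (g y))\<^sup>2)"
    using assms by (intro sum.mono_neutral_cong_right) (auto simp: d_def)
  finally show ?thesis .
qed

text \<open>Riesz--Fischer: an \<open>L\<^sup>2\<close>-Cauchy sequence of partial sums with geometric rate converges almost
  everywhere because the \<open>L\<^sup>1\<close> norm of a probability space is dominated by the \<open>L\<^sup>2\<close> norm, and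
  Fatou's lemma turns this into convergence in \<open>L\<^sup>2\<close>.\<close>

lemma is_fourier_exists:
  fixes g :: "int ^ 'n::finite \<Rightarrow> complex"
  assumes "in_l2 g"
  shows "\<exists>F. is_fourier g F"
proof -
  define a where "a y = (cmod (g y))\<^sup>2" for y
  have a: "a summable_on UNIV" "\<And>y. 0 \<le> a y"
    using assms by (auto simp: a_def[abs_def] in_l2_def)
  define P where "P S \<xi> = trig_sum S g \<xi>" for S \<xi>
  have P2: "square_integrable torus (P S)" for S
    unfolding P_def by (rule square_integrable_trig_sum)
  have PB [measurable]: "P S \<in> borel_measurable torus" for S
    using P2[of S] by (simp add: square_integrable_def)
  \<comment> \<open>Mass at most (1/4)^k outside \<open>S\<close> makes the k-th difference of
    partial sums at most (1/2)^k in L^2, hence in L^1, and this is summable over k.\<close>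
  have "\<exists>S. finite S \<and> (\<forall>U. finite U \<longrightarrow> U \<inter> S = {} \<longrightarrow> sum a U \<le> (1/4) ^ k)" for k :: nat
  proof -
    have "(sum a \<longlongrightarrow> infsum a UNIV) (finite_subsets_at_top UNIV)"
      using infsum_tendsto[OF a(1)] .
    then have "\<forall>\<^sub>F S in finite_subsets_at_top UNIV. infsum a UNIV - (1/4) ^ k < sum a S"
      by (rule order_tendstoD) simp
    then obtain S where S: "finite S" "infsum a UNIV - (1/4) ^ k < sum a S"
      unfolding eventually_finite_subsets_at_top by auto
    have "sum a U \<le> (1/4) ^ k" if "finite U" "U \<inter> S = {}" for U
    proof -
      have "sum a U + sum a S = sum a (U \<union> S)"
        using that S by (intro sum.union_disjoint[symmetric]) auto
      also have "\<dots> \<le> infsum a UNIV"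
        using that S a by (intro finite_sum_le_infsum) auto
      finally show ?thesis using S by linarith
    qed
    with S show ?thesis by blast
  qed
  then obtain S0 where S0: "\<And>k. finite (S0 k)"
     "\<And>k U. finite U \<Longrightarrow> U \<inter> S0 k = {} \<Longrightarrow> sum a U \<le> (1/4) ^ k"
    by metis
  \<comment> \<open>Unions make the sets increasing and keep the tail bound, since a set disjoint
    from \<open>S k\<close> is disjoint from \<open>S0 k\<close>.\<close>
  define S where "S k = (\<Union>j\<le>k. S0 j)" for k
  have Sfin: "finite (S k)" for k using S0 by (auto simp: S_def)
  have Smono: "S k \<subseteq> S l" if "k \<le> l" for k l using that by (force simp: S_def)
  have Stail: "sum a U \<le> (1/4) ^ k" if "finite U" "U \<inter> S k = {}" for U k
    using that by (intro S0(2)) (auto simp: S_def)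
  have dist: "(\<integral>\<xi>. (cmod (P U \<xi> - P V \<xi>))\<^sup>2 \<partial>torus) \<le> (1/4) ^ k"
    if "finite U" "finite V" "S k \<subseteq> U" "S k \<subseteq> V" for U V k
    unfolding P_def
    by (subst integral_trig_sum_diff_square) (use that in \<open>auto simp flip: a_def intro!: Stail\<close>)
  have step: "(\<integral>\<xi>. cmod (P (S (Suc k)) \<xi> - P (S k) \<xi>) \<partial>torus) \<le> (1/2) ^ k" for k
  proof (rule power2_le_imp_le)
    have "(\<integral>\<xi>. cmod (P (S (Suc k)) \<xi> - P (S k) \<xi>) \<partial>torus)\<^sup>2
       \<le> (\<integral>\<xi>. (cmod (P (S (Suc k)) \<xi> - P (S k) \<xi>))\<^sup>2 \<partial>torus)"
      by (intro torus.integral_cmod_square_le square_integrable_diff P2)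
    also have "\<dots> \<le> (1/4) ^ k"
      by (intro dist Sfin Smono) auto
    also have "\<dots> = ((1/2) ^ k)\<^sup>2"
      by (simp add: power_divide power_mult[symmetric] mult.commute[of k]) (simp add: power_mult)
    finally show "(\<integral>\<xi>. cmod (P (S (Suc k)) \<xi> - P (S k) \<xi>) \<partial>torus)\<^sup>2 \<le> ((1/2) ^ k)\<^sup>2" .
  qed simp
  have "(\<integral>\<^sup>+\<xi>. (\<Sum>k. ennreal (cmod (P (S (Suc k)) \<xi> - P (S k) \<xi>))) \<partial>torus)
     = (\<Sum>k. \<integral>\<^sup>+\<xi>. ennreal (cmod (P (S (Suc k)) \<xi> - P (S k) \<xi>)) \<partial>torus)"
    by (intro nn_integral_suminf) measurable
  also have "\<dots> = (\<Sum>k. ennreal (\<integral>\<xi>. cmod (P (S (Suc k)) \<xi> - P (S k) \<xi>) \<partial>torus))"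
    by (intro suminf_cong nn_integral_eq_integral integrable_norm
          torus.square_integrable_imp_integrable_complex square_integrable_diff P2) auto
  also have "\<dots> \<le> (\<Sum>k. ennreal ((1/2) ^ k))"
    by (intro suminf_le ennreal_leI step) auto
  also have "\<dots> = ennreal (\<Sum>k. (1/2) ^ k)"
    by (rule suminf_ennreal2) (auto intro: summable_geometric)
  finally have "(\<integral>\<^sup>+\<xi>. (\<Sum>k. ennreal (cmod (P (S (Suc k)) \<xi> - P (S k) \<xi>))) \<partial>torus) \<noteq> \<infinity>"
    by (auto simp: top_unique)
  then have "AE \<xi> in torus. (\<Sum>k. ennreal (cmod (P (S (Suc k)) \<xi> - P (S k) \<xi>))) \<noteq> \<infinity>"
    by (intro nn_integral_PInf_AE) measurable
  then have conv: "AE \<xi> in torus. convergent (\<lambda>k. P (S k) \<xi>)"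
  proof eventually_elim
    fix \<xi> assume "(\<Sum>k. ennreal (cmod (P (S (Suc k)) \<xi> - P (S k) \<xi>))) \<noteq> \<infinity>"
    then have "summable (\<lambda>k. cmod (P (S (Suc k)) \<xi> - P (S k) \<xi>))"
      by (intro summable_suminf_not_top) auto
    then have "summable (\<lambda>k. P (S (Suc k)) \<xi> - P (S k) \<xi>)"
      by (rule summable_norm_cancel)
    then have "convergent (\<lambda>n. \<Sum>k<n. P (S (Suc k)) \<xi> - P (S k) \<xi>)"
      by (simp add: summable_iff_convergent)
    then have "convergent (\<lambda>n. P (S n) \<xi> - P (S 0) \<xi>)"
      using sum_lessThan_telescope[of "\<lambda>k. P (S k) \<xi>"] by simp
    then show "convergent (\<lambda>n. P (S n) \<xi>)"
      using convergent_add[OF _ convergent_const[of "P (S 0) \<xi>"]] by force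
  qed
  define F where "F \<xi> = lim (\<lambda>k. P (S k) \<xi>)" for \<xi>
  have FB [measurable]: "F \<in> borel_measurable torus"
    unfolding F_def by (rule borel_measurable_lim_metric) measurable
  have Flim: "AE \<xi> in torus. (\<lambda>k. P (S k) \<xi>) \<longlonglongrightarrow> F \<xi>"
    using conv by eventually_elim (simp add: F_def convergent_LIMSEQ_iff)
  have nn: "(\<integral>\<^sup>+\<xi>. ennreal ((cmod (F \<xi> - P U \<xi>))\<^sup>2) \<partial>torus) \<le> ennreal ((1/4) ^ k)"
    if "finite U" "S k \<subseteq> U" for U k
  proof -
    have "(\<integral>\<^sup>+\<xi>. ennreal ((cmod (F \<xi> - P U \<xi>))\<^sup>2) \<partial>torus)
       = (\<integral>\<^sup>+\<xi>. liminf (\<lambda>n. ennreal ((cmod (P (S n) \<xi> - P U \<xi>))\<^sup>2)) \<partial>torus)"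
    proof (rule nn_integral_cong_AE, use Flim in eventually_elim)
      fix \<xi> assume "(\<lambda>k. P (S k) \<xi>) \<longlonglongrightarrow> F \<xi>"
      then have "(\<lambda>n. ennreal ((cmod (P (S n) \<xi> - P U \<xi>))\<^sup>2)) \<longlonglongrightarrow> ennreal ((cmod (F \<xi> - P U \<xi>))\<^sup>2)"
        by (intro tendsto_intros)
      then show "ennreal ((cmod (F \<xi> - P U \<xi>))\<^sup>2) = liminf (\<lambda>n. ennreal ((cmod (P (S n) \<xi> - P U \<xi>))\<^sup>2))"
        by (intro lim_imp_Liminf[symmetric]) auto
    qed
    also have "\<dots> \<le> liminf (\<lambda>n. \<integral>\<^sup>+\<xi>. ennreal ((cmod (P (S n) \<xi> - P U \<xi>))\<^sup>2) \<partial>torus)"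
      by (intro nn_integral_liminf) measurable
    also have "\<dots> \<le> limsup (\<lambda>n. \<integral>\<^sup>+\<xi>. ennreal ((cmod (P (S n) \<xi> - P U \<xi>))\<^sup>2) \<partial>torus)"
      by (intro Liminf_le_Limsup) auto
    also have "\<dots> \<le> ennreal ((1/4) ^ k)"
    proof (rule Limsup_bounded, rule eventually_sequentiallyI[of k])
      fix n assume "k \<le> n"
      have "(\<integral>\<^sup>+\<xi>. ennreal ((cmod (P (S n) \<xi> - P U \<xi>))\<^sup>2) \<partial>torus)
         = ennreal (\<integral>\<xi>. (cmod (P (S n) \<xi> - P U \<xi>))\<^sup>2 \<partial>torus)"
        using square_integrable_diff[OF P2 P2]
        by (intro nn_integral_eq_integral) (auto simp: square_integrable_def)
      also have "\<dots> \<le> ennreal ((1/4) ^ k)"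
        using that \<open>k \<le> n\<close> by (intro ennreal_leI dist Sfin Smono) auto
      finally show "(\<integral>\<^sup>+\<xi>. ennreal ((cmod (P (S n) \<xi> - P U \<xi>))\<^sup>2) \<partial>torus) \<le> ennreal ((1/4) ^ k)" .
    qed
    finally show ?thesis .
  qed
  have diff2: "integrable torus (\<lambda>\<xi>. (cmod (F \<xi> - P U \<xi>))\<^sup>2)"
    and bound: "(\<integral>\<xi>. (cmod (F \<xi> - P U \<xi>))\<^sup>2 \<partial>torus) \<le> (1/4) ^ k" if "finite U" "S k \<subseteq> U" for U k
  proof -
    show i: "integrable torus (\<lambda>\<xi>. (cmod (F \<xi> - P U \<xi>))\<^sup>2)"
      using nn[OF that] by (intro integrableI_bounded) (auto simp: less_top[symmetric] top_unique)
    have "ennreal (\<integral>\<xi>. (cmod (F \<xi> - P U \<xi>))\<^sup>2 \<partial>torus) \<le> ennreal ((1/4) ^ k)"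
      using nn[OF that] i by (subst (asm) nn_integral_eq_integral) auto
    then show "(\<integral>\<xi>. (cmod (F \<xi> - P U \<xi>))\<^sup>2 \<partial>torus) \<le> (1/4) ^ k" by simp
  qed
  have "square_integrable torus (\<lambda>\<xi>. (F \<xi> - P (S 0) \<xi>) + P (S 0) \<xi>)"
    using diff2[of "S 0" 0] Sfin by (intro square_integrable_add P2) (auto simp: square_integrable_def)
  then have F2: "square_integrable torus F" by simp
  have "((\<lambda>U. \<integral>\<xi>. (cmod (F \<xi> - P U \<xi>))\<^sup>2 \<partial>torus) \<longlongrightarrow> 0) (finite_subsets_at_top UNIV)"
  proof (rule tendstoI)
    fix e :: real assume "e > 0"
    obtain k where k: "(1/4 :: real) ^ k < e"
      using real_arch_pow_inv[OF \<open>e > 0\<close>, of "1/4"] by auto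
    show "\<forall>\<^sub>F U in finite_subsets_at_top UNIV. dist (\<integral>\<xi>. (cmod (F \<xi> - P U \<xi>))\<^sup>2 \<partial>torus) 0 < e"
      unfolding eventually_finite_subsets_at_top
      using bound[of _ k] k Sfin[of k] by (intro exI[of _ "S k"]) (auto intro: le_less_trans)
  qed
  with F2 have "is_fourier g F"
    by (simp add: is_fourier_def square_integrable_def P_def)
  then show ?thesis by (rule exI[of _ F])
qed

lemma is_fourier_fourier: "in_l2 g \<Longrightarrow> is_fourier g (fourier g)"
  unfolding fourier_def by (rule someI_ex[OF is_fourier_exists])

section \<open>Multipliers\<close>

lemma trig_approximable_limit:
  assumes G: "square_integrable torus G"
    and H: "\<And>\<epsilon>. \<epsilon> > 0 \<Longrightarrow> \<exists>H. square_integrable torus H \<and> trig_approximable H \<and>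
        (\<integral>\<xi>. (cmod (G \<xi> - H \<xi>))\<^sup>2 \<partial>torus) < \<epsilon>"
  shows "trig_approximable G"
  unfolding trig_approximable_def
proof (intro allI impI)
  fix e :: real assume "e > 0"
  then obtain H where H: "square_integrable torus H" "trig_approximable H"
       "(\<integral>\<xi>. (cmod (G \<xi> - H \<xi>))\<^sup>2 \<partial>torus) < e / 4"
    using assms(2)[of "e / 4"] by auto
  obtain S c where S: "finite S"
       "(\<integral>\<xi>. (cmod (H \<xi> - trig_sum S c \<xi>))\<^sup>2 \<partial>torus) < e / 4"
    using H(2) \<open>e > 0\<close> unfolding trig_approximable_def by (meson divide_pos_pos zero_less_numeral)
  show "\<exists>S c. finite S \<and>
       (\<integral>\<xi>. (cmod (G \<xi> - trig_sum S c \<xi>))\<^sup>2 \<partial>torus) < e"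
    using square_integrable_add(2)[OF square_integrable_diff[OF G H(1)]
        square_integrable_diff[OF H(1) square_integrable_trig_sum, of c S]] S H(3)
    by (intro exI[of _ S] exI[of _ c]) auto
qed

lemma trig_approximable_add:
  assumes G: "square_integrable torus G" "trig_approximable G"
    and H: "square_integrable torus H" "trig_approximable H"
  shows "trig_approximable (\<lambda>\<xi>. G \<xi> + H \<xi>)"
  unfolding trig_approximable_def
proof (intro allI impI)
  fix e :: real assume "e > 0"
  then have "e / 4 > 0" by simp
  obtain S c where S: "finite S"
       "(\<integral>\<xi>. (cmod (G \<xi> - trig_sum S c \<xi>))\<^sup>2 \<partial>torus) < e / 4"
    using G(2) \<open>e / 4 > 0\<close> unfolding trig_approximable_def by blast
  obtain U d where U: "finite U"
       "(\<integral>\<xi>. (cmod (H \<xi> - trig_sum U d \<xi>))\<^sup>2 \<partial>torus) < e / 4"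
    using H(2) \<open>e / 4 > 0\<close> unfolding trig_approximable_def by blast
  define b where "b y = (if y \<in> S then c y else 0) + (if y \<in> U then d y else 0)" for y
  have "trig_sum S c \<xi> = (\<Sum>y\<in>S \<union> U. (if y \<in> S then c y else 0) * cnj (character y \<xi>))" for \<xi>
    using S U by (intro sum.mono_neutral_cong_left) auto
  moreover have "trig_sum U d \<xi> = (\<Sum>y\<in>S \<union> U. (if y \<in> U then d y else 0) * cnj (character y \<xi>))" for \<xi>
    using S U by (intro sum.mono_neutral_cong_left) auto
  ultimately have eq: "(G \<xi> - trig_sum S c \<xi>) + (H \<xi> - trig_sum U d \<xi>)
      = G \<xi> + H \<xi> - trig_sum (S \<union> U) b \<xi>" for \<xi>
    by (simp add: b_def distrib_right sum.distrib)
  have "(\<integral>\<xi>. (cmod (G \<xi> + H \<xi> - trig_sum (S \<union> U) b \<xi>))\<^sup>2 \<partial>torus) < e"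
    using square_integrable_add(2)[OF square_integrable_diff[OF G(1) square_integrable_trig_sum, of c S]
        square_integrable_diff[OF H(1) square_integrable_trig_sum, of d U]] S U
    by (simp add: eq)
  then show "\<exists>S c. finite S \<and>
       (\<integral>\<xi>. (cmod (G \<xi> + H \<xi> - trig_sum S c \<xi>))\<^sup>2 \<partial>torus) < e"
    using S U by blast
qed

lemma trig_approximable_cmult:
  assumes "trig_approximable G"
  shows "trig_approximable (\<lambda>\<xi>. a * G \<xi>)"
proof (cases "a = 0")
  case True
  then show ?thesis
    unfolding trig_approximable_def by (auto intro!: exI[of _ "{}"])
next
  case False
  show ?thesis
    unfolding trig_approximable_def
  proof (intro allI impI)
    fix e :: real assume "e > 0"
    with False have "e / (cmod a)\<^sup>2 > 0" by simp
    then obtain S c where S: "finite S"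
       "(\<integral>\<xi>. (cmod (G \<xi> - trig_sum S c \<xi>))\<^sup>2 \<partial>torus) < e / (cmod a)\<^sup>2"
      using assms unfolding trig_approximable_def by blast
    have "(cmod (a * G \<xi> - (\<Sum>y\<in>S. (a * c y) * cnj (character y \<xi>))))\<^sup>2
        = (cmod a)\<^sup>2 * (cmod (G \<xi> - trig_sum S c \<xi>))\<^sup>2" for \<xi>
      by (simp add: mult.assoc sum_distrib_left[symmetric] right_diff_distrib[symmetric] norm_mult power_mult_distrib)
    then have "(\<integral>\<xi>. (cmod (a * G \<xi> - (\<Sum>y\<in>S. (a * c y) * cnj (character y \<xi>))))\<^sup>2 \<partial>torus) < e"
      using S False by (simp add: pos_less_divide_eq mult.commute)
    with S show "\<exists>S c. finite S \<and>
       (\<integral>\<xi>. (cmod (a * G \<xi> - trig_sum S c \<xi>))\<^sup>2 \<partial>torus) < e"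
      by (intro exI[of _ S] exI[of _ "\<lambda>y. a * c y"] conjI)
  qed
qed

text \<open>The product with \<open>character z\<close> moves the frequency y to y - z, so
  trigonometric sums go to trigonometric sums and the modulus of the error is unchanged.\<close>

lemma trig_approximable_character_mult:
  assumes "trig_approximable G"
  shows "trig_approximable (\<lambda>\<xi>. character z \<xi> * G \<xi>)"
  unfolding trig_approximable_def
proof (intro allI impI)
  fix e :: real assume "e > 0"
  then obtain S c where S: "finite S"
       "(\<integral>\<xi>. (cmod (G \<xi> - trig_sum S c \<xi>))\<^sup>2 \<partial>torus) < e"
    using assms unfolding trig_approximable_def by blast
  have "(\<Sum>y\<in>(\<lambda>y. y - z) ` S. c (y + z) * cnj (character y \<xi>))
      = character z \<xi> * trig_sum S c \<xi>" for \<xi>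
  proof -
    have "(\<Sum>y\<in>(\<lambda>y. y - z) ` S. c (y + z) * cnj (character y \<xi>))
       = (\<Sum>y\<in>S. c y * cnj (character (y - z) \<xi>))"
      by (subst sum.reindex) (auto simp: inj_on_def)
    also have "\<dots> = (\<Sum>y\<in>S. character z \<xi> * (c y * cnj (character y \<xi>)))"
      unfolding cnj_character
      by (intro sum.cong refl)
         (simp add: character_add[symmetric] mult.left_commute[of _ "c _"])
    finally show ?thesis by (simp add: sum_distrib_left)
  qed
  then have "(cmod (character z \<xi> * G \<xi> - (\<Sum>y\<in>(\<lambda>y. y - z) ` S. c (y + z) * cnj (character y \<xi>))))
      = cmod (G \<xi> - trig_sum S c \<xi>)" for \<xi>
    by (simp add: right_diff_distrib[symmetric] norm_mult)
  then have "(\<integral>\<xi>. (cmod (character z \<xi> * G \<xi> - (\<Sum>y\<in>(\<lambda>y. y - z) ` S. c (y + z) * cnj (character y \<xi>))))\<^sup>2 \<partial>torus) < e"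
    using S by simp
  then show "\<exists>S c. finite S \<and>
       (\<integral>\<xi>. (cmod (character z \<xi> * G \<xi> - trig_sum S c \<xi>))\<^sup>2 \<partial>torus) < e"
    using S by (intro exI[of _ "(\<lambda>y. y - z) ` S"] exI[of _ "\<lambda>y. c (y + z)"] conjI) auto
qed

text \<open>Bounded symbols that preserve the closed span of the characters, which is exactly what
  makes the product of m and \<open>fourier g\<close> a transform of \<open>multiplier m g\<close>.
  The class is an algebra containing the characters and is closed under bounded pointwise limits;
  the Riesz symbols are reached in this way.\<close>

definition good_multiplier :: "(real ^ 'n::finite \<Rightarrow> complex) \<Rightarrow> bool" where
  "good_multiplier m \<longleftrightarrow> m \<in> borel_measurable torus \<and> (\<exists>B. \<forall>\<xi>\<in>space torus. cmod (m \<xi>) \<le> B) \<and>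
     (\<forall>G. square_integrable torus G \<longrightarrow> trig_approximable G \<longrightarrow> trig_approximable (\<lambda>\<xi>. m \<xi> * G \<xi>))"

lemma good_multiplier_square_integrable:
  "good_multiplier m \<Longrightarrow> square_integrable torus G \<Longrightarrow> square_integrable torus (\<lambda>\<xi>. m \<xi> * G \<xi>)"
  unfolding good_multiplier_def using square_integrable_bounded_mult(1) by metis

lemma good_multiplier_const: "good_multiplier (\<lambda>_. c)"
  by (auto simp: good_multiplier_def intro: trig_approximable_cmult)

lemma good_multiplier_character: "good_multiplier (character z)"
  by (auto simp: good_multiplier_def intro: trig_approximable_character_mult)

lemma good_multiplier_add:
  assumes "good_multiplier m" "good_multiplier m'"
  shows "good_multiplier (\<lambda>\<xi>. m \<xi> + m' \<xi>)"
proof -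
  obtain B B' where "\<forall>\<xi>\<in>space torus. cmod (m \<xi>) \<le> B" "\<forall>\<xi>\<in>space torus. cmod (m' \<xi>) \<le> B'"
    using assms unfolding good_multiplier_def by blast
  then have "\<forall>\<xi>\<in>space torus. cmod (m \<xi> + m' \<xi>) \<le> B + B'"
    by (auto intro: norm_triangle_mono)
  moreover have "trig_approximable (\<lambda>\<xi>. m \<xi> * G \<xi> + m' \<xi> * G \<xi>)"
    if "square_integrable torus G" "trig_approximable G" for G
    using that assms
    by (intro trig_approximable_add good_multiplier_square_integrable) (auto simp: good_multiplier_def)
  ultimately show ?thesis
    using assms unfolding good_multiplier_def distrib_right by (auto intro!: borel_measurable_add)
qed

lemma good_multiplier_mult:
  assumes "good_multiplier m" "good_multiplier m'"
  shows "good_multiplier (\<lambda>\<xi>. m \<xi> * m' \<xi>)"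
proof -
  obtain B B' where "\<forall>\<xi>\<in>space torus. cmod (m \<xi>) \<le> B" "\<forall>\<xi>\<in>space torus. cmod (m' \<xi>) \<le> B'"
    using assms unfolding good_multiplier_def by blast
  then have "\<forall>\<xi>\<in>space torus. cmod (m \<xi> * m' \<xi>) \<le> B * B'"
    by (auto simp: norm_mult intro!: mult_mono intro: order_trans[OF norm_ge_zero])
  moreover have "trig_approximable (\<lambda>\<xi>. m \<xi> * (m' \<xi> * G \<xi>))"
    if "square_integrable torus G" "trig_approximable G" for G
    using that assms good_multiplier_square_integrable[OF assms(2)] by (auto simp: good_multiplier_def)
  ultimately show ?thesis
    using assms unfolding good_multiplier_def mult.assoc by (auto intro!: borel_measurable_times)
qed

lemma good_multiplier_diff:
  "good_multiplier m \<Longrightarrow> good_multiplier m' \<Longrightarrow> good_multiplier (\<lambda>\<xi>. m \<xi> - m' \<xi>)"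
  using good_multiplier_add[of m "\<lambda>\<xi>. - 1 * m' \<xi>"] good_multiplier_mult[OF good_multiplier_const[of "-1"], of m']
  by simp

lemma good_multiplier_sum:
  "(\<And>i. i \<in> I \<Longrightarrow> good_multiplier (m i)) \<Longrightarrow> good_multiplier (\<lambda>\<xi>. \<Sum>i\<in>I. m i \<xi>)"
proof (induction I rule: infinite_finite_induct)
  case (insert i I)
  then show ?case by (simp add: good_multiplier_add)
qed (auto simp: good_multiplier_const)

lemma good_multiplier_power: "good_multiplier m \<Longrightarrow> good_multiplier (\<lambda>\<xi>. m \<xi> ^ k)"
  by (induction k) (auto intro: good_multiplier_const good_multiplier_mult)

text \<open>Bounded pointwise convergence of the symbols gives L^2 convergence of their products
  with G, with dominating function (2B)^2 |G|^2, and the closed span is closed in L^2.\<close>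

lemma good_multiplier_limit:
  fixes m' :: "real ^ 'n::finite \<Rightarrow> complex"
  assumes m: "\<And>k. good_multiplier (m k)" and B: "\<And>k \<xi>. \<xi> \<in> space torus \<Longrightarrow> cmod (m k \<xi>) \<le> B"
    and lim: "\<And>\<xi>. \<xi> \<in> space torus \<Longrightarrow> (\<lambda>k. m k \<xi>) \<longlonglongrightarrow> m' \<xi>"
  shows "good_multiplier m'"
proof -
  have mB [measurable]: "m k \<in> borel_measurable torus" for k
    using m[of k] by (simp add: good_multiplier_def)
  have m'B [measurable]: "m' \<in> borel_measurable torus"
    by (rule borel_measurable_LIMSEQ_metric[OF mB lim])
  have B': "cmod (m' \<xi>) \<le> B" if "\<xi> \<in> space torus" for \<xi>
    using tendsto_norm[OF lim[OF that]] B[OF that] by (intro Lim_bounded) auto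
  have "trig_approximable (\<lambda>\<xi>. m' \<xi> * G \<xi>)" if G: "square_integrable torus G" "trig_approximable G" for G
  proof (rule trig_approximable_limit)
    have [measurable]: "G \<in> borel_measurable torus" using G by (simp add: square_integrable_def)
    show "square_integrable torus (\<lambda>\<xi>. m' \<xi> * G \<xi>)"
      using square_integrable_bounded_mult(1)[OF G(1) m'B B'] .
    fix e :: real assume "e > 0"
    have "(\<lambda>k. \<integral>\<xi>. (cmod (m' \<xi> * G \<xi> - m k \<xi> * G \<xi>))\<^sup>2 \<partial>torus) \<longlonglongrightarrow> (\<integral>\<xi>. 0 \<partial>(torus :: (real ^ 'n) measure))"
    proof (rule integral_dominated_convergence[where w = "\<lambda>\<xi>. (2 * B)\<^sup>2 * (cmod (G \<xi>))\<^sup>2"])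
      show "integrable torus (\<lambda>\<xi>. (2 * B)\<^sup>2 * (cmod (G \<xi>))\<^sup>2)"
        using G(1) by (auto simp: square_integrable_def)
      show "AE \<xi> in torus. (\<lambda>k. (cmod (m' \<xi> * G \<xi> - m k \<xi> * G \<xi>))\<^sup>2) \<longlonglongrightarrow> 0"
      proof (rule AE_I2)
        fix \<xi> :: "real ^ 'n" assume "\<xi> \<in> space torus"
        then have "(\<lambda>k. (cmod (m' \<xi> * G \<xi> - m k \<xi> * G \<xi>))\<^sup>2) \<longlonglongrightarrow> (cmod (m' \<xi> * G \<xi> - m' \<xi> * G \<xi>))\<^sup>2"
          by (intro tendsto_intros lim)
        then show "(\<lambda>k. (cmod (m' \<xi> * G \<xi> - m k \<xi> * G \<xi>))\<^sup>2) \<longlonglongrightarrow> 0" by simp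
      qed
      show "AE \<xi> in torus. norm ((cmod (m' \<xi> * G \<xi> - m k \<xi> * G \<xi>))\<^sup>2) \<le> (2 * B)\<^sup>2 * (cmod (G \<xi>))\<^sup>2" for k
      proof (rule AE_I2)
        fix \<xi> :: "real ^ 'n" assume \<xi>: "\<xi> \<in> space torus"
        have "cmod (m' \<xi> - m k \<xi>) \<le> 2 * B"
          using norm_triangle_ineq4[of "m' \<xi>" "m k \<xi>"] B[OF \<xi>, of k] B'[OF \<xi>] by linarith
        then have "(cmod (m' \<xi> - m k \<xi>))\<^sup>2 \<le> (2 * B)\<^sup>2"
          by (intro power_mono) auto
        then show "norm ((cmod (m' \<xi> * G \<xi> - m k \<xi> * G \<xi>))\<^sup>2) \<le> (2 * B)\<^sup>2 * (cmod (G \<xi>))\<^sup>2"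
          by (simp add: left_diff_distrib[symmetric] norm_mult power_mult_distrib mult_right_mono)
      qed
    qed measurable
    then have "(\<lambda>k. \<integral>\<xi>. (cmod (m' \<xi> * G \<xi> - m k \<xi> * G \<xi>))\<^sup>2 \<partial>torus) \<longlonglongrightarrow> 0" by simp
    from order_tendstoD(2)[OF this \<open>e > 0\<close>]
    obtain k where "(\<integral>\<xi>. (cmod (m' \<xi> * G \<xi> - m k \<xi> * G \<xi>))\<^sup>2 \<partial>torus) < e"
      by (auto simp: eventually_sequentially)
    then show "\<exists>H. square_integrable torus H \<and> trig_approximable H \<and>
        (\<integral>\<xi>. (cmod (m' \<xi> * G \<xi> - H \<xi>))\<^sup>2 \<partial>torus) < e"
      using m[of k] G good_multiplier_square_integrable[OF m[of k] G(1)]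
      by (intro exI[of _ "\<lambda>\<xi>. m k \<xi> * G \<xi>"]) (auto simp: good_multiplier_def)
  qed
  with B' m'B show ?thesis unfolding good_multiplier_def by blast
qed

lemma is_fourier_multiplier:
  assumes "good_multiplier m" "in_l2 g"
  shows "is_fourier (multiplier m g) (\<lambda>\<xi>. m \<xi> * fourier g \<xi>)"
proof -
  have "is_fourier (fourier_coeff (\<lambda>\<xi>. m \<xi> * fourier g \<xi>)) (\<lambda>\<xi>. m \<xi> * fourier g \<xi>)"
    using is_fourierD[OF is_fourier_fourier[OF assms(2)]] assms(1)
    by (intro is_fourier_fourier_coeff good_multiplier_square_integrable) (auto simp: good_multiplier_def)
  then show ?thesis unfolding multiplier_def fourier_coeff_def .
qed

text \<open>The inner symbol has to be good, because its product with \<open>fourier g\<close> must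
  be a transform again. The outer symbol merely stands under the integral, where replacing the
  transform on a null set is harmless.\<close>

lemma multiplier_multiplier:
  assumes m: "good_multiplier m" and g: "in_l2 g" and m': "m' \<in> borel_measurable torus"
  shows "multiplier m' (multiplier m g) x = (\<integral>\<xi>. m' \<xi> * m \<xi> * fourier g \<xi> * character x \<xi> \<partial>torus)"
proof -
  have f: "is_fourier (multiplier m g) (\<lambda>\<xi>. m \<xi> * fourier g \<xi>)"
    by (rule is_fourier_multiplier) fact+
  then have f': "is_fourier (multiplier m g) (fourier (multiplier m g))"
    unfolding fourier_def[of "multiplier m g"] by (rule someI[of "is_fourier (multiplier m g)"])
  have [measurable]: "m' \<in> borel_measurable torus" "m \<in> borel_measurable torus"
      "fourier g \<in> borel_measurable torus" "fourier (multiplier m g) \<in> borel_measurable torus"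
    using m m' f' is_fourier_fourier[OF g] by (auto simp: good_multiplier_def is_fourier_def)
  show ?thesis
    unfolding multiplier_def[of m']
    by (rule integral_cong_AE) (use is_fourier_unique[OF f' f] in \<open>auto simp: mult_ac\<close>)
qed

lemma cmod_integral_le:
  assumes "integrable M g" "\<And>x. x \<in> space M \<Longrightarrow> cmod (f x) \<le> g x"
  shows "cmod (\<integral>x. f x \<partial>M) \<le> (\<integral>x. g x \<partial>M)"
proof -
  have "(\<integral>x. cmod (f x) \<partial>M) \<le> (\<integral>x. g x \<partial>M)"
    using assms by (intro integral_mono' order_trans[OF norm_ge_zero]) auto
  then show ?thesis using integral_norm_bound[of M f] by linarith
qed

lemma torus_integrable_mult:
  assumes F: "square_integrable torus F" and [measurable]: "a \<in> borel_measurable torus"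
    and B: "\<And>\<xi>. \<xi> \<in> space torus \<Longrightarrow> cmod (a \<xi>) \<le> B"
  shows "integrable torus (\<lambda>\<xi>. a \<xi> * F \<xi> * character x \<xi>)"
proof -
  have [measurable]: "F \<in> borel_measurable torus" using F by (simp add: square_integrable_def)
  have "square_integrable torus (\<lambda>\<xi>. (a \<xi> * character x \<xi>) * F \<xi>)"
    by (rule square_integrable_bounded_mult(1)[OF F, where B = B]) (auto simp: norm_mult B)
  then show ?thesis
    by (auto dest!: torus.square_integrable_imp_integrable_complex simp: mult_ac)
qed

section \<open>Symbols of the difference operators and of the Laplacian\<close>

lemma neg_laplacian_symbol_nonneg: "0 \<le> neg_laplacian_symbol \<xi>"
  unfolding neg_laplacian_symbol_def by (intro sum_nonneg) simp

lemma neg_laplacian_symbol_le: "neg_laplacian_symbol (\<xi> :: real ^ 'n::finite) \<le> 4 * real CARD('n)"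
proof -
  have "2 - 2 * cos (2 * pi * \<xi> $ j) \<le> 4" for j
    using cos_ge_minus_one[of "2 * pi * \<xi> $ j"] by linarith
  then have "neg_laplacian_symbol \<xi> \<le> (\<Sum>j\<in>(UNIV :: 'n set). 4)"
    unfolding neg_laplacian_symbol_def by (intro sum_mono)
  then show ?thesis by simp
qed

lemma neg_laplacian_symbol_measurable [measurable]: "neg_laplacian_symbol \<in> borel_measurable torus"
  unfolding neg_laplacian_symbol_def by (rule measurable_torus) measurable

lemma plus_symbol_measurable [measurable]: "plus_symbol i \<in> borel_measurable torus"
  unfolding plus_symbol_def by (rule measurable_torus) measurable

lemma minus_symbol_measurable [measurable]: "minus_symbol i \<in> borel_measurable torus"
  unfolding minus_symbol_def by (rule measurable_torus) measurable

lemma plus_symbol_character: "plus_symbol i \<xi> = character (axis i 1) \<xi> - 1"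
  by (simp add: plus_symbol_def character_axis)

lemma minus_symbol_character: "minus_symbol i \<xi> = 1 - character (- axis i 1) \<xi>"
  by (simp add: minus_symbol_def cnj_character[symmetric] character_axis cis_cnj)

lemma cmod_plus_symbol: "(cmod (plus_symbol i \<xi>))\<^sup>2 = 2 - 2 * cos (2 * pi * \<xi> $ i)"
  using sin_cos_squared_add[of "2 * pi * \<xi> $ i"]
  unfolding cmod_power2 plus_symbol_def by (simp add: power2_eq_square algebra_simps)

lemma cmod_minus_symbol: "cmod (minus_symbol i \<xi>) = cmod (plus_symbol i \<xi>)"
proof -
  have "minus_symbol i \<xi> = - cnj (plus_symbol i \<xi>)"
    by (simp add: minus_symbol_def plus_symbol_def cis_cnj)
  then show ?thesis by (simp only: norm_minus_cancel complex_mod_cnj)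
qed

text \<open>The square of the left side is one of the nonnegative summands of
  \<open>neg_laplacian_symbol\<close>. This is the source of the boundedness of all Riesz
  symbols.\<close>

lemma cmod_plus_symbol_le: "cmod (plus_symbol i \<xi>) \<le> sqrt (neg_laplacian_symbol \<xi>)"
proof (rule real_le_rsqrt)
  show "(cmod (plus_symbol i \<xi>))\<^sup>2 \<le> neg_laplacian_symbol \<xi>"
    unfolding cmod_plus_symbol neg_laplacian_symbol_def
    by (rule member_le_sum) auto
qed

lemma cmod_plus_symbol_le_2: "cmod (plus_symbol i \<xi>) \<le> 2"
  unfolding plus_symbol_def using norm_triangle_ineq4[of "cis (2 * pi * \<xi> $ i)" 1] by simp

definition two_symbol :: "'n \<Rightarrow> real ^ 'n \<Rightarrow> complex" where
  "two_symbol i \<xi> = plus_symbol i \<xi> - minus_symbol i \<xi>"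

definition zero_symbol :: "'n \<Rightarrow> real ^ 'n \<Rightarrow> complex" where
  "zero_symbol i \<xi> = plus_symbol i \<xi> + minus_symbol i \<xi>"

lemma two_symbol_eq: "two_symbol i \<xi> = complex_of_real (2 * cos (2 * pi * \<xi> $ i) - 2)"
  by (simp add: two_symbol_def plus_symbol_def minus_symbol_def complex_eq_iff)

lemma zero_symbol_eq: "zero_symbol i \<xi> = \<i> * complex_of_real (2 * sin (2 * pi * \<xi> $ i))"
  by (simp add: zero_symbol_def plus_symbol_def minus_symbol_def complex_eq_iff)

lemma two_symbol_measurable [measurable]: "two_symbol i \<in> borel_measurable torus"
  unfolding two_symbol_def by measurable

lemma zero_symbol_measurable [measurable]: "zero_symbol i \<in> borel_measurable torus"
  unfolding zero_symbol_def by measurable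

lemma cmod_two_symbol_le:
  "cmod (two_symbol i \<xi>) \<le> 2 * sqrt (neg_laplacian_symbol \<xi>)" "cmod (two_symbol i \<xi>) \<le> 4"
  unfolding two_symbol_def
  using norm_triangle_ineq4[of "plus_symbol i \<xi>" "minus_symbol i \<xi>"] cmod_minus_symbol[of i \<xi>]
    cmod_plus_symbol_le[of i \<xi>] cmod_plus_symbol_le_2[of i \<xi>] by linarith+

lemma cmod_zero_symbol_le:
  "cmod (zero_symbol i \<xi>) \<le> 2 * sqrt (neg_laplacian_symbol \<xi>)" "cmod (zero_symbol i \<xi>) \<le> 4"
  unfolding zero_symbol_def
  using norm_triangle_ineq[of "plus_symbol i \<xi>" "minus_symbol i \<xi>"] cmod_minus_symbol[of i \<xi>]
    cmod_plus_symbol_le[of i \<xi>] cmod_plus_symbol_le_2[of i \<xi>] by linarith+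

lemma good_multiplier_plus_symbol: "good_multiplier (plus_symbol i)"
  unfolding plus_symbol_character[abs_def]
  by (intro good_multiplier_diff good_multiplier_character good_multiplier_const)

lemma good_multiplier_minus_symbol: "good_multiplier (minus_symbol i)"
  unfolding minus_symbol_character[abs_def]
  by (intro good_multiplier_diff good_multiplier_character good_multiplier_const)

lemma neg_laplacian_symbol_eq:
  "complex_of_real (neg_laplacian_symbol \<xi>) = (\<Sum>j\<in>UNIV. minus_symbol j \<xi> - plus_symbol j \<xi>)"
  unfolding neg_laplacian_symbol_def of_real_sum
  by (intro sum.cong refl) (simp add: plus_symbol_def minus_symbol_def complex_eq_iff)

lemma good_multiplier_neg_laplacian_symbol:
  "good_multiplier (\<lambda>\<xi>. complex_of_real (neg_laplacian_symbol \<xi>))"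
  unfolding neg_laplacian_symbol_eq
  by (intro good_multiplier_sum good_multiplier_diff good_multiplier_plus_symbol good_multiplier_minus_symbol)

text \<open>The multiplier \<open>(-\<Delta>)\<^bsup>-1/2\<^esup>\<close> is a monotone limit of trigonometric polynomials: expand
  \<open>(1 + w)\<^bsup>-1/2\<^esup>\<close> with \<open>w = L / (4 N) - 1 \<le> 0\<close> into its binomial series, all terms of which are
  nonnegative.\<close>

lemma good_multiplier_div_sqrt:
  fixes m :: "real ^ 'n::finite \<Rightarrow> complex"
  assumes m: "good_multiplier m" and le: "\<And>\<xi>. cmod (m \<xi>) \<le> sqrt (neg_laplacian_symbol \<xi>)"
  shows "good_multiplier (\<lambda>\<xi>. m \<xi> / complex_of_real (sqrt (neg_laplacian_symbol \<xi>)))"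
proof -
  define N where "N = real CARD('n)"
  have "N > 0" by (simp add: N_def)
  define w where "w \<xi> = neg_laplacian_symbol \<xi> / (4 * N) - 1" for \<xi> :: "real ^ 'n"
  have w: "-1 \<le> w \<xi>" "w \<xi> \<le> 0" for \<xi>
    using neg_laplacian_symbol_nonneg[of \<xi>] neg_laplacian_symbol_le[of \<xi>] \<open>N > 0\<close>
    by (auto simp: w_def N_def divide_simps)
  define S where "S k \<xi> = (\<Sum>n<k. ((-1/2) gchoose n) * w \<xi> ^ n)" for k \<xi>
  \<comment> \<open>The binomial coefficient at -1/2 has the sign (-1)^n, which cancels that of
    \<open>w \<xi> ^ n\<close>.\<close>
  have nonneg: "0 \<le> ((-1/2) gchoose n) * w \<xi> ^ n" for n \<xi>
  proof -
    have "((-1/2) gchoose n) * w \<xi> ^ n = pochhammer (1/2) n / fact n * (- w \<xi>) ^ n"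
      by (simp add: gbinomial_pochhammer power_mult_distrib[symmetric])
    then show ?thesis using w[of \<xi>] by (auto intro!: mult_nonneg_nonneg divide_nonneg_nonneg pochhammer_nonneg zero_le_power)
  qed
  have sums: "(\<lambda>n. ((-1/2) gchoose n) * w \<xi> ^ n) sums (2 * sqrt N / sqrt (neg_laplacian_symbol \<xi>))"
    if "neg_laplacian_symbol \<xi> > 0" for \<xi>
  proof -
    have "\<bar>w \<xi>\<bar> < 1" using that w[of \<xi>] \<open>N > 0\<close> by (auto simp: w_def)
    from gen_binomial_real[OF this, of "-1/2"]
    have "(\<lambda>n. ((-1/2) gchoose n) * w \<xi> ^ n) sums (1 + w \<xi>) powr (-1/2)" .
    also have "(1 + w \<xi>) powr (-1/2) = 1 / sqrt (neg_laplacian_symbol \<xi> / (4 * N))"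
      using that \<open>N > 0\<close> powr_minus[of "neg_laplacian_symbol \<xi> / (4 * N)" "1/2"]
      by (simp add: w_def powr_half_sqrt divide_simps)
    also have "\<dots> = 2 * sqrt N / sqrt (neg_laplacian_symbol \<xi>)"
      by (simp add: real_sqrt_divide real_sqrt_mult)
    finally show ?thesis .
  qed
  \<comment> \<open>As 1 + w = L / (4 N), the series sums to 2 sqrt N / sqrt L; the division takes
    the constant out again.\<close>
  define m' where "m' k \<xi> = m \<xi> * complex_of_real (S k \<xi> / (2 * sqrt N))" for k \<xi>
  \<comment> \<open>Where L vanishes so does m, and the quotient is 0 there by the convention on
    division by zero. The approximations vanish at such points too, so the limit holds everywhere
    and not just almost everywhere.\<close>
  have zero: "m \<xi> = 0" if "neg_laplacian_symbol \<xi> = 0" for \<xi>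
    using le[of \<xi>] that by simp
  show ?thesis
  proof (rule good_multiplier_limit[where m = m' and B = 1])
    fix k
    have "good_multiplier (\<lambda>\<xi>. complex_of_real (w \<xi>))"
    proof -
      have "good_multiplier (\<lambda>\<xi>. complex_of_real (1 / (4 * N)) * complex_of_real (neg_laplacian_symbol \<xi>) - 1)"
        by (intro good_multiplier_diff good_multiplier_mult good_multiplier_const good_multiplier_neg_laplacian_symbol)
      then show ?thesis by (simp add: w_def)
    qed
    then have "good_multiplier (\<lambda>\<xi>. m \<xi> * ((\<Sum>n<k. complex_of_real ((-1/2) gchoose n) * complex_of_real (w \<xi>) ^ n) * complex_of_real (1 / (2 * sqrt N))))"
      by (intro good_multiplier_mult m good_multiplier_sum good_multiplier_const good_multiplier_power)
    then show "good_multiplier (m' k)"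
      by (simp add: m'_def[abs_def] S_def)
  next
    fix k and \<xi> :: "real ^ 'n"
    show "cmod (m' k \<xi>) \<le> 1"
    proof (cases "neg_laplacian_symbol \<xi> = 0")
      case False
      then have pos: "neg_laplacian_symbol \<xi> > 0" using neg_laplacian_symbol_nonneg[of \<xi>] by simp
      have "S k \<xi> \<le> 2 * sqrt N / sqrt (neg_laplacian_symbol \<xi>)"
        unfolding S_def using sums[OF pos] nonneg by (metis sum_le_suminf finite_lessThan sums_iff)
      moreover have "0 \<le> S k \<xi>" unfolding S_def by (intro sum_nonneg nonneg)
      ultimately have "cmod (m' k \<xi>) \<le> sqrt (neg_laplacian_symbol \<xi>) * (1 / sqrt (neg_laplacian_symbol \<xi>))"
        unfolding m'_def norm_mult norm_of_real using \<open>N > 0\<close> pos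
        by (intro mult_mono le) (auto simp: divide_simps mult_ac)
      with pos show ?thesis by simp
    qed (simp add: zero m'_def)
  next
    fix \<xi> :: "real ^ 'n"
    show "(\<lambda>k. m' k \<xi>) \<longlonglongrightarrow> m \<xi> / complex_of_real (sqrt (neg_laplacian_symbol \<xi>))"
    proof (cases "neg_laplacian_symbol \<xi> = 0")
      case False
      then have pos: "neg_laplacian_symbol \<xi> > 0" using neg_laplacian_symbol_nonneg[of \<xi>] by simp
      have "(\<lambda>k. m' k \<xi>) \<longlonglongrightarrow> m \<xi> * complex_of_real (2 * sqrt N / sqrt (neg_laplacian_symbol \<xi>) / (2 * sqrt N))"
        unfolding m'_def using sums[OF pos] \<open>N > 0\<close>
        by (intro tendsto_intros) (auto simp: S_def sums_def)
      then show ?thesis using \<open>N > 0\<close> by (simp add: field_simps)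
    qed (simp add: zero m'_def)
  qed
qed

text \<open>Multipliers commute, so the four products in \<open>riesz2\<close> coincide in pairs and
  its factor 1/4 becomes 1/2.\<close>

definition riesz_symbol :: "'n::finite \<Rightarrow> 'n \<Rightarrow> real ^ 'n \<Rightarrow> complex" where
  "riesz_symbol i j \<xi> = (plus_symbol i \<xi> * minus_symbol j \<xi> + plus_symbol j \<xi> * minus_symbol i \<xi>)
     / complex_of_real (2 * neg_laplacian_symbol \<xi>)"

text \<open>The second and symmetric differences are the difference and the sum of the forward and
  backward ones, so the products of equal type cancel. This is the form in which the probabilistic
  side delivers the symbol.\<close>

lemma riesz_symbol_eq:
  "riesz_symbol i j \<xi> = (zero_symbol i \<xi> * zero_symbol j \<xi> - two_symbol i \<xi> * two_symbol j \<xi>)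
     / complex_of_real (4 * neg_laplacian_symbol \<xi>)"
proof -
  have "zero_symbol i \<xi> * zero_symbol j \<xi> - two_symbol i \<xi> * two_symbol j \<xi>
      = 2 * (plus_symbol i \<xi> * minus_symbol j \<xi> + plus_symbol j \<xi> * minus_symbol i \<xi>)"
    by (simp add: zero_symbol_def two_symbol_def algebra_simps)
  moreover have "complex_of_real (4 * neg_laplacian_symbol \<xi>) = 2 * complex_of_real (2 * neg_laplacian_symbol \<xi>)"
    by simp
  ultimately show ?thesis
    unfolding riesz_symbol_def by (simp only: mult_divide_mult_cancel_left_if) simp
qed

lemma riesz_symbol_measurable [measurable]: "riesz_symbol i j \<in> borel_measurable torus"
  unfolding riesz_symbol_def by measurable

lemma cmod_riesz_symbol_le: "cmod (riesz_symbol i j \<xi>) \<le> 1"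
proof (cases "neg_laplacian_symbol \<xi> = 0")
  case False
  then have pos: "neg_laplacian_symbol \<xi> > 0" using neg_laplacian_symbol_nonneg[of \<xi>] by simp
  have le: "cmod (plus_symbol k \<xi> * minus_symbol l \<xi>) \<le> neg_laplacian_symbol \<xi>" for k l
  proof -
    have "cmod (plus_symbol k \<xi> * minus_symbol l \<xi>)
        \<le> sqrt (neg_laplacian_symbol \<xi>) * sqrt (neg_laplacian_symbol \<xi>)"
      unfolding norm_mult cmod_minus_symbol by (intro mult_mono cmod_plus_symbol_le) (use pos in auto)
    then show ?thesis using pos by simp
  qed
  have "cmod (plus_symbol i \<xi> * minus_symbol j \<xi> + plus_symbol j \<xi> * minus_symbol i \<xi>) \<le> 2 * neg_laplacian_symbol \<xi>"
    using norm_triangle_ineq[of "plus_symbol i \<xi> * minus_symbol j \<xi>" "plus_symbol j \<xi> * minus_symbol i \<xi>"]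
      le[of i j] le[of j i] by linarith
  then show ?thesis
    unfolding riesz_symbol_def norm_divide norm_of_real using pos by simp
qed (simp add: riesz_symbol_def)

lemma riesz_plus_minus:
  assumes g: "in_l2 g"
  shows "riesz_plus i (riesz_minus j g) x =
      (\<integral>\<xi>. plus_symbol i \<xi> * minus_symbol j \<xi> / complex_of_real (neg_laplacian_symbol \<xi>) * fourier g \<xi> * character x \<xi> \<partial>torus)"
    and "riesz_minus i (riesz_plus j g) x =
      (\<integral>\<xi>. plus_symbol j \<xi> * minus_symbol i \<xi> / complex_of_real (neg_laplacian_symbol \<xi>) * fourier g \<xi> * character x \<xi> \<partial>torus)"
proof -
  have sq: "complex_of_real (sqrt (neg_laplacian_symbol \<xi>)) * complex_of_real (sqrt (neg_laplacian_symbol \<xi>))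
      = complex_of_real (neg_laplacian_symbol \<xi>)" for \<xi> :: "real ^ 'a"
    by (simp flip: of_real_mult add: neg_laplacian_symbol_nonneg)
  have gp: "good_multiplier (\<lambda>\<xi>. plus_symbol j \<xi> / complex_of_real (sqrt (neg_laplacian_symbol \<xi>)))"
    by (intro good_multiplier_div_sqrt good_multiplier_plus_symbol cmod_plus_symbol_le)
  have gm: "good_multiplier (\<lambda>\<xi>. minus_symbol j \<xi> / complex_of_real (sqrt (neg_laplacian_symbol \<xi>)))"
    by (intro good_multiplier_div_sqrt good_multiplier_minus_symbol) (simp add: cmod_minus_symbol cmod_plus_symbol_le)
  show "riesz_plus i (riesz_minus j g) x =
      (\<integral>\<xi>. plus_symbol i \<xi> * minus_symbol j \<xi> / complex_of_real (neg_laplacian_symbol \<xi>) * fourier g \<xi> * character x \<xi> \<partial>torus)"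
    unfolding riesz_plus_def riesz_minus_def
    by (subst multiplier_multiplier[OF gm g]) (simp_all add: sq)
  show "riesz_minus i (riesz_plus j g) x =
      (\<integral>\<xi>. plus_symbol j \<xi> * minus_symbol i \<xi> / complex_of_real (neg_laplacian_symbol \<xi>) * fourier g \<xi> * character x \<xi> \<partial>torus)"
    unfolding riesz_plus_def riesz_minus_def
    by (subst multiplier_multiplier[OF gp g]) (simp_all add: sq mult.commute)
qed

lemma riesz2_eq_integral:
  assumes g: "in_l2 g"
  shows "riesz2 i j g x = (\<integral>\<xi>. riesz_symbol i j \<xi> * fourier g \<xi> * character x \<xi> \<partial>torus)"
proof -
  let ?q = "\<lambda>i j \<xi>. plus_symbol i \<xi> * minus_symbol j \<xi> / complex_of_real (neg_laplacian_symbol \<xi>)"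
  have F: "square_integrable torus (fourier g)"
    using is_fourierD(1)[OF is_fourier_fourier[OF g]] .
  have int: "integrable torus (\<lambda>\<xi>. ?q i j \<xi> * fourier g \<xi> * character x \<xi>)" for i j
  proof (rule torus_integrable_mult[OF F, where B = 1])
    fix \<xi>
    have "cmod (plus_symbol i \<xi> * minus_symbol j \<xi>)
        \<le> sqrt (neg_laplacian_symbol \<xi>) * sqrt (neg_laplacian_symbol \<xi>)"
      unfolding norm_mult cmod_minus_symbol
      by (intro mult_mono cmod_plus_symbol_le) (auto simp: neg_laplacian_symbol_nonneg)
    then show "cmod (?q i j \<xi>) \<le> 1"
      using neg_laplacian_symbol_nonneg[of \<xi>]
      by (cases "neg_laplacian_symbol \<xi> = 0") (simp_all add: norm_divide)
  qed measurable
  have "riesz_symbol i j \<xi> * fourier g \<xi> * character x \<xi> =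
     1/2 * (?q i j \<xi> * fourier g \<xi> * character x \<xi> + ?q j i \<xi> * fourier g \<xi> * character x \<xi>)" for \<xi>
  proof -
    have "riesz_symbol i j \<xi> = 1/2 * (?q i j \<xi> + ?q j i \<xi>)"
      by (simp add: riesz_symbol_def add_divide_distrib[symmetric])
    then show ?thesis by (simp only: distrib_left distrib_right mult.assoc)
  qed
  note eq = this
  have "(\<integral>\<xi>. riesz_symbol i j \<xi> * fourier g \<xi> * character x \<xi> \<partial>torus)
     = 1/2 * ((\<integral>\<xi>. ?q i j \<xi> * fourier g \<xi> * character x \<xi> \<partial>torus)
        + (\<integral>\<xi>. ?q j i \<xi> * fourier g \<xi> * character x \<xi> \<partial>torus))"
    by (simp only: eq integral_mult_right_zero Bochner_Integration.integral_add[OF int int])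
  note eq = this
  show ?thesis
    unfolding riesz2_def riesz_plus_minus[OF g] eq by simp
qed

section \<open>The heat semigroup in Fourier space\<close>

lemma character_diff: "character (x - y) \<xi> = character x \<xi> * character (- y) \<xi>"
  using character_add[of x "- y"] by simp

text \<open>A shift by \<open>axis i 1\<close> multiplies the integrand by a character. The lemma
  starts from an integral representation of u with a general symbol a and returns one, so it can be
  iterated along powers of the Laplacian and applied to the heat extension.\<close>

lemma diff_multiplier:
  assumes F: "square_integrable torus F" and a: "a \<in> borel_measurable torus"
    "\<And>\<xi>. \<xi> \<in> space torus \<Longrightarrow> cmod (a \<xi>) \<le> B"
    and u: "\<And>y. u y = (\<integral>\<xi>. a \<xi> * F \<xi> * character y \<xi> \<partial>torus)"
  shows "diff_plus i u y = (\<integral>\<xi>. (plus_symbol i \<xi> * a \<xi>) * F \<xi> * character y \<xi> \<partial>torus)"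
    and "diff_minus i u y = (\<integral>\<xi>. (minus_symbol i \<xi> * a \<xi>) * F \<xi> * character y \<xi> \<partial>torus)"
    and "diff_two i u y = (\<integral>\<xi>. (two_symbol i \<xi> * a \<xi>) * F \<xi> * character y \<xi> \<partial>torus)"
    and "diff_zero i u y = (\<integral>\<xi>. (zero_symbol i \<xi> * a \<xi>) * F \<xi> * character y \<xi> \<partial>torus)"
proof -
  note [measurable] = a(1)
  have int: "integrable torus (\<lambda>\<xi>. a \<xi> * F \<xi> * character y \<xi>)" for y
    by (rule torus_integrable_mult[OF F a])
  have intp: "integrable torus (\<lambda>\<xi>. (s \<xi> * a \<xi>) * F \<xi> * character y \<xi>)"
    if [measurable]: "s \<in> borel_measurable torus" and s: "\<And>\<xi>. cmod (s \<xi>) \<le> 2" for s y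
    by (rule torus_integrable_mult[OF F, where B = "2 * B"])
       (auto simp: norm_mult intro!: mult_mono s a)
  have ip: "integrable torus (\<lambda>\<xi>. (plus_symbol i \<xi> * a \<xi>) * F \<xi> * character y \<xi>)"
    and im: "integrable torus (\<lambda>\<xi>. (minus_symbol i \<xi> * a \<xi>) * F \<xi> * character y \<xi>)"
    by (rule intp; simp add: cmod_minus_symbol cmod_plus_symbol_le_2)+
  show p: "diff_plus i u y = (\<integral>\<xi>. (plus_symbol i \<xi> * a \<xi>) * F \<xi> * character y \<xi> \<partial>torus)"
    unfolding diff_plus_def u using int[of y] int[of "y + axis i 1"]
    by (subst Bochner_Integration.integral_diff[symmetric])
       (auto simp: plus_symbol_character character_add algebra_simps)
  show m: "diff_minus i u y = (\<integral>\<xi>. (minus_symbol i \<xi> * a \<xi>) * F \<xi> * character y \<xi> \<partial>torus)"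
    unfolding diff_minus_def u using int[of y] int[of "y - axis i 1"]
    by (subst Bochner_Integration.integral_diff[symmetric])
       (auto simp: minus_symbol_character character_diff algebra_simps)
  show "diff_two i u y = (\<integral>\<xi>. (two_symbol i \<xi> * a \<xi>) * F \<xi> * character y \<xi> \<partial>torus)"
    unfolding diff_two_def p m using ip im
    by (subst Bochner_Integration.integral_diff[symmetric])
       (auto simp: two_symbol_def algebra_simps)
  show "diff_zero i u y = (\<integral>\<xi>. (zero_symbol i \<xi> * a \<xi>) * F \<xi> * character y \<xi> \<partial>torus)"
    unfolding diff_zero_def p m using ip im
    by (subst Bochner_Integration.integral_add[symmetric])
       (auto simp: zero_symbol_def algebra_simps)
qed

lemma of_real_diff_two: "complex_of_real (diff_two i f y) = diff_two i (\<lambda>y. of_real (f y)) y"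
  by (simp only: diff_two_def diff_plus_def diff_minus_def of_real_diff)

lemma of_real_diff_zero: "complex_of_real (diff_zero i f y) = diff_zero i (\<lambda>y. of_real (f y)) y"
  by (simp only: diff_zero_def diff_plus_def diff_minus_def of_real_diff of_real_add)

lemma in_l2_of_real: "in_l2 f \<Longrightarrow> in_l2 (\<lambda>y. complex_of_real (f y))"
  by (simp add: in_l2_def)

lemma laplacian_power_eq_integral:
  fixes f :: "int ^ 'n::finite \<Rightarrow> real"
  assumes f: "in_l2 f"
  defines "F \<equiv> fourier (\<lambda>y. complex_of_real (f y))"
  shows "complex_of_real ((laplacian ^^ k) f y)
    = (\<integral>\<xi>. complex_of_real ((- neg_laplacian_symbol \<xi>) ^ k) * F \<xi> * character y \<xi> \<partial>torus)"
proof (induction k arbitrary: y)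
  case 0
  show ?case
    using fourier_coeff_is_fourier[OF is_fourier_fourier[OF in_l2_of_real[OF f]], of y]
    by (simp add: fourier_coeff_def F_def)
next
  case (Suc k)
  have F: "square_integrable torus F"
    unfolding F_def using is_fourierD(1)[OF is_fourier_fourier[OF in_l2_of_real[OF f]]] .
  have B: "cmod (complex_of_real ((- neg_laplacian_symbol \<xi>) ^ k)) \<le> (4 * real CARD('n)) ^ k" for \<xi> :: "real ^ 'n"
    unfolding norm_of_real power_abs using neg_laplacian_symbol_le[of \<xi>] neg_laplacian_symbol_nonneg[of \<xi>]
    by (intro power_mono) auto
  have "complex_of_real ((laplacian ^^ Suc k) f y)
     = (\<Sum>i\<in>UNIV. diff_two i (\<lambda>y. complex_of_real ((laplacian ^^ k) f y)) y)"
    by (simp add: laplacian_def of_real_diff_two)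
  also have "\<dots> = (\<Sum>i\<in>UNIV. \<integral>\<xi>. (two_symbol i \<xi> * complex_of_real ((- neg_laplacian_symbol \<xi>) ^ k)) * F \<xi> * character y \<xi> \<partial>torus)"
    by (intro sum.cong refl diff_multiplier(3)[OF F _ B] Suc) measurable
  also have "\<dots> = (\<integral>\<xi>. (\<Sum>i\<in>UNIV. (two_symbol i \<xi> * complex_of_real ((- neg_laplacian_symbol \<xi>) ^ k)) * F \<xi> * character y \<xi>) \<partial>torus)"
  proof (intro Bochner_Integration.integral_sum[symmetric]
         torus_integrable_mult[OF F, where B = "4 * (4 * real CARD('n)) ^ k"])
    show "cmod (two_symbol i \<xi> * complex_of_real ((- neg_laplacian_symbol \<xi>) ^ k)) \<le> 4 * (4 * real CARD('n)) ^ k"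
      for i :: 'n and \<xi> :: "real ^ 'n"
      unfolding norm_mult[of "two_symbol i \<xi>"] by (intro mult_mono B cmod_two_symbol_le norm_ge_zero) simp_all
  qed measurable
  also have "\<dots> = (\<integral>\<xi>. complex_of_real ((- neg_laplacian_symbol \<xi>) ^ Suc k) * F \<xi> * character y \<xi> \<partial>torus)"
  proof -
    have "(\<Sum>i\<in>UNIV. (two_symbol i \<xi> * complex_of_real ((- neg_laplacian_symbol \<xi>) ^ k)) * F \<xi> * character y \<xi>)
       = complex_of_real ((- neg_laplacian_symbol \<xi>) ^ Suc k) * F \<xi> * character y \<xi>" for \<xi>
    proof -
      have "(\<Sum>i\<in>UNIV. two_symbol i \<xi>) = complex_of_real (- neg_laplacian_symbol \<xi>)"
        by (simp add: neg_laplacian_symbol_eq two_symbol_def sum_negf[symmetric])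
      then show ?thesis by (simp add: sum_distrib_right[symmetric])
    qed
    then show ?thesis by simp
  qed
  finally show ?case .
qed

text \<open>The symbol lies between 0 and \<open>4 * CARD('n)\<close>, so the exponential series
  under the integral is dominated by the convergent series of (|t| 4 CARD)^k / k! times |F|, and
  summation and integration can be exchanged for every real t.\<close>

lemma
  fixes f :: "int ^ 'n::finite \<Rightarrow> real"
  assumes f: "in_l2 f"
  defines "F \<equiv> fourier (\<lambda>y. complex_of_real (f y))"
  shows summable_heat: "summable (\<lambda>k. t ^ k / fact k * (laplacian ^^ k) f y)"
    and heat_eq_integral: "complex_of_real (heat t f y)
    = (\<integral>\<xi>. complex_of_real (exp (- t * neg_laplacian_symbol \<xi>)) * F \<xi> * character y \<xi> \<partial>torus)"
proof -
  have F: "square_integrable torus F"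
    unfolding F_def using is_fourierD(1)[OF is_fourier_fourier[OF in_l2_of_real[OF f]]] .
  have [measurable]: "F \<in> borel_measurable torus" using F by (simp add: square_integrable_def)
  have iF: "integrable torus (\<lambda>\<xi>. cmod (F \<xi>))"
    using torus.square_integrable_imp_integrable_complex[OF F] by simp
  define N where "N = 4 * real CARD('n)"
  define h where "h k \<xi> = complex_of_real (t ^ k / fact k * (- neg_laplacian_symbol \<xi>) ^ k) * F \<xi> * character y \<xi>" for k \<xi>
  have B: "cmod (complex_of_real (t ^ k / fact k * (- neg_laplacian_symbol \<xi>) ^ k)) \<le> (\<bar>t\<bar> * N) ^ k / fact k" for k and \<xi> :: "real ^ 'n"
  proof -
    have "cmod (complex_of_real (t ^ k / fact k * (- neg_laplacian_symbol \<xi>) ^ k)) = (\<bar>t\<bar> * neg_laplacian_symbol \<xi>) ^ k / fact k"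
      unfolding norm_of_real using neg_laplacian_symbol_nonneg[of \<xi>]
      by (simp add: abs_mult power_abs power_mult_distrib)
    also have "\<dots> \<le> (\<bar>t\<bar> * N) ^ k / fact k"
      unfolding N_def using neg_laplacian_symbol_le[of \<xi>] neg_laplacian_symbol_nonneg[of \<xi>]
      by (intro divide_right_mono power_mono mult_left_mono) auto
    finally show ?thesis .
  qed
  have ih: "integrable torus (h k)" for k
    unfolding h_def by (rule torus_integrable_mult[OF F _ B]) measurable
  have nh: "cmod (h k \<xi>) \<le> (\<bar>t\<bar> * N) ^ k / fact k * cmod (F \<xi>)" for k \<xi>
    using mult_right_mono[OF B[of k \<xi>] norm_ge_zero[of "F \<xi>"]]
    by (simp only: h_def norm_mult norm_character mult_1_right)
  have sm: "summable (\<lambda>k. (\<bar>t\<bar> * N) ^ k / fact k)"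
    using summable_exp[of "\<bar>t\<bar> * N"] by (simp add: field_simps)
  have "(\<lambda>k. \<integral>\<xi>. h k \<xi> \<partial>torus) sums (\<integral>\<xi>. (\<Sum>k. h k \<xi>) \<partial>torus)"
  proof (rule sums_integral[OF ih])
    show "AE \<xi> in torus. summable (\<lambda>k. norm (h k \<xi>))"
      by (intro AE_I2 summable_comparison_test'[OF summable_mult2[OF sm]]) (use nh in auto)
    show "summable (\<lambda>k. \<integral>\<xi>. norm (h k \<xi>) \<partial>torus)"
    proof (rule summable_comparison_test'[OF summable_mult2[OF sm]])
      fix k
      have "norm (\<integral>\<xi>. norm (h k \<xi>) \<partial>torus) = (\<integral>\<xi>. norm (h k \<xi>) \<partial>torus)"
        by simp
      also have "\<dots> \<le> (\<integral>\<xi>. (\<bar>t\<bar> * N) ^ k / fact k * cmod (F \<xi>) \<partial>torus)"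
        by (intro integral_mono integrable_norm ih nh integrable_mult_right iF)
      also have "\<dots> = (\<bar>t\<bar> * N) ^ k / fact k * (\<integral>\<xi>. cmod (F \<xi>) \<partial>torus)"
        by (rule integral_mult_right_zero)
      finally show "norm (\<integral>\<xi>. norm (h k \<xi>) \<partial>torus) \<le> (\<bar>t\<bar> * N) ^ k / fact k * (\<integral>\<xi>. cmod (F \<xi>) \<partial>torus)" .
    qed
  qed
  moreover have "(\<Sum>k. h k \<xi>) = complex_of_real (exp (- t * neg_laplacian_symbol \<xi>)) * F \<xi> * character y \<xi>" for \<xi>
  proof -
    have "(\<lambda>k. (- t * neg_laplacian_symbol \<xi>) ^ k / fact k) sums exp (- t * neg_laplacian_symbol \<xi>)"
      using exp_converges[of "- t * neg_laplacian_symbol \<xi>"] by (simp add: divide_inverse mult.commute)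
    also have "(\<lambda>k. (- t * neg_laplacian_symbol \<xi>) ^ k / fact k) = (\<lambda>k. t ^ k / fact k * (- neg_laplacian_symbol \<xi>) ^ k)"
      by (simp add: fun_eq_iff power_mult_distrib[symmetric])
    finally have "(\<lambda>k. h k \<xi>) sums (complex_of_real (exp (- t * neg_laplacian_symbol \<xi>)) * F \<xi> * character y \<xi>)"
      unfolding h_def by (intro sums_mult2 sums_of_real)
    then show ?thesis by (simp add: sums_iff)
  qed
  moreover have "(\<integral>\<xi>. h k \<xi> \<partial>torus) = complex_of_real (t ^ k / fact k * (laplacian ^^ k) f y)" for k
    unfolding of_real_mult[of _ "(laplacian ^^ k) f y"] laplacian_power_eq_integral[OF f] h_def F_def
    by (simp add: mult.assoc)
  ultimately have "(\<lambda>k. complex_of_real (t ^ k / fact k * (laplacian ^^ k) f y)) sums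
      (\<integral>\<xi>. complex_of_real (exp (- t * neg_laplacian_symbol \<xi>)) * F \<xi> * character y \<xi> \<partial>torus)"
    by simp
  note sums = this
  have *: "(\<lambda>k. t ^ k / fact k * (laplacian ^^ k) f y) sums
      Re (\<integral>\<xi>. complex_of_real (exp (- t * neg_laplacian_symbol \<xi>)) * F \<xi> * character y \<xi> \<partial>torus)"
    using sums_Re[OF sums] by (simp only: Re_complex_of_real)
  then have "(\<lambda>k. complex_of_real (t ^ k / fact k * (laplacian ^^ k) f y)) sums complex_of_real (heat t f y)"
    unfolding heat_def by (intro sums_of_real) (simp add: sums_iff)
  from this sums show "complex_of_real (heat t f y)
    = (\<integral>\<xi>. complex_of_real (exp (- t * neg_laplacian_symbol \<xi>)) * F \<xi> * character y \<xi> \<partial>torus)"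
    by (rule sums_unique2)
  show "summable (\<lambda>k. t ^ k / fact k * (laplacian ^^ k) f y)"
    using * by (rule sums_summable)
qed


lemma isCont_heat:
  assumes "in_l2 f"
  shows "isCont (\<lambda>t. heat t f y) t"
proof -
  have "isCont (\<lambda>t. \<Sum>k. ((laplacian ^^ k) f y / fact k) * t ^ k) t"
    using summable_heat[OF assms] by (intro isCont_powser_converges_everywhere) (simp add: mult.commute)
  then show ?thesis by (simp add: heat_def[abs_def] mult.commute)
qed

lemma isCont_diff_heat:
  assumes "in_l2 f"
  shows "isCont (\<lambda>t. diff_two i (heat t f) y) t" "isCont (\<lambda>t. diff_zero i (heat t f) y) t"
  unfolding diff_two_def diff_zero_def diff_plus_def diff_minus_def
  by (intro continuous_intros isCont_heat assms)+

text \<open>The two bounds are uniform in the point and in the time t; they supply the constant that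
  dominates the Riemann sums for the compensator. The 4 is the maximal modulus of
  \<open>two_symbol\<close> and \<open>zero_symbol\<close>.\<close>

lemma diff_heat_eq_integral:
  fixes f :: "int ^ 'n::finite \<Rightarrow> real"
  assumes f: "in_l2 f" and t: "0 \<le> t"
  defines "F \<equiv> fourier (\<lambda>y. complex_of_real (f y))"
  shows "complex_of_real (diff_two j (heat t f) y)
      = (\<integral>\<xi>. (two_symbol j \<xi> * complex_of_real (exp (- t * neg_laplacian_symbol \<xi>))) * F \<xi> * character y \<xi> \<partial>torus)" (is ?two)
    and "complex_of_real (diff_zero j (heat t f) y)
      = (\<integral>\<xi>. (zero_symbol j \<xi> * complex_of_real (exp (- t * neg_laplacian_symbol \<xi>))) * F \<xi> * character y \<xi> \<partial>torus)" (is ?zero)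
    and "\<bar>diff_two j (heat t f) y\<bar> \<le> 4 * (\<integral>\<xi>. cmod (F \<xi>) \<partial>torus)" (is ?btwo)
    and "\<bar>diff_zero j (heat t f) y\<bar> \<le> 4 * (\<integral>\<xi>. cmod (F \<xi>) \<partial>torus)" (is ?bzero)
proof -
  have F: "square_integrable torus F"
    unfolding F_def using is_fourierD(1)[OF is_fourier_fourier[OF in_l2_of_real[OF f]]] .
  have iF: "integrable torus (\<lambda>\<xi>. cmod (F \<xi>))"
    using torus.square_integrable_imp_integrable_complex[OF F] by simp
  have e: "cmod (complex_of_real (exp (- t * neg_laplacian_symbol \<xi>))) \<le> 1" for \<xi> :: "real ^ 'n"
    using t neg_laplacian_symbol_nonneg[of \<xi>] by simp
  show two: ?two and zero: ?zero
    unfolding of_real_diff_two of_real_diff_zero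
    by (rule diff_multiplier[OF F _ e]; simp add: heat_eq_integral[OF f] F_def)+
  have bound: "\<bar>v\<bar> \<le> 4 * (\<integral>\<xi>. cmod (F \<xi>) \<partial>torus)"
    if v: "complex_of_real v = (\<integral>\<xi>. (s \<xi> * complex_of_real (exp (- t * neg_laplacian_symbol \<xi>))) * F \<xi> * character y \<xi> \<partial>torus)"
      and s: "\<And>\<xi>. cmod (s \<xi>) \<le> 4" for s v
  proof -
    have "\<bar>v\<bar> = cmod (complex_of_real v)" by simp
    also have "\<dots> \<le> (\<integral>\<xi>. 4 * cmod (F \<xi>) \<partial>torus)"
      unfolding v
    proof (rule cmod_integral_le)
      fix \<xi> :: "real ^ 'n"
      have "cmod (s \<xi> * complex_of_real (exp (- t * neg_laplacian_symbol \<xi>))) \<le> 4 * 1"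
        unfolding norm_mult by (intro mult_mono s e) auto
      then show "cmod ((s \<xi> * complex_of_real (exp (- t * neg_laplacian_symbol \<xi>))) * F \<xi> * character y \<xi>) \<le> 4 * cmod (F \<xi>)"
        by (simp only: norm_mult[of _ "F \<xi>"] norm_mult[of _ "character y \<xi>"] norm_character mult_1_right)
          (intro mult_right_mono, auto)
    qed (use iF in auto)
    also have "\<dots> = 4 * (\<integral>\<xi>. cmod (F \<xi>) \<partial>torus)" by simp
    finally show ?thesis .
  qed
  show ?btwo by (rule bound[OF two cmod_two_symbol_le(2)])
  show ?bzero by (rule bound[OF zero cmod_zero_symbol_le(2)])
qed

section \<open>Step paths and their Stieltjes integrals\<close>

text \<open>Integer-valued right-continuous paths with left limits, phrased by local constancy. Only
  times from 0 on are constrained, because the noise is specified only there.\<close>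

definition step_path :: "(real \<Rightarrow> int) \<Rightarrow> bool" where
  "step_path g \<longleftrightarrow> (\<forall>s\<ge>0. \<forall>\<^sub>F u in at_right s. g u = g s)
     \<and> (\<forall>s>0. \<exists>c. \<forall>\<^sub>F u in at_left s. g u = c)"

lemma jump_eqI:
  assumes "\<forall>\<^sub>F u in at_left s. g u = c"
  shows "jump g s = g s - c"
  using tendsto_Lim[OF trivial_limit_at_left_real tendsto_eventually[OF assms]] by (simp add: jump_def)

lemma step_path_left:
  assumes "step_path g" "s > 0"
  shows "\<forall>\<^sub>F u in at_left s. g u = g s - jump g s"
  using assms jump_eqI unfolding step_path_def by (smt (verit) eventually_mono)

lemma step_path_right: "step_path g \<Longrightarrow> 0 \<le> s \<Longrightarrow> \<forall>\<^sub>F u in at_right s. g u = g s"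
  by (simp add: step_path_def)

text \<open>Bisection: the claim passes from two adjacent intervals to their union, and it holds on
  short intervals around any x, since the path is constant on either side of x and can jump only at
  x.\<close>

lemma sum_jumps:
  assumes g: "step_path g" and ab: "0 \<le> a" "a \<le> b"
  shows "finite {s\<in>{a<..b}. jump g s \<noteq> 0}"
    and "(\<Sum>s\<in>{s\<in>{a<..b}. jump g s \<noteq> 0}. jump g s) = g b - g a"
proof -
  \<comment> \<open>Short intervals around 0 reach into negative times, where the path is
    uncontrolled; the premise \<open>0 \<le> u\<close> makes the claim vacuous for them.\<close>
  define P where "P u v \<longleftrightarrow> 0 \<le> u \<longrightarrow> finite {s\<in>{u<..v}. jump g s \<noteq> 0} \<and>
     (\<Sum>s\<in>{s\<in>{u<..v}. jump g s \<noteq> 0}. jump g s) = g v - g u" for u v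
  have "P a b"
  proof (rule Bolzano[OF ab(2)])
    fix u v w assume uvw: "P u v" "P v w" "u \<le> v" "v \<le> w"
    show "P u w"
      unfolding P_def
    proof (intro impI)
      assume "0 \<le> u"
      have eq: "{s\<in>{u<..w}. jump g s \<noteq> 0} = {s\<in>{u<..v}. jump g s \<noteq> 0} \<union> {s\<in>{v<..w}. jump g s \<noteq> 0}"
        using uvw by auto
      show "finite {s\<in>{u<..w}. jump g s \<noteq> 0} \<and>
        (\<Sum>s\<in>{s\<in>{u<..w}. jump g s \<noteq> 0}. jump g s) = g w - g u"
        unfolding eq using uvw \<open>0 \<le> u\<close>
        by (subst sum.union_disjoint) (auto simp: P_def)
    qed
  next
    fix x assume x: "a \<le> x" "x \<le> b"
    then have "0 \<le> x" using ab by simp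
    from step_path_right[OF g this] obtain r where r: "r > x" "\<And>u. x < u \<Longrightarrow> u < r \<Longrightarrow> g u = g x"
      unfolding eventually_at_right_field by auto
    obtain l where l: "l < x" "0 < x \<Longrightarrow> (\<forall>u. l < u \<and> u < x \<longrightarrow> g u = g x - jump g x)"
    proof (cases "0 < x")
      case True
      from step_path_left[OF g this] show ?thesis
        unfolding eventually_at_left_field using that by blast
    qed (use that[of "x - 1"] in auto)
    show "\<exists>d>0. \<forall>u v. u \<le> x \<and> x \<le> v \<and> v - u < d \<longrightarrow> P u v"
    proof (intro exI[of _ "min (r - x) (x - l)"] conjI allI impI)
      fix u v assume uv: "u \<le> x \<and> x \<le> v \<and> v - u < min (r - x) (x - l)"
      show "P u v"
        unfolding P_def
      proof (intro impI)
        assume "0 \<le> u"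
        have gv: "g v = g x" using r(2)[of v] uv by (cases "v = x") auto
        have nojump: "jump g s = 0" if s: "s \<in> {u<..v}" "s \<noteq> x" for s
        proof (cases "s < x")
          case True
          have "\<forall>\<^sub>F z in at_left s. g z = g x - jump g x"
            unfolding eventually_at_left_field
            using l(2) s True uv \<open>0 \<le> u\<close> by (intro exI[of _ l]) auto
          from jump_eqI[OF this] show ?thesis using l s True uv \<open>0 \<le> u\<close> by auto
        next
          case False
          then have "x < s" using s by auto
          have "\<forall>\<^sub>F z in at_left s. g z = g x"
            unfolding eventually_at_left_field
            using r(2) s \<open>x < s\<close> uv by (intro exI[of _ x]) auto
          from jump_eqI[OF this] show ?thesis using r(2)[of s] s \<open>x < s\<close> uv by auto
        qed
        show "finite {s\<in>{u<..v}. jump g s \<noteq> 0} \<and>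
          (\<Sum>s\<in>{s\<in>{u<..v}. jump g s \<noteq> 0}. jump g s) = g v - g u"
        proof (cases "u = x")
          case True
          then have eq: "{s\<in>{u<..v}. jump g s \<noteq> 0} = {}" using nojump by auto
          show ?thesis unfolding eq using gv True by simp
        next
          case False
          then have "u < x" using uv by auto
          then have gu: "g u = g x - jump g x" using l \<open>0 \<le> u\<close> uv by auto
          have "{s\<in>{u<..v}. jump g s \<noteq> 0} = (if jump g x = 0 then {} else {x})"
            using nojump \<open>u < x\<close> uv by auto
          then show ?thesis using gu gv by auto
        qed
      qed
    qed (use r l in auto)
  qed
  then show "finite {s\<in>{a<..b}. jump g s \<noteq> 0}"
    and "(\<Sum>s\<in>{s\<in>{a<..b}. jump g s \<noteq> 0}. jump g s) = g b - g a"
    using ab by (auto simp: P_def)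
qed

section \<open>Counting paths\<close>

definition counting_path :: "(real \<Rightarrow> nat) \<Rightarrow> bool" where
  "counting_path p \<longleftrightarrow> p 0 = 0 \<and> mono_on {0..} p \<and> (\<forall>t\<ge>0. continuous (at_right t) p)"

lemma counting_path_right:
  assumes "counting_path p" "0 \<le> s"
  shows "\<forall>\<^sub>F u in at_right s. p u = p s"
proof -
  have "(p \<longlongrightarrow> p s) (at_right s)"
    using assms by (auto simp: counting_path_def continuous_within)
  then show ?thesis by (simp add: tendsto_discrete)
qed

text \<open>On \<open>{0..<s}\<close> the path takes finitely many values, being bounded by
  \<open>p s\<close>. It attains its maximum at some v, and by monotonicity it is constant from v
  on.\<close>

lemma counting_path_left:
  assumes p: "counting_path p" and "0 < s"
  shows "\<exists>c. \<forall>\<^sub>F u in at_left s. p u = c"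
proof -
  have mono: "p u \<le> p v" if "0 \<le> u" "u \<le> v" for u v
    using p that by (auto simp: counting_path_def mono_on_def)
  have fin: "finite (p ` {0..<s})"
    by (rule finite_subset[of _ "{..p s}"]) (auto intro: mono)
  have ne: "p ` {0..<s} \<noteq> {}" using \<open>0 < s\<close> by auto
  obtain v where v: "v \<in> {0..<s}" "p v = Max (p ` {0..<s})"
    using Max_in[OF fin ne] by auto
  have "\<forall>\<^sub>F u in at_left s. p u = p v"
    unfolding eventually_at_left_field
  proof (intro exI[of _ v] conjI allI impI)
    fix u assume "v < u" "u < s"
    then have "p u \<le> p v" using v fin by (auto intro!: Max_ge)
    moreover have "p v \<le> p u" using v \<open>v < u\<close> by (intro mono) auto
    ultimately show "p u = p v" by simp
  qed (use v in auto)
  then show ?thesis by blast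
qed

lemma step_path_counting: "counting_path p \<Longrightarrow> step_path (\<lambda>s. int (p s))"
  unfolding step_path_def using counting_path_right counting_path_left
  by (smt (verit, best) eventually_mono)

lemma counting_path_mono: "counting_path p \<Longrightarrow> 0 \<le> u \<Longrightarrow> u \<le> v \<Longrightarrow> p u \<le> p v"
  by (auto simp: counting_path_def mono_on_def)

lemma jump_counting_nonneg:
  assumes p: "counting_path p" and "0 < s"
  shows "0 \<le> jump (\<lambda>s. int (p s)) s"
proof -
  have "\<forall>\<^sub>F u in at_left s. int (p u) = int (p s) - jump (\<lambda>s. int (p s)) s \<and> 0 < u \<and> u < s"
    using step_path_left[OF step_path_counting[OF p] \<open>0 < s\<close>] eventually_at_left_real[OF \<open>0 < s\<close>]
    by eventually_elim auto
  then obtain u where "int (p u) = int (p s) - jump (\<lambda>s. int (p s)) s" "0 < u" "u < s"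
    using eventually_happens' trivial_limit_at_left_real by blast
  with counting_path_mono[OF p, of u s] show ?thesis by simp
qed

text \<open>There are finitely many jumps up to any time, so the set \<open>J\<close> of jump times
  does not change shortly after s, and shortly before s it lacks at most s itself. This applies to
  the walk, whose components are such integrals.\<close>

lemma stieltjes_int_path:
  fixes g c x
  assumes g: "step_path g"
  defines "w \<equiv> \<lambda>t. x + stieltjes_int g c t"
  shows "step_path w" and "\<And>s. 0 < s \<Longrightarrow> jump w s = c s * jump g s"
proof -
  define J where "J t = {s\<in>{0<..t}. jump g s \<noteq> 0}" for t
  have w: "w t = x + (\<Sum>s\<in>J t. c s * jump g s)" for t
    by (simp add: w_def stieltjes_int_def J_def)
  have fin: "finite (J t)" for t
    using sum_jumps(1)[OF g, of 0 t] by (cases "0 \<le> t") (auto simp: J_def)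
  have r: "\<forall>\<^sub>F u in at_right s. w u = w s" if "0 \<le> s" for s
  proof -
    have "\<forall>\<^sub>F u in at_right s. \<forall>j\<in>J (s + 1) - J s. u < j"
    proof (intro eventually_ball_finite finite_Diff ballI fin)
      fix j assume "j \<in> J (s + 1) - J s"
      then have "s < j" by (auto simp: J_def)
      from eventually_at_right_real[OF this] show "\<forall>\<^sub>F u in at_right s. u < j"
        by eventually_elim simp
    qed
    moreover have "\<forall>\<^sub>F u in at_right s. s < u \<and> u < s + 1"
      using eventually_at_right_real[of s "s + 1"] by simp
    ultimately show ?thesis
    proof eventually_elim
      case (elim u)
      have "x \<in> J u \<longleftrightarrow> x \<in> J s" for x
        using elim(2) bspec[OF elim(1), of x] by (cases "x \<le> s"; cases "jump g x = 0") (auto simp: J_def)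
      then have "J u = J s" by blast
      then show ?case by (simp add: w)
    qed
  qed
  have l: "\<forall>\<^sub>F u in at_left s. w u = w s - c s * jump g s" if "0 < s" for s
  proof -
    have "\<forall>\<^sub>F u in at_left s. \<forall>j\<in>J s - {s}. j < u"
    proof (intro eventually_ball_finite finite_Diff ballI fin)
      fix j assume "j \<in> J s - {s}"
      then have "j < s" by (auto simp: J_def)
      from eventually_at_left_real[OF this] show "\<forall>\<^sub>F u in at_left s. j < u"
        by eventually_elim simp
    qed
    moreover have "\<forall>\<^sub>F u in at_left s. 0 < u \<and> u < s"
      using eventually_at_left_real[OF that] by simp
    ultimately show ?thesis
    proof eventually_elim
      case (elim u)
      have "x \<in> J s - {s} \<longleftrightarrow> x \<in> J u" for x
        using elim(2) bspec[OF elim(1), of x] by (cases "x \<le> u"; cases "jump g x = 0") (auto simp: J_def)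
      then have "J s - {s} = J u" by blast
      moreover have "(\<Sum>s\<in>J s. c s * jump g s) = c s * jump g s + (\<Sum>s\<in>J s - {s}. c s * jump g s)"
      proof (cases "s \<in> J s")
        case True
        then show ?thesis using fin by (simp add: sum.remove)
      next
        case False
        then have "jump g s = 0" using that by (auto simp: J_def)
        with False show ?thesis by simp
      qed
      ultimately show ?case by (simp add: w)
    qed
  qed
  show "step_path w" using l r unfolding step_path_def by blast
  show "jump w s = c s * jump g s" if "0 < s" for s
    using jump_eqI[OF l[OF that]] by simp
qed

section \<open>Dyadic grids\<close>

definition grid :: "real \<Rightarrow> nat \<Rightarrow> nat \<Rightarrow> real" where
  "grid T n k = T * real k / 2 ^ n"

text \<open>Index of the grid cell containing s. Rounding up and subtracting 1 makes the cells open
  on the left and closed on the right, so a jump at a grid point belongs to the cell that ends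
  there, in accordance with integration over (0, t].\<close>

definition cell :: "real \<Rightarrow> nat \<Rightarrow> real \<Rightarrow> nat" where
  "cell T n s = nat (\<lceil>s * 2 ^ n / T\<rceil> - 1)"

lemma grid_0 [simp]: "grid T n 0 = 0" by (simp add: grid_def)

lemma grid_end [simp]: "grid T n (2 ^ n) = T" by (simp add: grid_def)

lemma grid_mono: "0 \<le> T \<Longrightarrow> k \<le> l \<Longrightarrow> grid T n k \<le> grid T n l"
  by (auto simp: grid_def intro!: divide_right_mono mult_left_mono)

lemma grid_nonneg: "0 \<le> T \<Longrightarrow> 0 \<le> grid T n k"
  by (simp add: grid_def)

lemma grid_Suc: "grid T n (Suc k) = grid T n k + T / 2 ^ n"
  by (simp add: grid_def field_simps)

lemma grid_le: "0 \<le> T \<Longrightarrow> k \<le> 2 ^ n \<Longrightarrow> grid T n k \<le> T"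
  using grid_mono[of T k "2 ^ n" n] by simp

lemma cell_iff:
  assumes "0 < T" "0 < s"
  shows "cell T n s = k \<longleftrightarrow> s \<in> {grid T n k<..grid T n (Suc k)}"
proof -
  have "0 < s * 2 ^ n / T" using assms by simp
  then have c: "1 \<le> \<lceil>s * 2 ^ n / T\<rceil>" by linarith
  have "cell T n s = k \<longleftrightarrow> \<lceil>s * 2 ^ n / T\<rceil> = int k + 1"
    using c by (auto simp: cell_def)
  also have "\<dots> \<longleftrightarrow> real k < s * 2 ^ n / T \<and> s * 2 ^ n / T \<le> real k + 1"
    by (simp add: ceiling_eq_iff)
  also have "\<dots> \<longleftrightarrow> s \<in> {grid T n k<..grid T n (Suc k)}"
    using assms by (auto simp: grid_def field_simps)
  finally show ?thesis .
qed

lemma grid_cell: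
  assumes "0 < T" "0 < s"
  shows "grid T n (cell T n s) < s" "s \<le> grid T n (Suc (cell T n s))" "0 \<le> grid T n (cell T n s)"
  using cell_iff[OF assms, of n "cell T n s"] assms by (auto intro: grid_nonneg)

lemma cell_less:
  assumes "0 < T" "0 < s" "s \<le> T" shows "cell T n s < 2 ^ n"
proof (rule ccontr)
  assume "\<not> cell T n s < 2 ^ n"
  then have "grid T n (2 ^ n) \<le> grid T n (cell T n s)" using assms by (intro grid_mono) auto
  with grid_cell(1)[OF assms(1,2), of n] assms show False by simp
qed

lemma grid_cell_tendsto:
  assumes "0 < T" "0 < s"
  shows "filterlim (\<lambda>n. grid T n (cell T n s)) (at_left s) sequentially"
    and "(\<lambda>n. grid T n (Suc (cell T n s))) \<longlonglongrightarrow> s"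
proof -
  have h: "(\<lambda>n. T / 2 ^ n) \<longlonglongrightarrow> 0"
    using LIMSEQ_divide_realpow_zero[of 2 T] by simp
  have "(\<lambda>n. s - T / 2 ^ n) \<longlonglongrightarrow> s" "(\<lambda>n. s + T / 2 ^ n) \<longlonglongrightarrow> s"
    using tendsto_diff[OF tendsto_const h, of s] tendsto_add[OF tendsto_const h, of s] by auto
  note bounds = this
  have lower: "s - T / 2 ^ n \<le> grid T n (cell T n s)" "s \<le> grid T n (Suc (cell T n s))" for n
    using grid_cell[OF assms, of n] by (auto simp: grid_Suc)
  have upper: "grid T n (Suc (cell T n s)) \<le> s + T / 2 ^ n" "grid T n (cell T n s) \<le> s" for n
    using grid_cell[OF assms, of n] by (auto simp: grid_Suc)
  have "(\<lambda>n. grid T n (cell T n s)) \<longlonglongrightarrow> s"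
    by (rule tendsto_sandwich[OF _ _ bounds(1) tendsto_const]) (use lower upper in auto)
  then show "filterlim (\<lambda>n. grid T n (cell T n s)) (at_left s) sequentially"
    using grid_cell(1)[OF assms] by (auto simp: filterlim_at intro!: always_eventually less_imp_neq)
  show "(\<lambda>n. grid T n (Suc (cell T n s))) \<longlonglongrightarrow> s"
    by (rule tendsto_sandwich[OF _ _ tendsto_const bounds(2)]) (use lower upper in auto)
qed

text \<open>Group the jumps by cells; the increment over a cell is the sum of its jumps. On the
  right the set of summation is finite and does not depend on n, so limits in n can be taken term by
  term.\<close>

lemma grid_sum_eq:
  fixes a :: "nat \<Rightarrow> 'a::ring_1"
  assumes g: "step_path g" and T: "0 < T"
  shows "(\<Sum>k<2^n. a k * of_int (g (grid T n (Suc k)) - g (grid T n k)))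
     = (\<Sum>s\<in>{s\<in>{0<..T}. jump g s \<noteq> 0}. a (cell T n s) * of_int (jump g s))"
proof -
  let ?J = "{s\<in>{0<..T}. jump g s \<noteq> 0}"
  have fin: "finite ?J" using sum_jumps(1)[OF g, of 0 T] T by simp
  have "(\<Sum>s\<in>?J. a (cell T n s) * of_int (jump g s))
     = (\<Sum>k<2^n. \<Sum>s\<in>{s\<in>?J. cell T n s = k}. a (cell T n s) * of_int (jump g s))"
    using T by (intro sum.group[symmetric] fin) (auto intro: cell_less)
  also have "\<dots> = (\<Sum>k<2^n. a k * of_int (g (grid T n (Suc k)) - g (grid T n k)))"
  proof (rule sum.cong[OF refl])
    fix k :: nat assume k: "k \<in> {..<2^n}"
    have "grid T n (Suc k) \<le> T" using k T by (intro grid_le) auto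
    moreover have "0 \<le> grid T n k" using T by (simp add: grid_nonneg)
    ultimately have eq: "{s\<in>?J. cell T n s = k} = {s\<in>{grid T n k<..grid T n (Suc k)}. jump g s \<noteq> 0}"
      using cell_iff[OF T] by auto
    have "(\<Sum>s\<in>{s\<in>?J. cell T n s = k}. a (cell T n s) * of_int (jump g s))
       = (\<Sum>s\<in>{s\<in>?J. cell T n s = k}. a k * of_int (jump g s))"
      by (intro sum.cong) auto
    also have "\<dots> = a k * of_int (\<Sum>s\<in>{s\<in>{grid T n k<..grid T n (Suc k)}. jump g s \<noteq> 0}. jump g s)"
      unfolding eq by (simp add: sum_distrib_left)
    also have "\<dots> = a k * of_int (g (grid T n (Suc k)) - g (grid T n k))"
      using T by (subst sum_jumps(2)[OF g]) (auto intro!: grid_nonneg grid_mono)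
    finally show "(\<Sum>s\<in>{s\<in>?J. cell T n s = k}. a (cell T n s) * of_int (jump g s))
      = a k * of_int (g (grid T n (Suc k)) - g (grid T n k))" .
  qed
  finally show ?thesis ..
qed

lemma grid_sum_tendsto:
  fixes a :: "nat \<Rightarrow> nat \<Rightarrow> 'a::real_normed_algebra_1"
  assumes g: "step_path g" and T: "0 < T"
    and lim: "\<And>s. 0 < s \<Longrightarrow> s \<le> T \<Longrightarrow> (\<lambda>n. a n (cell T n s)) \<longlonglongrightarrow> H s"
  shows "(\<lambda>n. \<Sum>k<2^n. a n k * of_int (g (grid T n (Suc k)) - g (grid T n k))) \<longlonglongrightarrow> stieltjes_int g H T"
  unfolding grid_sum_eq[OF g T] stieltjes_int_def
  by (intro tendsto_intros lim) auto

text \<open>The Riemann sum is the integral of the step function \<open>S n\<close>, which converges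
  pointwise because left end points approach s strictly from the left. K is the integrand along the
  path and H its left limit; measurability of the latter comes out of the convergence.\<close>

lemma grid_sum_tendsto_lebesgue:
  fixes K :: "real \<Rightarrow> real"
  assumes T: "0 < T" and bound: "\<And>s. 0 \<le> s \<Longrightarrow> s \<le> T \<Longrightarrow> \<bar>K s\<bar> \<le> C"
    and lim: "\<And>s. 0 < s \<Longrightarrow> s \<le> T \<Longrightarrow> (K \<longlongrightarrow> H s) (at_left s)"
  shows "(\<lambda>n. \<Sum>k<2^n. K (grid T n k) * (T / 2 ^ n)) \<longlonglongrightarrow> (LBINT s:{0..T}. H s)"
proof -
  define S where "S n s = (\<Sum>k<2^n. K (grid T n k) * indicator {grid T n k<..grid T n (Suc k)} s)" for n s
  have S_in: "S n s = K (grid T n (cell T n s))" if "0 < s" "s \<le> T" for n s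
  proof -
    have "S n s = (\<Sum>k<2^n. if cell T n s = k then K (grid T n k) else 0)"
      unfolding S_def using cell_iff[OF T that(1)] by (intro sum.cong) (auto simp: indicator_def)
    then show ?thesis using cell_less[OF T that] by simp
  qed
  have S_out: "S n s = 0" if "\<not> (0 < s \<and> s \<le> T)" for n s
  proof -
    have "s \<notin> {grid T n k<..grid T n (Suc k)}" if "k < 2^n" for k
      using grid_nonneg[of T n k] grid_le[of T "Suc k" n] that T \<open>\<not> (0 < s \<and> s \<le> T)\<close> by auto
    then show ?thesis by (auto simp: S_def indicator_def intro!: sum.neutral)
  qed
  have intS: "(\<integral>s. S n s \<partial>lborel) = (\<Sum>k<2^n. K (grid T n k) * (T / 2 ^ n))" for n
  proof -
    have "(\<integral>s. S n s \<partial>lborel)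
       = (\<Sum>k<2^n. \<integral>s. K (grid T n k) * indicator {grid T n k<..grid T n (Suc k)} s \<partial>lborel)"
      unfolding S_def using T
      by (intro Bochner_Integration.integral_sum integrable_mult_right integrable_real_indicator)
         (auto simp: grid_mono)
    also have "\<dots> = (\<Sum>k<2^n. K (grid T n k) * (T / 2 ^ n))"
      using T by (intro sum.cong refl) (simp add: grid_Suc)
    finally show ?thesis .
  qed
  define H' where "H' s = (if 0 < s \<and> s \<le> T then H s else 0)" for s
  have SH: "(\<lambda>n. S n s) \<longlonglongrightarrow> H' s" for s
  proof (cases "0 < s \<and> s \<le> T")
    case True
    then show ?thesis
      using filterlim_compose[OF lim grid_cell_tendsto(1)[OF T, of s]]
      by (simp add: S_in H'_def)
  qed (auto simp: S_out H'_def)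
  have [measurable]: "S n \<in> borel_measurable lborel" for n
    unfolding S_def by measurable
  have [measurable]: "H' \<in> borel_measurable lborel"
    by (rule borel_measurable_LIMSEQ_real[OF SH]) measurable
  have "(\<lambda>n. \<integral>s. S n s \<partial>lborel) \<longlonglongrightarrow> (\<integral>s. H' s \<partial>lborel)"
  proof (rule integral_dominated_convergence[where w = "\<lambda>s. C * indicator {0..T} s"])
    show "integrable lborel (\<lambda>s. C * indicator {0..T} s)"
      using T by (intro integrable_mult_right integrable_real_indicator) auto
    show "AE s in lborel. norm (S n s) \<le> C * indicator {0..T} s" for n
    proof (intro AE_I2)
      fix s
      show "norm (S n s) \<le> C * indicator {0..T} s"
      proof (cases "0 < s \<and> s \<le> T")
        case True
        then show ?thesis
          using grid_cell[OF T, of s n] bound[of "grid T n (cell T n s)"] by (simp add: S_in)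
      next
        case False
        have "0 \<le> C" using bound[of 0] T by auto
        then show ?thesis using False by (simp add: S_out)
      qed
    qed
  qed (auto simp: SH)
  also have "(\<integral>s. H' s \<partial>lborel) = (LBINT s:{0..T}. H s)"
  proof -
    \<comment> \<open>The cells are open on the left and miss time 0, where H may take any value; a
      single point is a null set.\<close>
    have eq: "indicator {0..T} s *\<^sub>R H s = H' s + indicator {0} s * H 0" for s
      using T by (auto simp: H'_def indicator_def)
    have "AE s in lborel. s \<noteq> (0::real)" by (rule AE_lborel_singleton)
    then have "AE s in lborel. H' s = H' s + indicator {0} s * H 0"
      by eventually_elim auto
    then show ?thesis
      unfolding set_lebesgue_integral_def eq by (intro integral_cong_AE) auto
  qed
  finally show ?thesis by (simp only: intS)
qed


section \<open>The walk along a fixed path of the noise\<close>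

lemma jump_total_less:
  fixes p :: "'n::finite \<Rightarrow> real \<Rightarrow> nat"
  assumes p: "\<And>i. counting_path (p i)" and s: "0 \<le> a" "a < s"
    and jump: "jump (\<lambda>s. int (p i s)) s \<noteq> 0"
  shows "(\<Sum>j\<in>UNIV. p j a) < (\<Sum>j\<in>UNIV. p j s)"
proof -
  have "0 < s" using s by simp
  have "\<forall>\<^sub>F u in at_left s. int (p i u) = int (p i s) - jump (\<lambda>s. int (p i s)) s \<and> a < u \<and> u < s"
    using step_path_left[OF step_path_counting[OF p[of i]] \<open>0 < s\<close>] eventually_at_left_real[OF s(2)]
    by eventually_elim auto
  then obtain u where u: "int (p i u) = int (p i s) - jump (\<lambda>s. int (p i s)) s" "a < u" "u < s"
    using eventually_happens' trivial_limit_at_left_real by blast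
  have "p i a \<le> p i u" using counting_path_mono[OF p] u s by simp
  moreover have "p i u < p i s"
    using u jump jump_counting_nonneg[OF p[of i] \<open>0 < s\<close>] by linarith
  ultimately have "p i a < p i s" by simp
  then show ?thesis
    using counting_path_mono[OF p] s by (intro sum_strict_mono_ex1 ballI bexI[of _ i]) auto
qed

context
  fixes \<N> :: "'n::finite \<Rightarrow> real \<Rightarrow> 'w \<Rightarrow> nat" and \<tau> :: "nat \<Rightarrow> 'w \<Rightarrow> int" and \<omega> :: 'w
  assumes counting: "\<And>i. counting_path (\<lambda>t. \<N> i t \<omega>)"
begin

abbreviation (input) "tot t \<equiv> \<Sum>j\<in>UNIV. \<N> j t \<omega>"

lemma walk_nth: "walk \<N> \<tau> x0 t \<omega> $ i
    = x0 $ i + stieltjes_int (\<lambda>s. int (\<N> i s \<omega>)) (\<lambda>s. \<tau> (tot s) \<omega>) t"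
  by (simp add: walk_def)

lemma step_path_noise: "step_path (\<lambda>s. int (\<N> i s \<omega>))"
  by (rule step_path_counting[OF counting])

lemma step_path_walk: "step_path (\<lambda>t. walk \<N> \<tau> x0 t \<omega> $ i)"
  unfolding walk_nth by (rule stieltjes_int_path(1)[OF step_path_noise])

lemma jump_walk:
  "0 < s \<Longrightarrow> jump (\<lambda>t. walk \<N> \<tau> x0 t \<omega> $ i) s = \<tau> (tot s) \<omega> * jump (\<lambda>s. int (\<N> i s \<omega>)) s"
  unfolding walk_nth by (rule stieltjes_int_path(2)[OF step_path_noise])

lemma walk_translate: "walk \<N> \<tau> x0 t \<omega> = x0 + walk \<N> \<tau> 0 t \<omega>"
  by (simp add: vec_eq_iff walk_nth)

lemma walk_0: "walk \<N> \<tau> x0 0 \<omega> = x0"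
  by (simp add: vec_eq_iff walk_nth stieltjes_int_def)

lemma eventually_walk_left:
  assumes "0 < s" shows "\<forall>\<^sub>F u in at_left s. walk \<N> \<tau> x0 u \<omega> = walk_left \<N> \<tau> x0 s \<omega>"
proof -
  have "\<forall>\<^sub>F u in at_left s. \<forall>i. walk \<N> \<tau> x0 u \<omega> $ i = walk_left \<N> \<tau> x0 s \<omega> $ i"
  proof (rule eventually_all_finite)
    fix i
    obtain c where c: "\<forall>\<^sub>F u in at_left s. walk \<N> \<tau> x0 u \<omega> $ i = c"
      using step_path_walk assms unfolding step_path_def by blast
    have "walk_left \<N> \<tau> x0 s \<omega> $ i = c"
      unfolding walk_left_def using tendsto_Lim[OF trivial_limit_at_left_real tendsto_eventually[OF c]] by simp
    with c show "\<forall>\<^sub>F u in at_left s. walk \<N> \<tau> x0 u \<omega> $ i = walk_left \<N> \<tau> x0 s \<omega> $ i" by simp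
  qed
  then show ?thesis by (simp add: vec_eq_iff)
qed

lemma walk_increment:
  assumes "0 \<le> a" "a \<le> b"
  shows "walk \<N> \<tau> x0 b \<omega> $ i - walk \<N> \<tau> x0 a \<omega> $ i
    = (\<Sum>s\<in>{s\<in>{a<..b}. jump (\<lambda>s. int (\<N> i s \<omega>)) s \<noteq> 0}. \<tau> (tot s) \<omega> * jump (\<lambda>s. int (\<N> i s \<omega>)) s)"
proof -
  have "walk \<N> \<tau> x0 b \<omega> $ i - walk \<N> \<tau> x0 a \<omega> $ i
    = (\<Sum>s\<in>{s\<in>{a<..b}. jump (\<lambda>t. walk \<N> \<tau> x0 t \<omega> $ i) s \<noteq> 0}. jump (\<lambda>t. walk \<N> \<tau> x0 t \<omega> $ i) s)"
    using sum_jumps(2)[OF step_path_walk assms] by simp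
  also have "\<dots> = (\<Sum>s\<in>{s\<in>{a<..b}. jump (\<lambda>s. int (\<N> i s \<omega>)) s \<noteq> 0}. \<tau> (tot s) \<omega> * jump (\<lambda>s. int (\<N> i s \<omega>)) s)"
    using assms sum_jumps(1)[OF step_path_noise assms]
    by (intro sum.mono_neutral_cong_left) (auto simp: jump_walk)
  finally show ?thesis .
qed

text \<open>If the total count grows by at most one over (a, b], then at the time of a jump it
  already has its value at b. The sign of that jump can therefore be read off at the end of the
  interval, without knowing the jump time.\<close>

lemma walk_increment_single:
  assumes "0 \<le> a" "a \<le> b" and single: "tot b \<le> tot a + 1"
  shows "walk \<N> \<tau> x0 b \<omega> $ i - walk \<N> \<tau> x0 a \<omega> $ i
    = \<tau> (tot b) \<omega> * (int (\<N> i b \<omega>) - int (\<N> i a \<omega>))"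
proof -
  have "tot s = tot b" if s: "s \<in> {a<..b}" "jump (\<lambda>s. int (\<N> i s \<omega>)) s \<noteq> 0" for s
  proof -
    have "tot a < tot s" using jump_total_less[of "\<lambda>j t. \<N> j t \<omega>" a s i, OF counting] s assms by simp
    moreover have "tot s \<le> tot b"
      using counting_path_mono[OF counting] s assms by (intro sum_mono) auto
    ultimately show ?thesis using single by linarith
  qed
  then have "walk \<N> \<tau> x0 b \<omega> $ i - walk \<N> \<tau> x0 a \<omega> $ i
    = (\<Sum>s\<in>{s\<in>{a<..b}. jump (\<lambda>s. int (\<N> i s \<omega>)) s \<noteq> 0}. \<tau> (tot b) \<omega> * jump (\<lambda>s. int (\<N> i s \<omega>)) s)"
    unfolding walk_increment[OF assms(1,2)] by (intro sum.cong) auto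
  also have "\<dots> = \<tau> (tot b) \<omega> * (int (\<N> i b \<omega>) - int (\<N> i a \<omega>))"
    unfolding sum_distrib_left[symmetric] sum_jumps(2)[OF step_path_noise assms(1,2)] by simp
  finally show ?thesis .
qed

lemma walk_increment_bound:
  assumes "0 \<le> a" "a \<le> b" and sign: "\<And>k. 1 \<le> k \<Longrightarrow> \<bar>\<tau> k \<omega>\<bar> \<le> 1"
  shows "\<bar>walk \<N> \<tau> x0 b \<omega> $ i - walk \<N> \<tau> x0 a \<omega> $ i\<bar> \<le> int (\<N> i b \<omega>) - int (\<N> i a \<omega>)"
proof -
  have "\<bar>walk \<N> \<tau> x0 b \<omega> $ i - walk \<N> \<tau> x0 a \<omega> $ i\<bar>
     \<le> (\<Sum>s\<in>{s\<in>{a<..b}. jump (\<lambda>s. int (\<N> i s \<omega>)) s \<noteq> 0}. jump (\<lambda>s. int (\<N> i s \<omega>)) s)"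
    unfolding walk_increment[OF assms(1,2)]
  proof (rule order_trans[OF sum_abs], rule sum_mono)
    fix s assume s: "s \<in> {s\<in>{a<..b}. jump (\<lambda>s. int (\<N> i s \<omega>)) s \<noteq> 0}"
    have "0 < s" using s assms by auto
    \<comment> \<open>A jump at s makes the total count at s positive, so the index 0 of
      \<open>\<tau>\<close> never enters.\<close>
    have "1 \<le> tot s" using jump_total_less[of "\<lambda>j t. \<N> j t \<omega>" a s i, OF counting] s assms by auto
    then have "\<bar>\<tau> (tot s) \<omega>\<bar> * jump (\<lambda>s. int (\<N> i s \<omega>)) s \<le> 1 * jump (\<lambda>s. int (\<N> i s \<omega>)) s"
      using jump_counting_nonneg[OF counting[of i] \<open>0 < s\<close>] by (intro mult_right_mono sign) auto
    then show "\<bar>\<tau> (tot s) \<omega> * jump (\<lambda>s. int (\<N> i s \<omega>)) s\<bar> \<le> jump (\<lambda>s. int (\<N> i s \<omega>)) s"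
      using jump_counting_nonneg[OF counting[of i] \<open>0 < s\<close>] by (simp add: abs_mult)
  qed
  also have "\<dots> = int (\<N> i b \<omega>) - int (\<N> i a \<omega>)"
    by (rule sum_jumps(2)[OF step_path_noise assms(1,2)])
  finally show ?thesis .
qed

text \<open>This presents the walk as a limit of functions of the noise at finitely many times and
  of the signs, from which its measurability follows. By right-continuity the total count at the
  right end of the cell of s eventually equals the count at s.\<close>

lemma walk_approx:
  assumes T: "0 < T"
  shows "(\<lambda>n. \<Sum>k<2^n. real_of_int (\<tau> (tot (grid T n (Suc k))) \<omega>)
            * real_of_int (int (\<N> i (grid T n (Suc k)) \<omega>) - int (\<N> i (grid T n k) \<omega>)))
     \<longlonglongrightarrow> real_of_int (walk \<N> \<tau> 0 T \<omega> $ i)"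
proof -
  have "(\<lambda>n. real_of_int (\<tau> (tot (grid T n (Suc (cell T n s)))) \<omega>)) \<longlonglongrightarrow> real_of_int (\<tau> (tot s) \<omega>)"
    if s: "0 < s" "s \<le> T" for s
  proof (rule tendsto_eventually)
    have "\<forall>\<^sub>F u in at_right s. \<forall>i. \<N> i u \<omega> = \<N> i s \<omega>"
      using s by (intro eventually_all_finite counting_path_right counting) auto
    then obtain r where r: "r > s" "\<And>u i. s < u \<Longrightarrow> u < r \<Longrightarrow> \<N> i u \<omega> = \<N> i s \<omega>"
      unfolding eventually_at_right_field by auto
    have "\<forall>\<^sub>F n in sequentially. grid T n (Suc (cell T n s)) < r"
      using grid_cell_tendsto(2)[OF T s(1)] r(1) by (rule order_tendstoD)
    then show "\<forall>\<^sub>F n in sequentially. real_of_int (\<tau> (tot (grid T n (Suc (cell T n s)))) \<omega>) = real_of_int (\<tau> (tot s) \<omega>)"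
    proof eventually_elim
      case (elim n)
      have "\<N> i (grid T n (Suc (cell T n s))) \<omega> = \<N> i s \<omega>" for i
        using r(2)[of "grid T n (Suc (cell T n s))" i] elim grid_cell(2)[OF T s(1), of n]
        by (cases "grid T n (Suc (cell T n s)) = s") auto
      then show ?case by simp
    qed
  qed
  from grid_sum_tendsto[OF step_path_noise T, where a = "\<lambda>n k. real_of_int (\<tau> (tot (grid T n (Suc k))) \<omega>)", OF this]
  show ?thesis by (simp add: walk_nth stieltjes_int_def)
qed

text \<open>The left end points of the cells containing a jump time approach it strictly from the left, so
  that the Riemann sums pick up the left limit of the walk.\<close>

lemma mtransform_approx:
  fixes A :: "real ^ 'n ^ 'n" and x0 :: "int ^ 'n" and f :: "int ^ 'n \<Rightarrow> real" and T :: real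
  assumes f: "in_l2 f" and T: "0 < T"
  defines "K2 \<equiv> \<lambda>i t. (A *v grad_two (heat (T - t) f) (walk \<N> \<tau> x0 t \<omega>)) $ i"
    and "K0 \<equiv> \<lambda>i t. (A *v grad_zero (heat (T - t) f) (walk \<N> \<tau> x0 t \<omega>)) $ i"
  shows "(\<lambda>n. 1/2 * (\<Sum>i\<in>UNIV. \<Sum>k<2^n.
      K2 i (grid T n k) * (real (\<N> i (grid T n (Suc k)) \<omega>) - real (\<N> i (grid T n k) \<omega>) - 2 * (T / 2 ^ n))
      + K0 i (grid T n k) * (real_of_int (walk \<N> \<tau> x0 (grid T n (Suc k)) \<omega> $ i) - real_of_int (walk \<N> \<tau> x0 (grid T n k) \<omega> $ i))))
    \<longlonglongrightarrow> mtransform \<N> \<tau> A f T x0 T \<omega>"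
proof -
  define H2 where "H2 i s = (A *v grad_two (heat (T - s) f) (walk_left \<N> \<tau> x0 s \<omega>)) $ i" for i s
  define H0 where "H0 i s = (A *v grad_zero (heat (T - s) f) (walk_left \<N> \<tau> x0 s \<omega>)) $ i" for i s
  define C where "C = 4 * (\<integral>\<xi>. cmod (fourier (\<lambda>y. complex_of_real (f y)) \<xi>) \<partial>torus)"
  have cont: "((\<lambda>t. diff_two j (heat (T - t) f) y) \<longlongrightarrow> diff_two j (heat (T - s) f) y) (at_left s)"
     "((\<lambda>t. diff_zero j (heat (T - t) f) y) \<longlongrightarrow> diff_zero j (heat (T - s) f) y) (at_left s)" for j y s
  proof -
    have lim: "((\<lambda>t. T - t) \<longlongrightarrow> T - s) (at_left s)" by (intro tendsto_intros)
    show "((\<lambda>t. diff_two j (heat (T - t) f) y) \<longlongrightarrow> diff_two j (heat (T - s) f) y) (at_left s)"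
      "((\<lambda>t. diff_zero j (heat (T - t) f) y) \<longlongrightarrow> diff_zero j (heat (T - s) f) y) (at_left s)"
      using isCont_diff_heat[OF f, where i = j and y = y and t = "T - s"]
      by (auto intro: isCont_tendsto_compose[OF _ lim])
  qed
  have lim2: "(K2 i \<longlongrightarrow> H2 i s) (at_left s)" and lim0: "(K0 i \<longlongrightarrow> H0 i s) (at_left s)" if "0 < s" for i s
  proof -
    have "((\<lambda>t. (A *v grad_two (heat (T - t) f) (walk_left \<N> \<tau> x0 s \<omega>)) $ i) \<longlongrightarrow> H2 i s) (at_left s)"
      unfolding H2_def matrix_vector_mult_def grad_two_def vec_lambda_beta by (intro tendsto_intros cont)
    then show "(K2 i \<longlongrightarrow> H2 i s) (at_left s)"
      using eventually_walk_left[OF that, of x0]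
      by (elim Lim_transform_eventually) (auto simp: K2_def elim: eventually_mono)
    have "((\<lambda>t. (A *v grad_zero (heat (T - t) f) (walk_left \<N> \<tau> x0 s \<omega>)) $ i) \<longlongrightarrow> H0 i s) (at_left s)"
      unfolding H0_def matrix_vector_mult_def grad_zero_def vec_lambda_beta by (intro tendsto_intros cont)
    then show "(K0 i \<longlongrightarrow> H0 i s) (at_left s)"
      using eventually_walk_left[OF that, of x0]
      by (elim Lim_transform_eventually) (auto simp: K0_def elim: eventually_mono)
  qed
  have bound: "\<bar>K2 i s\<bar> \<le> (\<Sum>j\<in>UNIV. \<bar>A $ i $ j\<bar> * C)" if "0 \<le> s" "s \<le> T" for i s
    unfolding K2_def matrix_vector_mult_def grad_two_def vec_lambda_beta
    using diff_heat_eq_integral(3)[OF f, of "T - s"] that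
    by (intro order_trans[OF sum_abs] sum_mono) (auto simp: abs_mult C_def intro!: mult_left_mono)
  note lims = filterlim_compose[OF lim2 grid_cell_tendsto(1)[OF T]] filterlim_compose[OF lim0 grid_cell_tendsto(1)[OF T]]
  have N: "(\<lambda>n. \<Sum>k<2^n. K2 i (grid T n k) * real_of_int (int (\<N> i (grid T n (Suc k)) \<omega>) - int (\<N> i (grid T n k) \<omega>)))
      \<longlonglongrightarrow> stieltjes_int (\<lambda>s. int (\<N> i s \<omega>)) (H2 i) T" for i
    by (rule grid_sum_tendsto[OF step_path_noise T]) (use lims in auto)
  have X: "(\<lambda>n. \<Sum>k<2^n. K0 i (grid T n k) * real_of_int (walk \<N> \<tau> x0 (grid T n (Suc k)) \<omega> $ i - walk \<N> \<tau> x0 (grid T n k) \<omega> $ i))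
      \<longlonglongrightarrow> stieltjes_int (\<lambda>s. walk \<N> \<tau> x0 s \<omega> $ i) (H0 i) T" for i
    by (rule grid_sum_tendsto[OF step_path_walk T]) (use lims in auto)
  have L: "(\<lambda>n. \<Sum>k<2^n. K2 i (grid T n k) * (T / 2 ^ n)) \<longlonglongrightarrow> (LBINT s:{0..T}. H2 i s)" for i
    by (rule grid_sum_tendsto_lebesgue[OF T bound lim2]) auto
  have "(\<lambda>n. 1/2 * (\<Sum>i\<in>UNIV.
      (\<Sum>k<2^n. K2 i (grid T n k) * real_of_int (int (\<N> i (grid T n (Suc k)) \<omega>) - int (\<N> i (grid T n k) \<omega>)))
      - 2 * (\<Sum>k<2^n. K2 i (grid T n k) * (T / 2 ^ n))
      + (\<Sum>k<2^n. K0 i (grid T n k) * real_of_int (walk \<N> \<tau> x0 (grid T n (Suc k)) \<omega> $ i - walk \<N> \<tau> x0 (grid T n k) \<omega> $ i))))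
    \<longlonglongrightarrow> mtransform \<N> \<tau> A f T x0 T \<omega>"
    unfolding mtransform_def Let_def H2_def[symmetric] H0_def[symmetric]
    by (intro tendsto_intros N X L)
  then show ?thesis
    by (simp add: sum_distrib_left sum.distrib[symmetric] sum_subtractf[symmetric] algebra_simps)
qed

end

section \<open>Poisson increments\<close>

lemma poisson_expectation:
  fixes f :: "nat \<Rightarrow> real"
  assumes r: "0 < r" and sums: "(\<lambda>k. r ^ k / fact k * f k) sums s"
    and summable: "summable (\<lambda>k. r ^ k / fact k * \<bar>f k\<bar>)"
  shows "has_bochner_integral (measure_pmf (poisson_pmf r)) f (exp (- r) * s)"
proof -
  have eq: "pmf (poisson_pmf r) k *\<^sub>R f k = exp (- r) * (r ^ k / fact k * f k)" for k
    using r by simp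
  have "summable (\<lambda>k. norm (pmf (poisson_pmf r) k *\<^sub>R f k))"
    unfolding eq using summable_mult[OF summable, of "exp (- r)"] r by (simp add: abs_mult)
  then have i: "integrable (count_space UNIV) (\<lambda>k. pmf (poisson_pmf r) k *\<^sub>R f k)"
    by (simp add: integrable_count_space_nat_iff)
  have "(\<lambda>k. pmf (poisson_pmf r) k *\<^sub>R f k) sums (exp (- r) * s)"
    unfolding eq by (intro sums_mult sums)
  with i have "(\<integral>k. pmf (poisson_pmf r) k *\<^sub>R f k \<partial>count_space UNIV) = exp (- r) * s"
    by (simp add: integral_count_space_nat sums_iff)
  with i show ?thesis
    by (simp add: has_bochner_integral_iff measure_pmf_eq_density integrable_density integral_density)
qed

text \<open>The generating function of the Poisson law. It is used at the cosines of the
  frequencies, and at 0 for the probability of no jump.\<close>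

lemma poisson_power:
  assumes "0 < r"
  shows "has_bochner_integral (measure_pmf (poisson_pmf r)) (\<lambda>k. c ^ k) (exp (r * (c - 1)))"
proof -
  have *: "(\<lambda>k. r ^ k / fact k * c ^ k) sums exp (r * c)" for c
    using exp_converges[of "r * c"] by (simp add: power_mult_distrib field_simps)
  have "has_bochner_integral (measure_pmf (poisson_pmf r)) (\<lambda>k. c ^ k) (exp (- r) * exp (r * c))"
    using assms * *[of "\<bar>c\<bar>"] by (intro poisson_expectation) (auto simp: power_abs sums_iff)
  then show ?thesis by (simp add: mult_exp_exp algebra_simps)
qed

lemma poisson_mean:
  assumes "0 < r"
  shows "has_bochner_integral (measure_pmf (poisson_pmf r)) real r"
proof -
  have "(\<lambda>k. r * (r ^ k / fact k)) sums (r * exp r)"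
    using exp_converges[of r] by (intro sums_mult) (simp add: divide_inverse mult.commute)
  also have "(\<lambda>k. r * (r ^ k / fact k)) = (\<lambda>k. r ^ Suc k / fact (Suc k) * real (Suc k))"
    by (auto simp: fun_eq_iff simp del: of_nat_Suc)
  finally have *: "(\<lambda>k. r ^ k / fact k * real k) sums (r * exp r)"
    by (subst (asm) sums_Suc_iff) simp
  have "has_bochner_integral (measure_pmf (poisson_pmf r)) real (exp (- r) * (r * exp r))"
    using assms * by (intro poisson_expectation) (auto simp: sums_iff)
  moreover have "exp (- r) * (r * exp r) = r" by (simp add: exp_minus)
  ultimately show ?thesis by (simp only:)
qed

context walk_noise
begin

abbreviation "W \<equiv> walk \<N> \<tau> 0"

abbreviation "total_noise t \<omega> \<equiv> \<Sum>j\<in>UNIV. \<N> j t \<omega>"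

abbreviation "increment T n i k \<omega> \<equiv> \<N> i (grid T n (Suc k)) \<omega> - \<N> i (grid T n k) \<omega>"

lemma counting: "\<omega> \<in> space \<Omega> \<Longrightarrow> counting_path (\<lambda>t. \<N> i t \<omega>)"
  using poisson[of i] unfolding poisson_process_def counting_path_def by blast

lemma noise_mono: "\<omega> \<in> space \<Omega> \<Longrightarrow> 0 \<le> s \<Longrightarrow> s \<le> t \<Longrightarrow> \<N> i s \<omega> \<le> \<N> i t \<omega>"
  using counting_path_mono[OF counting] .

lemma noise_0: "\<omega> \<in> space \<Omega> \<Longrightarrow> \<N> i 0 \<omega> = 0"
  using counting unfolding counting_path_def by blast

lemma noise_measurable: "0 \<le> t \<Longrightarrow> \<N> i t \<in> measurable \<Omega> (count_space UNIV)"
  using poisson[of i] unfolding poisson_process_def by blast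

lemma total_measurable:
  assumes "0 \<le> t" shows "(\<lambda>\<omega>. total_noise t \<omega>) \<in> measurable \<Omega> (count_space UNIV)"
  by (intro measurable_sum_nat noise_measurable assms)

lemma total_le_measurable:
  assumes "0 \<le> s" "0 \<le> t"
  shows "Measurable.pred \<Omega> (\<lambda>\<omega>. total_noise t \<omega> \<le> total_noise s \<omega> + 1)"
proof -
  have "Measurable.pred \<Omega> (\<lambda>\<omega>. a \<omega> \<le> b \<omega> + 1)"
    if [measurable]: "a \<in> measurable \<Omega> (count_space UNIV)" "b \<in> measurable \<Omega> (count_space UNIV)"
    for a b :: "'w \<Rightarrow> nat"
    by (rule measurable_compose_countable[OF _ that(1)], rule measurable_compose[OF that(2)]) simp
  from this[OF total_measurable total_measurable, OF assms(2,1)] show ?thesis .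
qed

lemma has_expectation_increment:
  fixes f :: "nat \<Rightarrow> real"
  assumes "0 \<le> s" "s < t" "has_bochner_integral (measure_pmf (poisson_pmf (2 * (t - s)))) f e"
  shows "has_bochner_integral \<Omega> (\<lambda>\<omega>. f (\<N> i t \<omega> - \<N> i s \<omega>)) e"
proof -
  have [measurable]: "(\<lambda>\<omega>. \<N> i t \<omega> - \<N> i s \<omega>) \<in> measurable \<Omega> (count_space UNIV)"
  proof -
    have [measurable]: "\<N> i t \<in> measurable \<Omega> (count_space UNIV)" "\<N> i s \<in> measurable \<Omega> (count_space UNIV)"
      using assms by (auto intro: noise_measurable)
    show ?thesis by measurable
  qed
  have "distr \<Omega> (count_space UNIV) (\<lambda>\<omega>. \<N> i t \<omega> - \<N> i s \<omega>) = measure_pmf (poisson_pmf (2 * (t - s)))"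
    using poisson[of i] assms unfolding poisson_process_def by blast
  note d = this
  have "has_bochner_integral (distr \<Omega> (count_space UNIV) (\<lambda>\<omega>. \<N> i t \<omega> - \<N> i s \<omega>)) f e"
    unfolding d by (rule assms(3))
  then show ?thesis
    unfolding has_bochner_integral_iff by (auto simp: integral_distr dest: integrable_distr[rotated])
qed

lemma increment_power:
  assumes "0 \<le> s" "s \<le> t"
  shows "has_bochner_integral \<Omega> (\<lambda>\<omega>. c ^ (\<N> i t \<omega> - \<N> i s \<omega>)) (exp (2 * (t - s) * (c - 1)))"
proof (cases "s = t")
  case True
  then show ?thesis using integrable_const[of "1 :: real"] by (simp add: has_bochner_integral_iff prob_space)
next
  case False
  with assms show ?thesis by (intro has_expectation_increment poisson_power) auto
qed

lemma increment_mean: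
  assumes "0 \<le> s" "s \<le> t"
  shows "has_bochner_integral \<Omega> (\<lambda>\<omega>. real (\<N> i t \<omega> - \<N> i s \<omega>)) (2 * (t - s))"
proof (cases "s = t")
  case False
  with assms show ?thesis by (intro has_expectation_increment poisson_mean) auto
qed (simp add: has_bochner_integral_zero)

lemma increment_mean_power:
  assumes "0 \<le> a" "a \<le> b" "b \<le> d"
  shows "has_bochner_integral \<Omega> (\<lambda>\<omega>. real (\<N> i b \<omega> - \<N> i a \<omega>) * c ^ (\<N> i d \<omega> - \<N> i b \<omega>))
    (2 * (b - a) * exp (2 * (d - b) * (c - 1)))"
proof -
  \<comment> \<open>\<open>poisson_process\<close> gives independence of increments along a monotone
    sequence of times. In the sequence a, b, d, d, ... the two increments in question have the
    indices 0 and 1.\<close>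
  define t where "t k = (if k = 0 then a else if k = 1 then b else d)" for k :: nat
  have "mono t" using assms by (auto simp: t_def mono_def)
  moreover have "0 \<le> t 0" using assms by (simp add: t_def)
  ultimately have "indep_vars (\<lambda>_. count_space UNIV) (\<lambda>k \<omega>. \<N> i (t (Suc k)) \<omega> - \<N> i (t k) \<omega>) UNIV"
    using poisson[of i] unfolding poisson_process_def by blast
  then have "indep_vars (\<lambda>_. count_space UNIV) (\<lambda>k \<omega>. \<N> i (t (Suc k)) \<omega> - \<N> i (t k) \<omega>) {0, 1}"
    by (rule indep_vars_subset) simp
  then have ind: "indep_vars (\<lambda>_. borel)
      (\<lambda>k \<omega>. (if k = 0 then real else (\<lambda>m. c ^ m)) (\<N> i (t (Suc k)) \<omega> - \<N> i (t k) \<omega>)) {0, 1}"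
    by (rule indep_vars_compose2) auto
  have int: "integrable \<Omega> (\<lambda>\<omega>. (if k = 0 then real else (\<lambda>m. c ^ m)) (\<N> i (t (Suc k)) \<omega> - \<N> i (t k) \<omega>))"
    if "k \<in> {0, 1}" for k
    using that increment_mean[of a b i] increment_power[of b d c i] assms
    by (auto simp: t_def has_bochner_integral_iff)
  from indep_vars_lebesgue_integral[OF _ ind int] indep_vars_integrable[OF _ ind int]
  show ?thesis
    using increment_mean[of a b i] increment_power[of b d c i] assms
    by (simp add: t_def has_bochner_integral_iff)
qed

lemma component_measurable:
  "0 \<le> t \<Longrightarrow> (\<lambda>y. y t) \<in> measurable (Pi\<^sub>M {0::real..} (\<lambda>_. count_space UNIV)) (count_space (UNIV :: nat set))"
  by (rule measurable_component_singleton) simp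

lemma noise_prod:
  fixes g :: "'n \<Rightarrow> (real \<Rightarrow> nat) \<Rightarrow> real"
  assumes g: "\<And>i. g i \<in> borel_measurable (Pi\<^sub>M {0..} (\<lambda>_. count_space UNIV))"
    and e: "\<And>i. has_bochner_integral \<Omega> (\<lambda>\<omega>. g i (\<lambda>t\<in>{0..}. \<N> i t \<omega>)) (e i)"
  shows "has_bochner_integral \<Omega> (\<lambda>\<omega>. \<Prod>i\<in>UNIV. g i (\<lambda>t\<in>{0..}. \<N> i t \<omega>)) (\<Prod>i\<in>UNIV. e i)"
proof -
  have ind: "indep_vars (\<lambda>_. borel) (\<lambda>i \<omega>. g i (\<lambda>t\<in>{0..}. \<N> i t \<omega>)) UNIV"
    by (rule indep_vars_compose2[OF indep_poisson g])
  show ?thesis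
    using indep_vars_lebesgue_integral[OF _ ind] indep_vars_integrable[OF _ ind] e
    by (simp add: has_bochner_integral_iff)
qed

lemma increments_power:
  fixes c :: "'n \<Rightarrow> real"
  assumes "0 \<le> s" "s \<le> t"
  shows "has_bochner_integral \<Omega> (\<lambda>\<omega>. \<Prod>j\<in>UNIV. c j ^ (\<N> j t \<omega> - \<N> j s \<omega>))
    (exp (\<Sum>j\<in>UNIV. 2 * (t - s) * (c j - 1)))"
proof -
  have "(\<lambda>y. c j ^ (y t - y s)) \<in> borel_measurable (Pi\<^sub>M {0..} (\<lambda>_. count_space (UNIV :: nat set)))" for j
  proof -
    note [measurable] = component_measurable[of s] component_measurable[of t]
    have [measurable]: "0 \<le> s" "0 \<le> t" using assms by auto
    show ?thesis by measurable
  qed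
  from noise_prod[OF this, where e = "\<lambda>j. exp (2 * (t - s) * (c j - 1))"]
  show ?thesis using increment_power[OF assms] assms by (simp add: exp_sum)
qed

lemma increments_mean_power:
  fixes c :: "'n \<Rightarrow> real"
  assumes "0 \<le> a" "a \<le> b" "b \<le> d"
  shows "has_bochner_integral \<Omega> (\<lambda>\<omega>. real (\<N> i b \<omega> - \<N> i a \<omega>) * (\<Prod>j\<in>UNIV. c j ^ (\<N> j d \<omega> - \<N> j b \<omega>)))
    (2 * (b - a) * exp (\<Sum>j\<in>UNIV. 2 * (d - b) * (c j - 1)))"
proof -
  define g where "g j y = (if j = i then real (y b - y a) else 1) * c j ^ (y d - y b)" for j and y :: "real \<Rightarrow> nat"
  define e where "e j = (if j = i then 2 * (b - a) else 1) * exp (2 * (d - b) * (c j - 1))" for j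
  have g: "g j \<in> borel_measurable (Pi\<^sub>M {0..} (\<lambda>_. count_space UNIV))" for j
  proof -
    note [measurable] = component_measurable[of a] component_measurable[of b] component_measurable[of d]
    have [measurable]: "0 \<le> b" "0 \<le> a" "0 \<le> d" using assms by auto
    show ?thesis unfolding g_def by measurable
  qed
  have e: "has_bochner_integral \<Omega> (\<lambda>\<omega>. g j (\<lambda>t\<in>{0..}. \<N> j t \<omega>)) (e j)" for j
    using increment_mean_power[OF assms, of i "c i"] increment_power[of b d "c j" j] assms
    by (cases "j = i") (simp_all add: g_def e_def)
  have "(\<Prod>j\<in>UNIV. g j (\<lambda>t\<in>{0..}. \<N> j t \<omega>))
      = real (\<N> i b \<omega> - \<N> i a \<omega>) * (\<Prod>j\<in>UNIV. c j ^ (\<N> j d \<omega> - \<N> j b \<omega>))" for \<omega>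
    using assms by (simp add: g_def prod.distrib)
  moreover have "(\<Prod>j\<in>UNIV. e j) = 2 * (b - a) * exp (\<Sum>j\<in>UNIV. 2 * (d - b) * (c j - 1))"
    by (simp add: e_def prod.distrib exp_sum)
  ultimately show ?thesis using noise_prod[OF g e] by (simp only:)
qed

section \<open>At most one jump per cell\<close>

text \<open>The jumps of all coordinates are counted together: the signs are indexed by the total
  count, and the cosine of a cell factors over the directions only if at most one of them
  jumps.\<close>

definition single :: "real \<Rightarrow> nat \<Rightarrow> 'w \<Rightarrow> bool" where
  "single T n \<omega> \<longleftrightarrow> (\<forall>k<2^n. total_noise (grid T n (Suc k)) \<omega> \<le> total_noise (grid T n k) \<omega> + 1)"

lemma single_measurable:
  assumes "0 < T" shows "Measurable.pred \<Omega> (single T n)"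
  unfolding single_def
  by (intro pred_intros_countable pred_intros_imp' total_le_measurable grid_nonneg) (use assms in auto)

text \<open>With S the total increment and y its mean, the indicator of S >= 2 is at most S - 1 +
  0^S, where 0^S indicates S = 0. Taking expectations leaves y - 1 + e^(-y), so a mean and a
  generating function replace the law of the sum.\<close>

lemma prob_increments_ge_2:
  assumes "0 \<le> s" "s \<le> t"
  shows "prob {\<omega>\<in>space \<Omega>. \<not> total_noise t \<omega> \<le> total_noise s \<omega> + 1}
    \<le> (2 * real CARD('n) * (t - s))\<^sup>2"
proof -
  define N where "N = real CARD('n)"
  define y where "y = 2 * N * (t - s)"
  have "0 \<le> y" using assms by (simp add: y_def N_def)
  define S where "S \<omega> = (\<Sum>j\<in>UNIV. \<N> j t \<omega> - \<N> j s \<omega>)" for \<omega>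
  have [measurable]: "(\<lambda>\<omega>. total_noise t \<omega>) \<in> measurable \<Omega> (count_space UNIV)"
      "(\<lambda>\<omega>. total_noise s \<omega>) \<in> measurable \<Omega> (count_space UNIV)"
    using assms by (auto intro: total_measurable)
  have S: "total_noise t \<omega> = total_noise s \<omega> + S \<omega>" if "\<omega> \<in> space \<Omega>" for \<omega>
    unfolding S_def sum.distrib[symmetric]
    using noise_mono[OF that assms] by (intro sum.cong) auto
  have mean: "has_bochner_integral \<Omega> (\<lambda>\<omega>. real (S \<omega>)) y"
  proof -
    have "has_bochner_integral \<Omega> (\<lambda>\<omega>. \<Sum>j\<in>UNIV. real (\<N> j t \<omega> - \<N> j s \<omega>)) (\<Sum>j\<in>(UNIV :: 'n set). 2 * (t - s))"
      by (intro has_bochner_integral_sum increment_mean assms)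
    then show ?thesis by (simp add: S_def y_def N_def algebra_simps)
  qed
  have zero: "has_bochner_integral \<Omega> (\<lambda>\<omega>. 0 ^ S \<omega>) (exp (- y))"
    using increments_power[OF assms, of "\<lambda>_. 0"]
    by (simp add: S_def power_sum y_def N_def algebra_simps)
  have B: "{\<omega>\<in>space \<Omega>. \<not> total_noise t \<omega> \<le> total_noise s \<omega> + 1} \<in> events" (is "?B \<in> _")
    using total_le_measurable[OF assms(1), of t] assms by (intro predE pred_intros_logic) auto
  have "prob ?B = (\<integral>\<omega>. indicator ?B \<omega> \<partial>\<Omega>)" using B by simp
  also have "\<dots> \<le> (\<integral>\<omega>. real (S \<omega>) - 1 + 0 ^ S \<omega> \<partial>\<Omega>)"
  proof (rule integral_mono)
    show "integrable \<Omega> (indicator ?B :: 'w \<Rightarrow> real)"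
      using B by (intro integrable_real_indicator) (auto simp: less_top[symmetric])
    show "integrable \<Omega> (\<lambda>\<omega>. real (S \<omega>) - 1 + 0 ^ S \<omega>)"
      using mean zero by (auto simp: has_bochner_integral_iff)
    show "indicator ?B \<omega> \<le> real (S \<omega>) - 1 + 0 ^ S \<omega>" if "\<omega> \<in> space \<Omega>" for \<omega>
    proof (cases "S \<omega> \<le> 1")
      case True
      then show ?thesis using S[OF that] by (cases "S \<omega> = 0") (auto simp: indicator_def)
    next
      case False
      then have "2 \<le> real (S \<omega>)" by linarith
      then show ?thesis by (simp add: indicator_def add_increasing2)
    qed
  qed
  also have "\<dots> = y - 1 + exp (- y)"
    using mean zero by (simp add: has_bochner_integral_iff prob_space)
  also have "\<dots> \<le> y\<^sup>2"
  proof -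
    \<comment> \<open>The next bound on the reciprocal comes from (1 + y)(1 - y + y^2) = 1 +
      y^3.\<close>
    have "exp (- y) \<le> 1 / (1 + y)"
      using exp_ge_add_one_self[of y] \<open>0 \<le> y\<close> by (simp add: exp_minus field_simps)
    also have "\<dots> \<le> 1 - y + y\<^sup>2"
      using \<open>0 \<le> y\<close> by (simp add: field_simps power2_eq_square)
    finally show ?thesis by simp
  qed
  finally show ?thesis by (simp add: y_def N_def)
qed

text \<open>Union bound over 2^n cells, each bad with probability quadratic in its length.\<close>

lemma prob_not_single:
  assumes "0 < T"
  shows "prob {\<omega>\<in>space \<Omega>. \<not> single T n \<omega>} \<le> (2 * real CARD('n) * T)\<^sup>2 / 2 ^ n"
proof -
  let ?B = "\<lambda>k. {\<omega>\<in>space \<Omega>. \<not> total_noise (grid T n (Suc k)) \<omega> \<le> total_noise (grid T n k) \<omega> + 1}"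
  have B: "?B k \<in> events" for k
    using assms by (intro predE pred_intros_logic total_le_measurable grid_nonneg) auto
  have "{\<omega>\<in>space \<Omega>. \<not> single T n \<omega>} = (\<Union>k\<in>{..<2^n}. ?B k)"
    by (auto simp: single_def)
  also have "prob \<dots> \<le> (\<Sum>k<2^n. prob (?B k))"
    by (intro finite_measure_subadditive_finite) (use B in auto)
  also have "\<dots> \<le> (\<Sum>k\<in>{..<2^n :: nat}. (2 * real CARD('n) * (T / 2 ^ n))\<^sup>2)"
  proof (rule sum_mono)
    fix k :: nat
    show "prob (?B k) \<le> (2 * real CARD('n) * (T / 2 ^ n))\<^sup>2"
      using prob_increments_ge_2[of "grid T n k" "grid T n (Suc k)"] assms
      by (simp add: grid_nonneg grid_Suc)
  qed
  also have "\<dots> = (2 * real CARD('n) * T)\<^sup>2 / 2 ^ n"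
    by (simp add: power_mult_distrib power2_eq_square)
  finally show ?thesis .
qed

lemma grid_double: "grid T (Suc n) (2 * k) = grid T n k"
  by (simp add: grid_def)

text \<open>Dyadic grids are nested: cell k of the finer grid lies in cell k div 2 of the coarser
  one. By this monotonicity the decay of the probabilities alone makes \<open>single\<close> hold
  eventually, almost surely.\<close>

lemma single_Suc:
  assumes "0 < T" "\<omega> \<in> space \<Omega>" "single T n \<omega>"
  shows "single T (Suc n) \<omega>"
  unfolding single_def
proof (intro allI impI)
  fix k :: nat assume k: "k < 2 ^ Suc n"
  let ?tot = "\<lambda>t. total_noise t \<omega>"
  have mono: "?tot s \<le> ?tot t" if "0 \<le> s" "s \<le> t" for s t
    using noise_mono[OF assms(2) that] by (intro sum_mono) auto
  have "?tot (grid T (Suc n) (Suc k)) \<le> ?tot (grid T (Suc n) (2 * Suc (k div 2)))"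
    using assms by (intro mono grid_nonneg grid_mono) auto
  also have "\<dots> \<le> ?tot (grid T (Suc n) (2 * (k div 2))) + 1"
    unfolding grid_double using assms(3) k unfolding single_def by auto
  also have "?tot (grid T (Suc n) (2 * (k div 2))) \<le> ?tot (grid T (Suc n) k)"
    using assms by (intro mono grid_nonneg grid_mono) auto
  finally show "?tot (grid T (Suc n) (Suc k)) \<le> ?tot (grid T (Suc n) k) + 1" by simp
qed

lemma AE_eventually_single:
  assumes T: "0 < T"
  shows "AE \<omega> in \<Omega>. \<forall>\<^sub>F n in sequentially. single T n \<omega>"
proof -
  note [measurable] = single_measurable[OF T]
  have mono: "single T m \<omega>" if "single T n \<omega>" "n \<le> m" "\<omega> \<in> space \<Omega>" for n m \<omega>
    using that(2,1) by (induction rule: dec_induct) (auto intro: single_Suc[OF T that(3)])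
  let ?B = "{\<omega>\<in>space \<Omega>. \<forall>n. \<not> single T n \<omega>}"
  have "prob ?B \<le> (2 * real CARD('n) * T)\<^sup>2 / 2 ^ n" for n
    by (rule order_trans[OF finite_measure_mono prob_not_single[OF T]]) (auto, measurable)
  moreover have "(\<lambda>n. (2 * real CARD('n) * T)\<^sup>2 / 2 ^ n) \<longlonglongrightarrow> 0"
    by (rule LIMSEQ_divide_realpow_zero) simp
  ultimately have "prob ?B \<le> 0"
    by (intro tendsto_lowerbound[of _ 0]) auto
  then have "prob ?B = 0" using measure_nonneg[of \<Omega> ?B] by linarith
  then have "AE \<omega> in \<Omega>. \<exists>n. single T n \<omega>"
    by (subst (asm) prob_eq_0) (auto elim: AE_mp)
  then show ?thesis
    unfolding eventually_sequentially by (rule AE_mp) (auto intro!: AE_I2 mono)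
qed

lemma expectation_not_single_tendsto:
  fixes G :: "'w \<Rightarrow> real"
  assumes T: "0 < T" and G: "integrable \<Omega> G"
  shows "(\<lambda>n. \<integral>\<omega>. G \<omega> * of_bool (\<not> single T n \<omega>) \<partial>\<Omega>) \<longlonglongrightarrow> 0"
proof -
  note [measurable] = single_measurable[OF T]
  have [measurable]: "G \<in> borel_measurable \<Omega>" using G by simp
  have "(\<lambda>n. \<integral>\<omega>. G \<omega> * of_bool (\<not> single T n \<omega>) \<partial>\<Omega>) \<longlonglongrightarrow> (\<integral>\<omega>. 0 \<partial>\<Omega>)"
  proof (rule integral_dominated_convergence[where w = "\<lambda>\<omega>. \<bar>G \<omega>\<bar>"])
    show "AE \<omega> in \<Omega>. (\<lambda>n. G \<omega> * of_bool (\<not> single T n \<omega>)) \<longlonglongrightarrow> 0"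
      using AE_eventually_single[OF T]
    proof eventually_elim
      case (elim \<omega>)
      then show ?case by (intro tendsto_eventually) (auto elim: eventually_mono)
    qed
  qed (use G in auto)
  then show ?thesis by simp
qed

end

section \<open>Averaging over the signs\<close>

text \<open>By independence the joint law is the product law, so Fubini allows X to be integrated
  out first while Y is frozen.\<close>

lemma (in prob_space) independent_pair_expectation:
  fixes f :: "'b \<times> 'c \<Rightarrow> complex"
  assumes X [measurable]: "X \<in> measurable M S" and Y [measurable]: "Y \<in> measurable M T"
    and ind: "\<And>A B. A \<in> sets S \<Longrightarrow> B \<in> sets T \<Longrightarrow>
      prob ((X -` A \<inter> space M) \<inter> (Y -` B \<inter> space M)) = prob (X -` A \<inter> space M) * prob (Y -` B \<inter> space M)"
    and f [measurable]: "f \<in> borel_measurable (S \<Otimes>\<^sub>M T)"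
    and int: "integrable M (\<lambda>\<omega>. f (X \<omega>, Y \<omega>))"
  shows "(\<integral>\<omega>. f (X \<omega>, Y \<omega>) \<partial>M) = (\<integral>\<omega>. (\<integral>\<omega>'. f (X \<omega>', Y \<omega>) \<partial>M) \<partial>M)"
proof -
  interpret PX: prob_space "distr M S X" by (rule prob_space_distr) measurable
  interpret PY: prob_space "distr M T Y" by (rule prob_space_distr) measurable
  interpret P: pair_sigma_finite "distr M S X" "distr M T Y" ..
  have eq: "distr M S X \<Otimes>\<^sub>M distr M T Y = distr M (S \<Otimes>\<^sub>M T) (\<lambda>\<omega>. (X \<omega>, Y \<omega>))"
  proof (rule pair_measure_eqI)
    fix A B assume "A \<in> sets (distr M S X)" "B \<in> sets (distr M T Y)"
    then have [measurable]: "A \<in> sets S" "B \<in> sets T" by auto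
    have "(\<lambda>\<omega>. (X \<omega>, Y \<omega>)) -` (A \<times> B) \<inter> space M = (X -` A \<inter> space M) \<inter> (Y -` B \<inter> space M)"
      by auto
    then show "emeasure (distr M S X) A * emeasure (distr M T Y) B
        = emeasure (distr M (S \<Otimes>\<^sub>M T) (\<lambda>\<omega>. (X \<omega>, Y \<omega>))) (A \<times> B)"
      by (simp add: emeasure_distr emeasure_eq_measure ind ennreal_mult)
  qed (auto intro: PX.sigma_finite_measure_axioms PY.sigma_finite_measure_axioms)
  have intP: "integrable (distr M S X \<Otimes>\<^sub>M distr M T Y) f"
    unfolding eq using int by (subst integrable_distr_eq) auto
  have "(\<integral>\<omega>. f (X \<omega>, Y \<omega>) \<partial>M) = (\<integral>p. f p \<partial>(distr M S X \<Otimes>\<^sub>M distr M T Y))"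
    unfolding eq by (subst integral_distr) auto
  also have "\<dots> = (\<integral>y. (\<integral>x. f (x, y) \<partial>distr M S X) \<partial>distr M T Y)"
    using P.integral_snd[of "\<lambda>x y. f (x, y)"] intP by simp
  also have "\<dots> = (\<integral>\<omega>. (\<integral>x. f (x, Y \<omega>) \<partial>distr M S X) \<partial>M)"
    by (subst integral_distr) (auto intro!: PX.borel_measurable_lebesgue_integral)
  also have "\<dots> = (\<integral>\<omega>. (\<integral>\<omega>'. f (X \<omega>', Y \<omega>) \<partial>M) \<partial>M)"
  proof (rule Bochner_Integration.integral_cong[OF refl])
    fix \<omega> assume "\<omega> \<in> space M"
    then have "Y \<omega> \<in> space T" using measurable_space[OF Y] by simp
    then have "(\<lambda>x. f (x, Y \<omega>)) \<in> borel_measurable S" by measurable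
    then show "(\<integral>x. f (x, Y \<omega>) \<partial>distr M S X) = (\<integral>\<omega>'. f (X \<omega>', Y \<omega>) \<partial>M)"
      by (subst integral_distr) auto
  qed
  finally show ?thesis .
qed

context walk_noise
begin

lemma sign_measurable: "1 \<le> k \<Longrightarrow> \<tau> k \<in> measurable \<Omega> (count_space UNIV)"
  using indep_signs unfolding indep_vars_def2 by auto

lemma AE_sign: "AE \<omega> in \<Omega>. \<forall>k\<ge>1. \<tau> k \<omega> = 1 \<or> \<tau> k \<omega> = -1"
proof -
  have "AE \<omega> in \<Omega>. 1 \<le> k \<longrightarrow> \<tau> k \<omega> = 1 \<or> \<tau> k \<omega> = -1" for k
  proof (cases "1 \<le> k")
    case True
    note [measurable] = sign_measurable[OF True]
    have "{\<omega> \<in> space \<Omega>. \<tau> k \<omega> = 1 \<or> \<tau> k \<omega> = -1}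
        = {\<omega> \<in> space \<Omega>. \<tau> k \<omega> = 1} \<union> {\<omega> \<in> space \<Omega>. \<tau> k \<omega> = -1}" by auto
    also have "prob \<dots> = 1/2 + 1/2"
      by (subst finite_measure_Union) (auto simp: sign_plus[OF True] sign_minus[OF True])
    finally have "prob {\<omega> \<in> space \<Omega>. \<tau> k \<omega> = 1 \<or> \<tau> k \<omega> = -1} = 1" by simp
    then show ?thesis
      by (subst (asm) prob_eq_1) (auto elim: AE_mp)
  qed auto
  then show ?thesis by (subst AE_all_countable) auto
qed

lemma sign_expectation:
  fixes h :: "int \<Rightarrow> complex"
  assumes k: "1 \<le> k"
  shows "has_bochner_integral \<Omega> (\<lambda>\<omega>. h (\<tau> k \<omega>)) ((h 1 + h (-1)) / 2)"
proof -
  note [measurable] = sign_measurable[OF k]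
  let ?P = "{\<omega> \<in> space \<Omega>. \<tau> k \<omega> = 1}" and ?M = "{\<omega> \<in> space \<Omega>. \<tau> k \<omega> = -1}"
  have "has_bochner_integral \<Omega> (\<lambda>\<omega>. indicator ?P \<omega> *\<^sub>R h 1 + indicator ?M \<omega> *\<^sub>R h (-1))
     (prob ?P *\<^sub>R h 1 + prob ?M *\<^sub>R h (-1))"
    by (intro has_bochner_integral_add has_bochner_integral_indicator) (auto simp: less_top[symmetric])
  moreover have "prob ?P *\<^sub>R h 1 + prob ?M *\<^sub>R h (-1) = (h 1 + h (-1)) / 2"
    unfolding sign_plus[OF k] sign_minus[OF k] by (simp add: scaleR_conv_of_real field_simps)
  moreover have "AE \<omega> in \<Omega>. indicator ?P \<omega> *\<^sub>R h 1 + indicator ?M \<omega> *\<^sub>R h (-1) = h (\<tau> k \<omega>)"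
    using AE_sign AE_space by eventually_elim (use k in \<open>auto simp: indicator_def\<close>)
  ultimately show ?thesis
    by (subst has_bochner_integral_cong_AE[symmetric]) auto
qed

lemma sign_prod_expectation:
  fixes h :: "'i \<Rightarrow> int \<Rightarrow> complex"
  assumes "finite I" "inj_on \<kappa> I" "\<kappa> ` I \<subseteq> {1..}"
  shows "(\<integral>\<omega>. (\<Prod>l\<in>I. h l (\<tau> (\<kappa> l) \<omega>)) \<partial>\<Omega>) = (\<Prod>l\<in>I. (h l 1 + h l (-1)) / 2)"
proof -
  define h' where "h' m = h (the_inv_into I \<kappa> m)" for m
  have h': "h' (\<kappa> l) = h l" if "l \<in> I" for l
    using that assms(2) by (simp add: h'_def the_inv_into_f_f)
  have ind: "indep_vars (\<lambda>_. borel) (\<lambda>m \<omega>. h' m (\<tau> m \<omega>)) (\<kappa> ` I)"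
    by (rule indep_vars_compose2[OF indep_vars_subset[OF indep_signs assms(3)]]) simp
  have int: "has_bochner_integral \<Omega> (\<lambda>\<omega>. h' m (\<tau> m \<omega>)) ((h' m 1 + h' m (-1)) / 2)" if "m \<in> \<kappa> ` I" for m
    using that assms(3) by (intro sign_expectation) auto
  have "(\<integral>\<omega>. (\<Prod>m\<in>\<kappa> ` I. h' m (\<tau> m \<omega>)) \<partial>\<Omega>) = (\<Prod>m\<in>\<kappa> ` I. \<integral>\<omega>. h' m (\<tau> m \<omega>) \<partial>\<Omega>)"
    using int by (intro indep_vars_lebesgue_integral[OF finite_imageI[OF assms(1)] ind])
      (auto simp: has_bochner_integral_iff)
  also have "\<dots> = (\<Prod>m\<in>\<kappa> ` I. (h' m 1 + h' m (-1)) / 2)"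
    by (intro prod.cong refl has_bochner_integral_integral_eq int)
  finally have "(\<integral>\<omega>. (\<Prod>m\<in>\<kappa> ` I. h' m (\<tau> m \<omega>)) \<partial>\<Omega>) = (\<Prod>m\<in>\<kappa> ` I. (h' m 1 + h' m (-1)) / 2)" .
  then show ?thesis
    using assms(2) h' by (simp add: prod.reindex)
qed

definition noise_space :: "('n \<times> real \<Rightarrow> nat) measure" where
  "noise_space = Pi\<^sub>M (UNIV \<times> {0..}) (\<lambda>_. count_space UNIV)"

definition noise_path :: "'w \<Rightarrow> 'n \<times> real \<Rightarrow> nat" where
  "noise_path \<omega> = (\<lambda>(i, t)\<in>UNIV \<times> {0..}. \<N> i t \<omega>)"

lemma noise_path_apply [simp]: "0 \<le> t \<Longrightarrow> noise_path \<omega> (i, t) = \<N> i t \<omega>"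
  by (simp add: noise_path_def)

lemma noise_path_measurable [measurable]: "noise_path \<in> measurable \<Omega> noise_space"
  unfolding noise_path_def noise_space_def
  by (intro measurable_restrict) (auto intro: noise_measurable)

lemma noise_space_component:
  "0 \<le> t \<Longrightarrow> (\<lambda>y. y (i, t)) \<in> measurable noise_space (count_space UNIV)"
  unfolding noise_space_def by (rule measurable_component_singleton) simp

lemma sign_path_measurable:
  "(\<lambda>\<omega>. \<lambda>k\<in>{1..}. \<tau> k \<omega>) \<in> measurable \<Omega> (Pi\<^sub>M {1..} (\<lambda>_. count_space UNIV))"
  by (intro measurable_restrict) (auto intro: sign_measurable)

lemma indep_sign_noise:
  fixes A :: "(nat \<Rightarrow> int) set"
  defines "X \<equiv> \<lambda>\<omega>. \<lambda>k\<in>{1..}. \<tau> k \<omega>"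
  assumes "A \<in> sets (Pi\<^sub>M {1..} (\<lambda>_. count_space UNIV))" "B \<in> sets noise_space"
  shows "prob ((X -` A \<inter> space \<Omega>) \<inter> (noise_path -` B \<inter> space \<Omega>))
    = prob (X -` A \<inter> space \<Omega>) * prob (noise_path -` B \<inter> space \<Omega>)"
proof (rule indep_setD[OF indep_signs_poisson])
  show "X -` A \<inter> space \<Omega> \<in> sets (vimage_algebra (space \<Omega>) (\<lambda>\<omega>. \<lambda>k\<in>{1..}. \<tau> k \<omega>)
                  (Pi\<^sub>M {1..} (\<lambda>_. count_space UNIV)))"
    unfolding X_def by (rule in_vimage_algebra) fact
  show "noise_path -` B \<inter> space \<Omega> \<in> sets (vimage_algebra (space \<Omega>) (\<lambda>\<omega>. \<lambda>(i, t)\<in>UNIV \<times> {0..}. \<N> i t \<omega>)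
                  (Pi\<^sub>M (UNIV \<times> {0..}) (\<lambda>_. count_space UNIV)))"
    unfolding noise_path_def using assms(3)[unfolded noise_space_def] by (rule in_vimage_algebra)
qed

lemma sign_average:
  fixes g :: "('n \<times> real \<Rightarrow> nat) \<Rightarrow> real" and h :: "nat \<Rightarrow> ('n \<times> real \<Rightarrow> nat) \<Rightarrow> int \<Rightarrow> complex"
    and T B :: real and k n :: nat
  defines "cnt \<equiv> \<lambda>y l. \<Sum>j\<in>UNIV. y (j, grid T n l)"
  assumes T: "0 < T" and g [measurable]: "g \<in> borel_measurable noise_space"
    and ig: "integrable \<Omega> (\<lambda>\<omega>. g (noise_path \<omega>))"
    and h [measurable]: "\<And>l s. (\<lambda>y. h l y s) \<in> borel_measurable noise_space"
    and B: "\<And>l y s. \<bar>s\<bar> \<le> 1 \<Longrightarrow> cmod (h l y s) \<le> B" "1 \<le> B"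
  shows "(\<integral>\<omega>. complex_of_real (g (noise_path \<omega>)) * (\<Prod>l\<in>{k..<2^n}.
        if cnt (noise_path \<omega>) (Suc l) = cnt (noise_path \<omega>) l then 1
        else h l (noise_path \<omega>) (\<tau> (cnt (noise_path \<omega>) (Suc l)) \<omega>)) \<partial>\<Omega>)
    = (\<integral>\<omega>. complex_of_real (g (noise_path \<omega>)) * (\<Prod>l\<in>{k..<2^n}.
        if cnt (noise_path \<omega>) (Suc l) = cnt (noise_path \<omega>) l then 1
        else (h l (noise_path \<omega>) 1 + h l (noise_path \<omega>) (-1)) / 2) \<partial>\<Omega>)"
proof -
  let ?S = "Pi\<^sub>M {1..} (\<lambda>_. count_space UNIV) :: (nat \<Rightarrow> int) measure"
  let ?X = "\<lambda>\<omega>. \<lambda>k\<in>{1..}. \<tau> k \<omega>"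
  \<comment> \<open>Nothing is assumed about \<open>\<tau> 0\<close>, not even measurability, and the path of signs starts at \<open>1\<close>.\<close>
  define x' where "x' x m = (if m = 0 then 0 else x m)" for x :: "nat \<Rightarrow> int" and m :: nat
  define f where "f p = complex_of_real (g (snd p)) * (\<Prod>l\<in>{k..<2^n}.
        if cnt (snd p) (Suc l) = cnt (snd p) l then 1 else h l (snd p) (x' (fst p) (cnt (snd p) (Suc l))))" for p
  have x'_m: "(\<lambda>x. x' x m) \<in> measurable ?S (count_space UNIV)" for m
    unfolding x'_def by (cases "m = 0") auto
  have cnt_m [measurable]: "(\<lambda>y. cnt y l) \<in> measurable noise_space (count_space UNIV)" for l
    unfolding cnt_def using T by (intro measurable_sum_nat noise_space_component grid_nonneg) simp
  have sgn [measurable]: "(\<lambda>p. x' (fst p) (cnt (snd p) (Suc l))) \<in> measurable (?S \<Otimes>\<^sub>M noise_space) (count_space UNIV)" for l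
    by (rule measurable_compose_countable[of "\<lambda>m p. x' (fst p) m"],
        rule measurable_compose[OF measurable_fst x'_m], rule measurable_compose[OF measurable_snd cnt_m])
  have hm [measurable]: "(\<lambda>p. h l (snd p) (x' (fst p) (cnt (snd p) (Suc l)))) \<in> borel_measurable (?S \<Otimes>\<^sub>M noise_space)" for l
    by (rule measurable_compose_countable[of "\<lambda>s p. h l (snd p) s"],
        rule measurable_compose[OF measurable_snd h], rule sgn)
  have eq_m: "Measurable.pred noise_space (\<lambda>y. cnt y (Suc l) = cnt y l)" for l
    by (rule measurable_compose_countable[of "\<lambda>m y. m = cnt y l", OF _ cnt_m], rule measurable_compose[OF cnt_m]) simp
  have [measurable]: "Measurable.pred (?S \<Otimes>\<^sub>M noise_space) (\<lambda>p. cnt (snd p) (Suc l) = cnt (snd p) l)" for l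
    by (rule measurable_compose[OF measurable_snd eq_m])
  have f [measurable]: "f \<in> borel_measurable (?S \<Otimes>\<^sub>M noise_space)"
    unfolding f_def
    by (intro borel_measurable_times borel_measurable_prod measurable_If) measurable
  have nz: "cnt (noise_path \<omega>) (Suc l) \<noteq> 0"
    if "\<omega> \<in> space \<Omega>" "cnt (noise_path \<omega>) (Suc l) \<noteq> cnt (noise_path \<omega>) l" for \<omega> l
  proof -
    have "cnt (noise_path \<omega>) l \<le> cnt (noise_path \<omega>) (Suc l)"
      unfolding cnt_def using T that(1) by (intro sum_mono) (auto simp: grid_nonneg intro!: noise_mono grid_mono)
    with that(2) show ?thesis by linarith
  qed
  have mono: "cnt (noise_path \<omega>) l \<le> cnt (noise_path \<omega>) l'" if "\<omega> \<in> space \<Omega>" "l \<le> l'" for \<omega> l l'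
    unfolding cnt_def using T that by (intro sum_mono) (auto simp: grid_nonneg intro!: noise_mono grid_mono)
  have fX: "f (?X \<omega>', noise_path \<omega>) = complex_of_real (g (noise_path \<omega>)) * (\<Prod>l\<in>{k..<2^n}.
        if cnt (noise_path \<omega>) (Suc l) = cnt (noise_path \<omega>) l then 1
        else h l (noise_path \<omega>) (\<tau> (cnt (noise_path \<omega>) (Suc l)) \<omega>'))" if "\<omega> \<in> space \<Omega>" for \<omega> \<omega>'
  proof -
    have "x' (?X \<omega>') (cnt (noise_path \<omega>) (Suc l)) = \<tau> (cnt (noise_path \<omega>) (Suc l)) \<omega>'"
      if "cnt (noise_path \<omega>) (Suc l) \<noteq> cnt (noise_path \<omega>) l" for l
      using nz[OF \<open>\<omega> \<in> space \<Omega>\<close> that] by (simp add: x'_def Suc_le_eq)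
    then show ?thesis
      unfolding f_def fst_conv snd_conv by (intro arg_cong2[where f = "(*)"] prod.cong refl) simp
  qed
  have X [measurable]: "?X \<in> measurable \<Omega> ?S" by (rule sign_path_measurable)
  have int: "integrable \<Omega> (\<lambda>\<omega>. f (?X \<omega>, noise_path \<omega>))"
  proof (rule Bochner_Integration.integrable_bound)
    show "integrable \<Omega> (\<lambda>\<omega>. B ^ (2^n - k) * \<bar>g (noise_path \<omega>)\<bar>)" using ig by simp
    show "AE \<omega> in \<Omega>. norm (f (?X \<omega>, noise_path \<omega>)) \<le> norm (B ^ (2^n - k) * \<bar>g (noise_path \<omega>)\<bar>)"
      using AE_sign AE_space
    proof eventually_elim
      case (elim \<omega>)
      let ?q = "\<lambda>l. if cnt (noise_path \<omega>) (Suc l) = cnt (noise_path \<omega>) l then 1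
        else h l (noise_path \<omega>) (\<tau> (cnt (noise_path \<omega>) (Suc l)) \<omega>)"
      have "cmod (?q l) \<le> B" for l
      proof (cases "cnt (noise_path \<omega>) (Suc l) = cnt (noise_path \<omega>) l")
        case False
        then have "\<bar>\<tau> (cnt (noise_path \<omega>) (Suc l)) \<omega>\<bar> \<le> 1"
          using nz[of \<omega> l] elim by (auto dest: spec[of _ "cnt (noise_path \<omega>) (Suc l)"])
        then show ?thesis using False B(1) by simp
      qed (use B(2) in simp)
      then have "cmod (\<Prod>l\<in>{k..<2^n}. ?q l) \<le> (\<Prod>l\<in>{k..<2^n}. B)"
        unfolding prod_norm[symmetric] by (intro prod_mono) auto
      also have "\<dots> = B ^ (2^n - k)" by simp
      finally show ?case
        unfolding fX[OF elim(2)] norm_mult using B(2)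
        by (simp add: mult.commute[of "B ^ _"] mult_left_mono)
    qed
  qed measurable
  have "(\<integral>\<omega>. f (?X \<omega>, noise_path \<omega>) \<partial>\<Omega>) = (\<integral>\<omega>. (\<integral>\<omega>'. f (?X \<omega>', noise_path \<omega>) \<partial>\<Omega>) \<partial>\<Omega>)"
    by (rule independent_pair_expectation[OF X noise_path_measurable indep_sign_noise f int])
  also have "\<dots> = (\<integral>\<omega>. complex_of_real (g (noise_path \<omega>)) * (\<Prod>l\<in>{k..<2^n}.
        if cnt (noise_path \<omega>) (Suc l) = cnt (noise_path \<omega>) l then 1
        else (h l (noise_path \<omega>) 1 + h l (noise_path \<omega>) (-1)) / 2) \<partial>\<Omega>)"
  proof (rule Bochner_Integration.integral_cong[OF refl])
    fix \<omega> assume \<omega>: "\<omega> \<in> space \<Omega>"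
    let ?y = "noise_path \<omega>"
    define I where "I = {l\<in>{k..<2^n}. cnt ?y (Suc l) \<noteq> cnt ?y l}"
    have prod_I: "(\<Prod>l\<in>{k..<2^n}. if cnt ?y (Suc l) = cnt ?y l then 1 else q l) = (\<Prod>l\<in>I. q l)" for q :: "nat \<Rightarrow> complex"
      unfolding I_def by (intro prod.mono_neutral_cong_right) auto
    have "inj_on (\<lambda>l. cnt ?y (Suc l)) I"
    proof (rule linorder_inj_onI)
      fix l l' assume l: "l < l'" "l \<in> I" "l' \<in> I"
      have "cnt ?y (Suc l) \<le> cnt ?y l'" using l by (intro mono \<omega>) auto
      also have "cnt ?y l' < cnt ?y (Suc l')"
        using l mono[OF \<omega>, of l' "Suc l'"] by (auto simp: I_def)
      finally show "cnt ?y (Suc l) \<noteq> cnt ?y (Suc l')" by simp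
    qed (auto simp: I_def)
    moreover have "(\<lambda>l. cnt ?y (Suc l)) ` I \<subseteq> {1..}"
    proof safe
      fix l assume "l \<in> I"
      then have "cnt ?y (Suc l) \<noteq> 0" using nz[OF \<omega>, of l] by (simp add: I_def)
      then show "1 \<le> cnt ?y (Suc l)" by linarith
    qed
    ultimately have "(\<integral>\<omega>'. (\<Prod>l\<in>I. h l ?y (\<tau> (cnt ?y (Suc l)) \<omega>')) \<partial>\<Omega>)
       = (\<Prod>l\<in>I. (h l ?y 1 + h l ?y (-1)) / 2)"
      by (intro sign_prod_expectation) (auto simp: I_def)
    then show "(\<integral>\<omega>'. f (?X \<omega>', ?y) \<partial>\<Omega>) = complex_of_real (g ?y) * (\<Prod>l\<in>{k..<2^n}.
        if cnt ?y (Suc l) = cnt ?y l then 1 else (h l ?y 1 + h l ?y (-1)) / 2)"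
      unfolding fX[OF \<omega>] prod_I by simp
  qed
  also have "(\<integral>\<omega>. f (?X \<omega>, noise_path \<omega>) \<partial>\<Omega>) = (\<integral>\<omega>. complex_of_real (g (noise_path \<omega>)) * (\<Prod>l\<in>{k..<2^n}.
        if cnt (noise_path \<omega>) (Suc l) = cnt (noise_path \<omega>) l then 1
        else h l (noise_path \<omega>) (\<tau> (cnt (noise_path \<omega>) (Suc l)) \<omega>)) \<partial>\<Omega>)"
    by (intro Bochner_Integration.integral_cong refl fX)
  finally show ?thesis .
qed


text \<open>W_t - W_T is minus the sum of the walk increments over the cells after t, hence the
  minus sign in the phases. With at most one jump per cell each of them is the noise increment times
  one sign.\<close>

lemma character_walk_increment:
  assumes T: "0 < T" and \<omega>: "\<omega> \<in> space \<Omega>" and s: "single T n \<omega>" and "k \<le> 2 ^ n"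
  shows "character (W (grid T n k) \<omega> - W T \<omega>) \<xi>
    = (\<Prod>l\<in>{k..<2^n}. cis (- (real_of_int (\<tau> (total_noise (grid T n (Suc l)) \<omega>) \<omega>)
        * (\<Sum>j\<in>UNIV. 2 * pi * \<xi> $ j * real (increment T n j l \<omega>)))))"
proof -
  let ?W = "\<lambda>l j. real_of_int (W (grid T n l) \<omega> $ j)"
  let ?\<tau> = "\<lambda>l. \<tau> (total_noise (grid T n (Suc l)) \<omega>) \<omega>"
  have step: "?W (Suc l) j - ?W l j = real_of_int (?\<tau> l) * real (increment T n j l \<omega>)"
    if "l < 2 ^ n" for l j
  proof -
    have le: "\<N> j (grid T n l) \<omega> \<le> \<N> j (grid T n (Suc l)) \<omega>"
      using T by (intro noise_mono \<omega> grid_nonneg grid_mono) auto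
    have "W (grid T n (Suc l)) \<omega> $ j - W (grid T n l) \<omega> $ j
        = ?\<tau> l * (int (\<N> j (grid T n (Suc l)) \<omega>) - int (\<N> j (grid T n l) \<omega>))"
      using s that T unfolding single_def
      by (intro walk_increment_single counting \<omega> grid_nonneg grid_mono) auto
    then have "real_of_int (W (grid T n (Suc l)) \<omega> $ j - W (grid T n l) \<omega> $ j)
        = real_of_int (?\<tau> l * (int (\<N> j (grid T n (Suc l)) \<omega>) - int (\<N> j (grid T n l) \<omega>)))" by (rule arg_cong)
    then show ?thesis using le by (simp add: of_nat_diff)
  qed
  have "(\<Prod>l\<in>{k..<2^n}. cis (- (real_of_int (?\<tau> l) * (\<Sum>j\<in>UNIV. 2 * pi * \<xi> $ j * real (increment T n j l \<omega>)))))
     = (\<Prod>l\<in>{k..<2^n}. cis (- (\<Sum>j\<in>UNIV. 2 * pi * \<xi> $ j * (?W (Suc l) j - ?W l j))))"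
    by (intro prod.cong refl) (simp add: step sum_distrib_left mult_ac)
  also have "\<dots> = cis (\<Sum>l\<in>{k..<2^n}. - (\<Sum>j\<in>UNIV. 2 * pi * \<xi> $ j * (?W (Suc l) j - ?W l j)))"
    by (induction rule: finite_induct[OF finite_atLeastLessThan[of k "2^n"]]) (auto simp: cis_mult)
  also have "(\<Sum>l\<in>{k..<2^n}. - (\<Sum>j\<in>UNIV. 2 * pi * \<xi> $ j * (?W (Suc l) j - ?W l j)))
     = - (\<Sum>j\<in>UNIV. 2 * pi * \<xi> $ j * (\<Sum>l\<in>{k..<2^n}. ?W (Suc l) j - ?W l j))"
    unfolding sum_negf sum_distrib_left by (subst sum.swap) simp
  also have "\<dots> = - (\<Sum>j\<in>UNIV. 2 * pi * \<xi> $ j * (?W (2^n) j - ?W k j))"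
  proof -
    have "(\<Sum>l\<in>{k..<2^n}. ?W (Suc l) j - ?W l j) = ?W (2^n) j - ?W k j" for j
      by (rule sum_Suc_diff'[OF assms(4), of "\<lambda>l. ?W l j"])
    then show ?thesis by (simp only:)
  qed
  finally have "(\<Prod>l\<in>{k..<2^n}. cis (- (real_of_int (?\<tau> l) * (\<Sum>j\<in>UNIV. 2 * pi * \<xi> $ j * real (increment T n j l \<omega>)))))
     = cis (- (\<Sum>j\<in>UNIV. 2 * pi * \<xi> $ j * (?W (2^n) j - ?W k j)))" .
  also have "\<dots> = character (W (grid T n k) \<omega> - W T \<omega>) \<xi>"
    unfolding character_def
    by (simp add: sum_distrib_left sum_negf[symmetric] algebra_simps)
  finally show ?thesis ..
qed

lemma sum_le_1_cases:
  fixes d :: "'i::finite \<Rightarrow> nat"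
  assumes "(\<Sum>j\<in>UNIV. d j) \<le> 1"
  obtains "\<And>j. d j = 0" | i where "\<And>j. d j = (if j = i then 1 else 0)"
proof (cases "\<forall>j. d j = 0")
  case False
  then obtain i where i: "d i \<noteq> 0" by blast
  have "(\<Sum>j\<in>UNIV. d j) = d i + (\<Sum>j\<in>UNIV - {i}. d j)" by (simp add: sum.remove)
  with assms i have "d i = 1" "(\<Sum>j\<in>UNIV - {i}. d j) = 0" by linarith+
  then have "d j = (if j = i then 1 else 0)" for j by auto
  then show ?thesis by (rule that(2))
qed (use that in blast)

text \<open>With at most one jump in the cell, the phase is either 0 or the angle of the one
  direction that jumps. A product of powers with exponents 0 and 1 therefore equals the cosine of
  the whole phase.\<close>

lemma cell_average:
  fixes \<theta> :: "'i::finite \<Rightarrow> real"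
  assumes "(\<Sum>j\<in>UNIV. d j) \<le> (1 :: nat)"
  shows "cos (\<Sum>j\<in>UNIV. \<theta> j * real (d j)) = (\<Prod>j\<in>UNIV. cos (\<theta> j) ^ d j)"
    and "d i \<noteq> 0 \<Longrightarrow> (\<Sum>j\<in>UNIV. \<theta> j * real (d j)) = \<theta> i"
    and "(\<Sum>j\<in>UNIV. d j) = 0 \<Longrightarrow> (\<Sum>j\<in>UNIV. \<theta> j * real (d j)) = 0"
proof -
  show "cos (\<Sum>j\<in>UNIV. \<theta> j * real (d j)) = (\<Prod>j\<in>UNIV. cos (\<theta> j) ^ d j)"
    using assms
  proof (cases rule: sum_le_1_cases)
    case (2 i)
    have "(\<Sum>j\<in>UNIV. \<theta> j * real (d j)) = (\<Sum>j\<in>UNIV. if j = i then \<theta> j else 0)"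
      by (intro sum.cong) (auto simp: 2)
    moreover have "(\<Prod>j\<in>UNIV. cos (\<theta> j) ^ d j) = (\<Prod>j\<in>UNIV. if j = i then cos (\<theta> j) else 1)"
      by (intro prod.cong) (auto simp: 2)
    ultimately show ?thesis by simp
  qed simp
  show "(\<Sum>j\<in>UNIV. \<theta> j * real (d j)) = \<theta> i" if i: "d i \<noteq> 0"
    using assms
  proof (cases rule: sum_le_1_cases)
    case (2 i')
    then have "i' = i" using i by (metis)
    have "(\<Sum>j\<in>UNIV. \<theta> j * real (d j)) = (\<Sum>j\<in>UNIV. if j = i then \<theta> j else 0)"
      by (intro sum.cong) (auto simp: 2 \<open>i' = i\<close>)
    then show ?thesis by simp
  qed (use i in simp)
  show "(\<Sum>j\<in>UNIV. \<theta> j * real (d j)) = 0" if "(\<Sum>j\<in>UNIV. d j) = 0"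
    using that by simp
qed

end

lemma sum_increments_nat:
  fixes f :: "nat \<Rightarrow> nat"
  assumes "k \<le> m" and "\<And>l. k \<le> l \<Longrightarrow> l < m \<Longrightarrow> f l \<le> f (Suc l)"
  shows "f k \<le> f m" and "(\<Sum>l\<in>{k..<m}. f (Suc l) - f l) = f m - f k"
proof -
  have "f k \<le> f m \<and> (\<Sum>l\<in>{k..<m}. f (Suc l) - f l) = f m - f k"
    using assms
  proof (induction m rule: dec_induct)
    case (step m)
    then have "f k \<le> f m \<and> (\<Sum>l\<in>{k..<m}. f (Suc l) - f l) = f m - f k" "f m \<le> f (Suc m)" by auto
    then show ?case using step.hyps by auto
  qed simp
  then show "f k \<le> f m" "(\<Sum>l\<in>{k..<m}. f (Suc l) - f l) = f m - f k" by auto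
qed

lemma borel_measurable_nat_diff:
  assumes "a \<in> measurable M (count_space UNIV)" "b \<in> measurable M (count_space UNIV)"
  shows "(\<lambda>x. real (a x - b x :: nat)) \<in> borel_measurable M"
  by (rule measurable_compose_countable[OF _ assms(1)], rule measurable_compose[OF assms(2)]) simp

lemma borel_measurable_of_bool:
  assumes "Measurable.pred M P"
  shows "(\<lambda>x. of_bool (P x) :: 'b::{zero_neq_one, topological_space}) \<in> borel_measurable M"
  by (rule measurable_compose[OF assms]) simp

context walk_noise
begin

lemma prod_cos_cells:
  fixes \<theta> :: "'n \<Rightarrow> real"
  assumes T: "0 < T" and \<omega>: "\<omega> \<in> space \<Omega>" and s: "single T n \<omega>" and "k \<le> 2 ^ n"
  shows "(\<Prod>l\<in>{k..<2^n}. cos (\<Sum>j\<in>UNIV. \<theta> j * real (increment T n j l \<omega>)))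
    = (\<Prod>j\<in>UNIV. cos (\<theta> j) ^ (\<N> j T \<omega> - \<N> j (grid T n k) \<omega>))"
proof -
  have mono: "\<N> j (grid T n l) \<omega> \<le> \<N> j (grid T n (Suc l)) \<omega>" for j l
    using T by (intro noise_mono \<omega> grid_nonneg grid_mono) auto
  have d: "(\<Sum>j\<in>UNIV. increment T n j l \<omega>) \<le> 1" if "l < 2^n" for l
  proof -
    have "(total_noise (grid T n (Suc l)) \<omega>)
        = total_noise (grid T n l) \<omega> + (\<Sum>j\<in>UNIV. increment T n j l \<omega>)"
      unfolding sum.distrib[symmetric] using mono by (intro sum.cong) auto
    with s that show ?thesis unfolding single_def by fastforce
  qed
  have "(\<Prod>l\<in>{k..<2^n}. cos (\<Sum>j\<in>UNIV. \<theta> j * real (increment T n j l \<omega>)))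
    = (\<Prod>l\<in>{k..<2^n}. \<Prod>j\<in>UNIV. cos (\<theta> j) ^ (increment T n j l \<omega>))"
    by (intro prod.cong refl cell_average(1) d) auto
  also have "\<dots> = (\<Prod>j\<in>UNIV. cos (\<theta> j) ^ (\<Sum>l\<in>{k..<2^n}. increment T n j l \<omega>))"
    by (subst prod.swap) (simp add: power_sum)
  also have "\<dots> = (\<Prod>j\<in>UNIV. cos (\<theta> j) ^ (\<N> j T \<omega> - \<N> j (grid T n k) \<omega>))"
    using sum_increments_nat(2)[OF assms(4), of "\<lambda>l. \<N> _ (grid T n l) \<omega>"] mono by simp
  finally show ?thesis .
qed

lemma single_noise_path:
  assumes "0 < T"
  shows "single T n \<omega> \<longleftrightarrow> (\<forall>l<2^n. (\<Sum>j\<in>UNIV. noise_path \<omega> (j, grid T n (Suc l))) \<le> (\<Sum>j\<in>UNIV. noise_path \<omega> (j, grid T n l)) + 1)"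
  using assms by (simp add: single_def grid_nonneg)

lemma single_path_measurable:
  assumes "0 < T"
  shows "Measurable.pred noise_space (\<lambda>y. \<forall>l<2^n. (\<Sum>j\<in>UNIV. y (j, grid T n (Suc l))) \<le> (\<Sum>j\<in>UNIV. y (j, grid T n l)) + 1)"
proof -
  have c: "(\<lambda>y. \<Sum>j\<in>UNIV. y (j, grid T n l)) \<in> measurable noise_space (count_space UNIV)" for l
    using assms by (intro measurable_sum_nat noise_space_component grid_nonneg) simp
  have "Measurable.pred noise_space (\<lambda>y. a y \<le> b y + 1)"
    if "a \<in> measurable noise_space (count_space UNIV)" "b \<in> measurable noise_space (count_space UNIV)"
    for a b :: "('n \<times> real \<Rightarrow> nat) \<Rightarrow> nat"
    by (rule measurable_compose_countable[OF _ that(1)], rule measurable_compose[OF that(2)]) simp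
  from this[OF c c] show ?thesis by (intro pred_intros_countable pred_intros_imp')
qed

text \<open>A jump of direction i in cell k with sign s contributes (B + C s) e^(-i s theta_i),
  whose mean over s = 1 and s = -1 is B cos theta_i - i C sin theta_i. Every later cell contributes
  the cosine of its phase. The powers of the cosines thus start at the right end of cell k, the cell
  itself being spent on the first factor.\<close>

lemma expectation_character_increment:
  fixes B C :: complex and \<xi> :: "real ^ 'n" and i :: 'n and T :: real and k n :: nat
  assumes T: "0 < T" and k: "k < 2 ^ n"
  defines "dN \<equiv> \<lambda>\<omega>. real (increment T n i k \<omega>)"
    and "dW \<equiv> \<lambda>\<omega>. W (grid T n (Suc k)) \<omega> $ i - W (grid T n k) \<omega> $ i"
  shows "(\<integral>\<omega>. of_bool (single T n \<omega>) * (character (W (grid T n k) \<omega> - W T \<omega>) \<xi>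
        * (B * complex_of_real (dN \<omega>) + C * of_int (dW \<omega>))) \<partial>\<Omega>)
    = (B * complex_of_real (cos (2 * pi * \<xi> $ i)) - \<i> * C * complex_of_real (sin (2 * pi * \<xi> $ i)))
      * complex_of_real (\<integral>\<omega>. of_bool (single T n \<omega>) * (dN \<omega> *
          (\<Prod>j\<in>UNIV. cos (2 * pi * \<xi> $ j) ^ (\<N> j T \<omega> - \<N> j (grid T n (Suc k)) \<omega>))) \<partial>\<Omega>)"
proof -
  define cnt where "cnt y l = (\<Sum>j\<in>UNIV. y (j, grid T n l))" for y :: "'n \<times> real \<Rightarrow> nat" and l
  define g where "g y = of_bool (\<forall>l<2^n. cnt y (Suc l) \<le> cnt y l + 1)
      * real (y (i, grid T n (Suc k)) - y (i, grid T n k))" for y :: "'n \<times> real \<Rightarrow> nat"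
  define \<phi> where "\<phi> y l = (\<Sum>j\<in>UNIV. 2 * pi * \<xi> $ j * real (y (j, grid T n (Suc l)) - y (j, grid T n l)))"
    for y :: "'n \<times> real \<Rightarrow> nat" and l
  \<comment> \<open>On \<open>single\<close> the walk increment is the sign times \<open>dN\<close>.
    So \<open>dN\<close> can be moved into the weight g, free of signs, and cell k keeps the factor
    \<open>B + C * s\<close> besides its phase.\<close>
  define h where "h l y s = cis (- (real_of_int s * \<phi> y l)) * (if l = k then B + C * of_int s else 1)" for l y s
  have g0: "0 \<le> grid T n l" for l using T by (simp add: grid_nonneg)
  have P: "Measurable.pred noise_space (\<lambda>y. \<forall>l<2^n. cnt y (Suc l) \<le> cnt y l + 1)"
    unfolding cnt_def by (rule single_path_measurable[OF T])
  have gm: "g \<in> borel_measurable noise_space"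
    unfolding g_def by (intro borel_measurable_times borel_measurable_of_bool P
        borel_measurable_nat_diff noise_space_component g0)
  have \<phi>m [measurable]: "(\<lambda>y. \<phi> y l) \<in> borel_measurable noise_space" for l
    unfolding \<phi>_def by (intro borel_measurable_sum borel_measurable_times borel_measurable_const
        borel_measurable_nat_diff noise_space_component g0)
  have hm: "(\<lambda>y. h l y s) \<in> borel_measurable noise_space" for l s
    unfolding h_def by (cases "l = k") (simp_all, measurable)
  have dN: "has_bochner_integral \<Omega> dN (2 * (grid T n (Suc k) - grid T n k))"
    unfolding dN_def using T by (intro increment_mean g0 grid_mono) auto
  have gY: "g (noise_path \<omega>) = of_bool (single T n \<omega>) * dN \<omega>" for \<omega>
    by (simp add: g_def cnt_def single_noise_path[OF T] dN_def g0)
  note [measurable] = single_measurable[OF T, of n]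
  have ig: "integrable \<Omega> (\<lambda>\<omega>. g (noise_path \<omega>))"
    unfolding gY
    by (rule Bochner_Integration.integrable_bound[of _ dN]) (use dN in \<open>auto simp: has_bochner_integral_iff\<close>)
  have hB: "cmod (h l y s) \<le> 1 + cmod B + cmod C" if "\<bar>s\<bar> \<le> 1" for l y s
  proof -
    have "cmod (C * of_int s) \<le> cmod C * 1"
      unfolding norm_mult using that by (intro mult_left_mono) auto
    then have "cmod (B + C * of_int s) \<le> cmod B + cmod C"
      using norm_triangle_ineq[of B "C * of_int s"] by simp
    then show ?thesis by (auto simp: h_def norm_mult)
  qed
  have cY: "cnt (noise_path \<omega>) l = (total_noise (grid T n l) \<omega>)" for \<omega> l
    by (simp add: cnt_def g0)
  have \<phi>Y: "\<phi> (noise_path \<omega>) l = (\<Sum>j\<in>UNIV. 2 * pi * \<xi> $ j * real (increment T n j l \<omega>))" for \<omega> l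
    by (simp add: \<phi>_def g0)
  have mono: "\<N> j (grid T n l) \<omega> \<le> \<N> j (grid T n (Suc l)) \<omega>" if "\<omega> \<in> space \<Omega>" for \<omega> j l
    using T by (intro noise_mono that g0 grid_mono) auto
  have \<phi>0: "\<phi> (noise_path \<omega>) l = 0" if "\<omega> \<in> space \<Omega>" "cnt (noise_path \<omega>) (Suc l) = cnt (noise_path \<omega>) l" for \<omega> l
  proof -
    have e: "(total_noise (grid T n (Suc l)) \<omega>)
        = total_noise (grid T n l) \<omega> + (\<Sum>j\<in>UNIV. increment T n j l \<omega>)"
      unfolding sum.distrib[symmetric] using mono[OF that(1)] by (intro sum.cong) auto
    have "(\<Sum>j\<in>UNIV. increment T n j l \<omega>) = 0"
      by (rule add_eq_self_zero[OF trans[OF e[symmetric] that(2)[unfolded cY]]])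
    then show ?thesis unfolding \<phi>Y by (intro cell_average(3)) (simp_all only: zero_le_one)
  qed
  \<comment> \<open>When \<open>dN\<close> is nonzero the total count changes in cell k, so the
    factor of this cell is not among those set to 1. When \<open>dN\<close> is zero both sides
    vanish through g.\<close>
  have jump_k: "cnt (noise_path \<omega>) (Suc k) \<noteq> cnt (noise_path \<omega>) k" if "\<omega> \<in> space \<Omega>" "dN \<omega> \<noteq> 0" for \<omega>
  proof -
    have "\<N> i (grid T n k) \<omega> < \<N> i (grid T n (Suc k)) \<omega>"
      using that(2) mono[OF that(1), of i k] by (auto simp: dN_def)
    then have "total_noise (grid T n k) \<omega> < (total_noise (grid T n (Suc k)) \<omega>)"
      using mono[OF that(1)] by (intro sum_strict_mono_ex1 ballI bexI[of _ i]) auto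
    then show ?thesis by (simp add: cY)
  qed
  have \<phi>k: "\<phi> (noise_path \<omega>) k = 2 * pi * \<xi> $ i" if "\<omega> \<in> space \<Omega>" "dN \<omega> \<noteq> 0" "single T n \<omega>" for \<omega>
    unfolding \<phi>Y
  proof (rule cell_average(2))
    have "(total_noise (grid T n (Suc k)) \<omega>)
        = total_noise (grid T n k) \<omega> + (\<Sum>j\<in>UNIV. increment T n j k \<omega>)"
      unfolding sum.distrib[symmetric] using mono[OF that(1)] by (intro sum.cong) auto
    then show "(\<Sum>j\<in>UNIV. increment T n j k \<omega>) \<le> 1"
      using that(3) k unfolding single_def by fastforce
    show "increment T n i k \<omega> \<noteq> 0" using that(2) by (simp add: dN_def)
  qed
  let ?lhs = "\<lambda>\<omega>. of_bool (single T n \<omega>) * (character (W (grid T n k) \<omega> - W T \<omega>) \<xi>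
        * (B * complex_of_real (dN \<omega>) + C * of_int (dW \<omega>)))"
  let ?s = "\<lambda>\<omega> l. \<tau> (cnt (noise_path \<omega>) (Suc l)) \<omega>"
  have lhs: "?lhs \<omega> = complex_of_real (g (noise_path \<omega>)) * (\<Prod>l\<in>{k..<2^n}.
        if cnt (noise_path \<omega>) (Suc l) = cnt (noise_path \<omega>) l then 1
        else h l (noise_path \<omega>) (?s \<omega> l))" if \<omega>: "\<omega> \<in> space \<Omega>" for \<omega>
  proof (cases "single T n \<omega>")
    case True
    have dW: "dW \<omega> = ?s \<omega> k * (int (\<N> i (grid T n (Suc k)) \<omega>) - int (\<N> i (grid T n k) \<omega>))"
      unfolding dW_def cY using True k T unfolding single_def
      by (intro walk_increment_single counting \<omega> g0 grid_mono) auto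
    have "real_of_int (dW \<omega>) = real_of_int (?s \<omega> k) * dN \<omega>"
      unfolding dW using mono[OF \<omega>] by (simp add: dN_def of_nat_diff)
    then have dW': "complex_of_int (dW \<omega>) = of_int (?s \<omega> k) * complex_of_real (dN \<omega>)"
      by (metis of_real_mult of_real_of_int_eq)
    show ?thesis
    proof (cases "dN \<omega> = 0")
      case True
      then show ?thesis by (simp add: dW' gY)
    next
      case False
      have "(\<Prod>l\<in>{k..<2^n}. if cnt (noise_path \<omega>) (Suc l) = cnt (noise_path \<omega>) l then 1
          else h l (noise_path \<omega>) (?s \<omega> l))
        = (\<Prod>l\<in>{k..<2^n}. cis (- (real_of_int (?s \<omega> l) * \<phi> (noise_path \<omega>) l)) * (if l = k then B + C * of_int (?s \<omega> l) else 1))"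
        using \<phi>0[OF \<omega>] jump_k[OF \<omega> False] by (intro prod.cong refl) (auto simp: h_def)
      also have "\<dots> = character (W (grid T n k) \<omega> - W T \<omega>) \<xi> * (B + C * of_int (?s \<omega> k))"
        unfolding character_walk_increment[OF T \<omega> True less_imp_le[OF k]] \<phi>Y cY
        using k by (simp add: prod.distrib)
      finally show ?thesis using True by (simp add: gY dW' algebra_simps)
    qed
  qed (simp add: gY)
  have rhs: "complex_of_real (g (noise_path \<omega>)) * (\<Prod>l\<in>{k..<2^n}.
        if cnt (noise_path \<omega>) (Suc l) = cnt (noise_path \<omega>) l then 1
        else (h l (noise_path \<omega>) 1 + h l (noise_path \<omega>) (-1)) / 2)
    = (B * complex_of_real (cos (2 * pi * \<xi> $ i)) - \<i> * C * complex_of_real (sin (2 * pi * \<xi> $ i)))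
      * complex_of_real (of_bool (single T n \<omega>) * (dN \<omega> *
          (\<Prod>j\<in>UNIV. cos (2 * pi * \<xi> $ j) ^ (\<N> j T \<omega> - \<N> j (grid T n (Suc k)) \<omega>))))"
    if \<omega>: "\<omega> \<in> space \<Omega>" for \<omega>
  proof (cases "single T n \<omega> \<and> dN \<omega> \<noteq> 0")
    case True
    have avg: "(h l (noise_path \<omega>) 1 + h l (noise_path \<omega>) (-1)) / 2 = complex_of_real (cos (\<phi> (noise_path \<omega>) l))"
      if "l \<noteq> k" for l
      using that by (simp add: h_def complex_eq_iff)
    have avgk: "(h k (noise_path \<omega>) 1 + h k (noise_path \<omega>) (-1)) / 2
       = B * complex_of_real (cos (2 * pi * \<xi> $ i)) - \<i> * C * complex_of_real (sin (2 * pi * \<xi> $ i))"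
      using True \<phi>k[OF \<omega>] by (simp add: h_def complex_eq_iff field_simps)
    have "{k..<2^n} = insert k {Suc k..<2^n}" using k by auto
    then have "(\<Prod>l\<in>{k..<2^n}. if cnt (noise_path \<omega>) (Suc l) = cnt (noise_path \<omega>) l then 1
        else (h l (noise_path \<omega>) 1 + h l (noise_path \<omega>) (-1)) / 2)
      = (h k (noise_path \<omega>) 1 + h k (noise_path \<omega>) (-1)) / 2 *
        (\<Prod>l\<in>{Suc k..<2^n}. if cnt (noise_path \<omega>) (Suc l) = cnt (noise_path \<omega>) l then 1
        else (h l (noise_path \<omega>) 1 + h l (noise_path \<omega>) (-1)) / 2)"
      using jump_k[OF \<omega>] True by simp
    also have "(\<Prod>l\<in>{Suc k..<2^n}. if cnt (noise_path \<omega>) (Suc l) = cnt (noise_path \<omega>) l then 1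
        else (h l (noise_path \<omega>) 1 + h l (noise_path \<omega>) (-1)) / 2)
       = (\<Prod>l\<in>{Suc k..<2^n}. complex_of_real (cos (\<phi> (noise_path \<omega>) l)))"
      using \<phi>0[OF \<omega>] by (intro prod.cong refl) (auto simp: avg)
    also have "\<dots> = complex_of_real (\<Prod>j\<in>UNIV. cos (2 * pi * \<xi> $ j) ^ (\<N> j T \<omega> - \<N> j (grid T n (Suc k)) \<omega>))"
      using prod_cos_cells[OF T \<omega>, of n "Suc k" "\<lambda>j. 2 * pi * \<xi> $ j"] True k
      by (simp add: \<phi>Y flip: of_real_prod)
    finally show ?thesis using True by (simp add: avgk gY)
  qed (auto simp: gY)
  have "(\<integral>\<omega>. ?lhs \<omega> \<partial>\<Omega>) = (\<integral>\<omega>. complex_of_real (g (noise_path \<omega>)) * (\<Prod>l\<in>{k..<2^n}.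
        if cnt (noise_path \<omega>) (Suc l) = cnt (noise_path \<omega>) l then 1
        else h l (noise_path \<omega>) (?s \<omega> l)) \<partial>\<Omega>)"
    by (intro Bochner_Integration.integral_cong refl lhs)
  also have "\<dots> = (\<integral>\<omega>. complex_of_real (g (noise_path \<omega>)) * (\<Prod>l\<in>{k..<2^n}.
        if cnt (noise_path \<omega>) (Suc l) = cnt (noise_path \<omega>) l then 1
        else (h l (noise_path \<omega>) 1 + h l (noise_path \<omega>) (-1)) / 2) \<partial>\<Omega>)"
    unfolding cnt_def by (rule sign_average[OF T gm ig hm hB]) auto
  also have "\<dots> = (\<integral>\<omega>. (B * complex_of_real (cos (2 * pi * \<xi> $ i)) - \<i> * C * complex_of_real (sin (2 * pi * \<xi> $ i)))
      * complex_of_real (of_bool (single T n \<omega>) * (dN \<omega> *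
          (\<Prod>j\<in>UNIV. cos (2 * pi * \<xi> $ j) ^ (\<N> j T \<omega> - \<N> j (grid T n (Suc k)) \<omega>)))) \<partial>\<Omega>)"
    by (intro Bochner_Integration.integral_cong refl rhs)
  also have "\<dots> = (B * complex_of_real (cos (2 * pi * \<xi> $ i)) - \<i> * C * complex_of_real (sin (2 * pi * \<xi> $ i)))
      * complex_of_real (\<integral>\<omega>. of_bool (single T n \<omega>) * (dN \<omega> *
          (\<Prod>j\<in>UNIV. cos (2 * pi * \<xi> $ j) ^ (\<N> j T \<omega> - \<N> j (grid T n (Suc k)) \<omega>))) \<partial>\<Omega>)"
    by (simp only: integral_mult_right_zero integral_complex_of_real)
  finally show ?thesis .
qed

text \<open>The same averaging without a weight on cell k. It serves the compensator, and here cell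
  k takes part in the cosines like all later cells.\<close>

lemma expectation_character:
  fixes \<xi> :: "real ^ 'n"
  assumes T: "0 < T" and k: "k < 2 ^ n"
  shows "(\<integral>\<omega>. of_bool (single T n \<omega>) * character (W (grid T n k) \<omega> - W T \<omega>) \<xi> \<partial>\<Omega>)
    = complex_of_real (\<integral>\<omega>. of_bool (single T n \<omega>) *
          (\<Prod>j\<in>UNIV. cos (2 * pi * \<xi> $ j) ^ (\<N> j T \<omega> - \<N> j (grid T n k) \<omega>)) \<partial>\<Omega>)"
proof -
  define cnt where "cnt y l = (\<Sum>j\<in>UNIV. y (j, grid T n l))" for y :: "'n \<times> real \<Rightarrow> nat" and l
  define g where "g y = (of_bool (\<forall>l<2^n. cnt y (Suc l) \<le> cnt y l + 1) :: real)" for y :: "'n \<times> real \<Rightarrow> nat"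
  define \<phi> where "\<phi> y l = (\<Sum>j\<in>UNIV. 2 * pi * \<xi> $ j * real (y (j, grid T n (Suc l)) - y (j, grid T n l)))"
    for y :: "'n \<times> real \<Rightarrow> nat" and l
  define h where "h l y s = cis (- (real_of_int s * \<phi> y l))" for l :: nat and y s
  have g0: "0 \<le> grid T n l" for l using T by (simp add: grid_nonneg)
  have P: "Measurable.pred noise_space (\<lambda>y. \<forall>l<2^n. cnt y (Suc l) \<le> cnt y l + 1)"
    unfolding cnt_def by (rule single_path_measurable[OF T])
  have gm: "g \<in> borel_measurable noise_space"
    unfolding g_def by (intro borel_measurable_times borel_measurable_of_bool P
        borel_measurable_nat_diff noise_space_component g0)
  have \<phi>m [measurable]: "(\<lambda>y. \<phi> y l) \<in> borel_measurable noise_space" for l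
    unfolding \<phi>_def by (intro borel_measurable_sum borel_measurable_times borel_measurable_const
        borel_measurable_nat_diff noise_space_component g0)
  have hm: "(\<lambda>y. h l y s) \<in> borel_measurable noise_space" for l s
    unfolding h_def by measurable
  have gY: "g (noise_path \<omega>) = of_bool (single T n \<omega>)" for \<omega>
    by (simp add: g_def cnt_def single_noise_path[OF T])
  note [measurable] = single_measurable[OF T, of n]
  have ig: "integrable \<Omega> (\<lambda>\<omega>. g (noise_path \<omega>))"
    unfolding gY by (rule Bochner_Integration.integrable_bound[of _ "\<lambda>_. 1 :: real"]) auto
  have cY: "cnt (noise_path \<omega>) l = (total_noise (grid T n l) \<omega>)" for \<omega> l
    by (simp add: cnt_def g0)
  have \<phi>Y: "\<phi> (noise_path \<omega>) l = (\<Sum>j\<in>UNIV. 2 * pi * \<xi> $ j * real (increment T n j l \<omega>))" for \<omega> l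
    by (simp add: \<phi>_def g0)
  have mono: "\<N> j (grid T n l) \<omega> \<le> \<N> j (grid T n (Suc l)) \<omega>" if "\<omega> \<in> space \<Omega>" for \<omega> j l
    using T by (intro noise_mono that g0 grid_mono) auto
  have \<phi>0: "\<phi> (noise_path \<omega>) l = 0" if "\<omega> \<in> space \<Omega>" "cnt (noise_path \<omega>) (Suc l) = cnt (noise_path \<omega>) l" for \<omega> l
  proof -
    have e: "(total_noise (grid T n (Suc l)) \<omega>)
        = total_noise (grid T n l) \<omega> + (\<Sum>j\<in>UNIV. increment T n j l \<omega>)"
      unfolding sum.distrib[symmetric] using mono[OF that(1)] by (intro sum.cong) auto
    have "(\<Sum>j\<in>UNIV. increment T n j l \<omega>) = 0"
      by (rule add_eq_self_zero[OF trans[OF e[symmetric] that(2)[unfolded cY]]])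
    then show ?thesis unfolding \<phi>Y by (intro cell_average(3)) (simp_all only: zero_le_one)
  qed
  let ?s = "\<lambda>\<omega> l. \<tau> (cnt (noise_path \<omega>) (Suc l)) \<omega>"
  have "(\<integral>\<omega>. of_bool (single T n \<omega>) * character (W (grid T n k) \<omega> - W T \<omega>) \<xi> \<partial>\<Omega>)
     = (\<integral>\<omega>. complex_of_real (g (noise_path \<omega>)) * (\<Prod>l\<in>{k..<2^n}.
        if cnt (noise_path \<omega>) (Suc l) = cnt (noise_path \<omega>) l then 1
        else h l (noise_path \<omega>) (?s \<omega> l)) \<partial>\<Omega>)"
  proof (intro Bochner_Integration.integral_cong refl)
    fix \<omega> assume \<omega>: "\<omega> \<in> space \<Omega>"
    show "of_bool (single T n \<omega>) * character (W (grid T n k) \<omega> - W T \<omega>) \<xi>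
      = complex_of_real (g (noise_path \<omega>)) * (\<Prod>l\<in>{k..<2^n}.
        if cnt (noise_path \<omega>) (Suc l) = cnt (noise_path \<omega>) l then 1
        else h l (noise_path \<omega>) (?s \<omega> l))"
    proof (cases "single T n \<omega>")
      case True
      have "(\<Prod>l\<in>{k..<2^n}. if cnt (noise_path \<omega>) (Suc l) = cnt (noise_path \<omega>) l then 1
          else h l (noise_path \<omega>) (?s \<omega> l))
        = (\<Prod>l\<in>{k..<2^n}. cis (- (real_of_int (?s \<omega> l) * \<phi> (noise_path \<omega>) l)))"
        using \<phi>0[OF \<omega>] by (intro prod.cong refl) (auto simp: h_def)
      then show ?thesis
        unfolding character_walk_increment[OF T \<omega> True less_imp_le[OF k]] \<phi>Y cY using True by (simp add: gY)
    qed (simp add: gY)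
  qed
  also have "\<dots> = (\<integral>\<omega>. complex_of_real (g (noise_path \<omega>)) * (\<Prod>l\<in>{k..<2^n}.
        if cnt (noise_path \<omega>) (Suc l) = cnt (noise_path \<omega>) l then 1
        else (h l (noise_path \<omega>) 1 + h l (noise_path \<omega>) (-1)) / 2) \<partial>\<Omega>)"
    unfolding cnt_def by (rule sign_average[OF T gm ig hm, where B = 1]) (auto simp: h_def)
  also have "\<dots> = (\<integral>\<omega>. complex_of_real (of_bool (single T n \<omega>) *
          (\<Prod>j\<in>UNIV. cos (2 * pi * \<xi> $ j) ^ (\<N> j T \<omega> - \<N> j (grid T n k) \<omega>))) \<partial>\<Omega>)"
  proof (intro Bochner_Integration.integral_cong refl)
    fix \<omega> assume \<omega>: "\<omega> \<in> space \<Omega>"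
    show "complex_of_real (g (noise_path \<omega>)) * (\<Prod>l\<in>{k..<2^n}.
        if cnt (noise_path \<omega>) (Suc l) = cnt (noise_path \<omega>) l then 1
        else (h l (noise_path \<omega>) 1 + h l (noise_path \<omega>) (-1)) / 2)
      = complex_of_real (of_bool (single T n \<omega>) *
          (\<Prod>j\<in>UNIV. cos (2 * pi * \<xi> $ j) ^ (\<N> j T \<omega> - \<N> j (grid T n k) \<omega>)))"
    proof (cases "single T n \<omega>")
      case True
      have avg: "(h l (noise_path \<omega>) 1 + h l (noise_path \<omega>) (-1)) / 2 = complex_of_real (cos (\<phi> (noise_path \<omega>) l))" for l
        by (simp add: h_def complex_eq_iff)
      have "(\<Prod>l\<in>{k..<2^n}. if cnt (noise_path \<omega>) (Suc l) = cnt (noise_path \<omega>) l then 1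
          else (h l (noise_path \<omega>) 1 + h l (noise_path \<omega>) (-1)) / 2)
         = (\<Prod>l\<in>{k..<2^n}. complex_of_real (cos (\<phi> (noise_path \<omega>) l)))"
        using \<phi>0[OF \<omega>] by (intro prod.cong refl) (auto simp: avg)
      also have "\<dots> = complex_of_real (\<Prod>j\<in>UNIV. cos (2 * pi * \<xi> $ j) ^ (\<N> j T \<omega> - \<N> j (grid T n k) \<omega>))"
        using prod_cos_cells[OF T \<omega> True less_imp_le[OF k], of "\<lambda>j. 2 * pi * \<xi> $ j"]
        by (simp add: \<phi>Y flip: of_real_prod)
      finally show ?thesis using True by (simp add: gY)
    qed (simp add: gY)
  qed
  finally show ?thesis by (simp only: integral_complex_of_real)
qed

section \<open>Riemann sums in Fourier space\<close>


text \<open>Where the total count is 0 the increment vanishes, so \<open>\<tau> 0\<close>, which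
  need not be measurable, can be replaced by 0.\<close>

lemma sign_total_measurable:
  assumes "0 \<le> s" "0 \<le> t" "s \<le> t"
  shows "(\<lambda>\<omega>. real_of_int (\<tau> (total_noise t \<omega>) \<omega>) * real_of_int (int (\<N> i t \<omega>) - int (\<N> i s \<omega>)))
    \<in> borel_measurable \<Omega>"
proof -
  have m: "(\<lambda>\<omega>. (if m = 0 then 0 else real_of_int (\<tau> m \<omega>)) * real (\<N> i t \<omega> - \<N> i s \<omega>)) \<in> borel_measurable \<Omega>" for m
  proof (cases "m = 0")
    case False
    then have "\<tau> m \<in> measurable \<Omega> (count_space UNIV)" by (intro sign_measurable) simp
    then have "(\<lambda>\<omega>. real_of_int (\<tau> m \<omega>)) \<in> borel_measurable \<Omega>"
      by (rule measurable_compose) simp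
    with False show ?thesis
      using assms by (auto intro!: borel_measurable_times borel_measurable_nat_diff noise_measurable)
  qed simp
  have "(\<lambda>\<omega>. (if total_noise t \<omega> = 0 then 0 else real_of_int (\<tau> (total_noise t \<omega>) \<omega>)) * real (\<N> i t \<omega> - \<N> i s \<omega>))
      \<in> borel_measurable \<Omega>"
    by (rule measurable_compose_countable[OF m total_measurable[OF assms(2)]])
  also have "?this \<longleftrightarrow> ?thesis"
  proof (rule measurable_cong)
    fix \<omega> assume \<omega>: "\<omega> \<in> space \<Omega>"
    have "real (\<N> i t \<omega> - \<N> i s \<omega>) = real_of_int (int (\<N> i t \<omega>) - int (\<N> i s \<omega>))"
      using noise_mono[OF \<omega> assms(1,3), of i] by (simp add: of_nat_diff)
    then show "(if total_noise t \<omega> = 0 then 0 else real_of_int (\<tau> (total_noise t \<omega>) \<omega>)) * real (\<N> i t \<omega> - \<N> i s \<omega>)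
      = real_of_int (\<tau> (total_noise t \<omega>) \<omega>) * real_of_int (int (\<N> i t \<omega>) - int (\<N> i s \<omega>))"
      by auto
  qed
  finally show ?thesis .
qed

lemma walk_component_measurable:
  assumes "0 \<le> t"
  shows "(\<lambda>\<omega>. real_of_int (W t \<omega> $ i)) \<in> borel_measurable \<Omega>"
proof (cases "t = 0")
  case True
  have "(\<lambda>\<omega>. 0 :: real) \<in> borel_measurable \<Omega>" by simp
  also have "?this \<longleftrightarrow> ?thesis"
    by (rule measurable_cong) (simp add: True walk_0[of \<N>, OF counting])
  finally show ?thesis .
next
  case False
  with assms have t: "0 < t" by simp
  show ?thesis
  proof (rule borel_measurable_LIMSEQ_real)
    show "(\<lambda>\<omega>. \<Sum>k<2^n. real_of_int (\<tau> (\<Sum>j\<in>UNIV. \<N> j (grid t n (Suc k)) \<omega>) \<omega>)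
            * real_of_int (int (\<N> i (grid t n (Suc k)) \<omega>) - int (\<N> i (grid t n k) \<omega>))) \<in> borel_measurable \<Omega>" for n
      using t by (intro borel_measurable_sum sign_total_measurable grid_nonneg grid_mono) auto
  qed (rule walk_approx[OF counting t])
qed

lemma walk_measurable:
  assumes "0 \<le> t"
  shows "W t \<in> measurable \<Omega> (count_space UNIV)"
proof (subst measurable_count_space_eq2_countable, intro conjI ballI)
  fix v :: "int ^ 'n"
  have [measurable]: "(\<lambda>\<omega>. real_of_int (W t \<omega> $ i)) \<in> borel_measurable \<Omega>" for i
    by (rule walk_component_measurable[OF assms])
  have "W t -` {v} \<inter> space \<Omega> = {\<omega>\<in>space \<Omega>. \<forall>i. real_of_int (W t \<omega> $ i) = real_of_int (v $ i)}"
    by (auto simp: vec_eq_iff)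
  also have "\<dots> \<in> events" by measurable
  finally show "W t -` {v} \<inter> space \<Omega> \<in> events" .
qed auto

lemma character_walk_measurable:
  assumes "0 \<le> s" "0 \<le> t"
  shows "(\<lambda>\<omega>. character (W s \<omega> - W t \<omega>) \<xi>) \<in> borel_measurable \<Omega>"
  by (rule measurable_compose_countable[OF _ walk_measurable[OF assms(1)]],
      rule measurable_compose[OF walk_measurable[OF assms(2)]]) simp

text \<open>The exceptional set depends on the signs alone, so one null set serves all times and
  directions.\<close>

lemma AE_walk_bound:
  "AE \<omega> in \<Omega>. \<forall>i s t. 0 \<le> s \<longrightarrow> s \<le> t \<longrightarrow>
     \<bar>real_of_int (W t \<omega> $ i) - real_of_int (W s \<omega> $ i)\<bar> \<le> real (\<N> i t \<omega> - \<N> i s \<omega>)"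
  using AE_sign AE_space
proof eventually_elim
  case (elim \<omega>)
  have sign: "\<bar>\<tau> k \<omega>\<bar> \<le> 1" if "1 \<le> k" for k
    using elim(1) that by (auto dest: spec[of _ k])
  show ?case
  proof (intro allI impI)
    fix i :: 'n and s t :: real assume st: "0 \<le> s" "s \<le> t"
    have "\<bar>W t \<omega> $ i - W s \<omega> $ i\<bar> \<le> int (\<N> i t \<omega>) - int (\<N> i s \<omega>)"
      using elim by (intro walk_increment_bound counting st sign)
    then have "real_of_int \<bar>W t \<omega> $ i - W s \<omega> $ i\<bar> \<le> real_of_int (int (\<N> i t \<omega>) - int (\<N> i s \<omega>))"
      by (simp only: of_int_le_iff)
    then show "\<bar>real_of_int (W t \<omega> $ i) - real_of_int (W s \<omega> $ i)\<bar> \<le> real (\<N> i t \<omega> - \<N> i s \<omega>)"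
      using noise_mono[OF elim(2) st, of i] by (simp add: of_nat_diff)
  qed
qed

section \<open>Riemann sums at a fixed frequency\<close>

definition cell_term :: "complex \<Rightarrow> complex \<Rightarrow> real \<Rightarrow> 'n \<Rightarrow> nat \<Rightarrow> nat \<Rightarrow> 'w \<Rightarrow> complex" where
  "cell_term b c T i n k \<omega> =
     b * complex_of_real (real (increment T n i k \<omega>))
     + c * of_int (W (grid T n (Suc k)) \<omega> $ i - W (grid T n k) \<omega> $ i)"

text \<open>The contribution of frequency \<xi> to the n-th Riemann sum of the transform started at
  \<open>x - W T\<close>, with the transform of f and \<open>character x\<close> taken out. The
  exponential comes from the heat extension, and the subtracted term compensates the intensity
  2.\<close>

definition riemann :: "('n \<Rightarrow> complex) \<Rightarrow> ('n \<Rightarrow> complex) \<Rightarrow> real \<Rightarrow> real ^ 'n \<Rightarrow> nat \<Rightarrow> 'w \<Rightarrow> complex" where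
  "riemann B C T \<xi> n \<omega> = 1/2 * (\<Sum>i\<in>UNIV. \<Sum>k<2^n.
     complex_of_real (exp (- (T - grid T n k) * neg_laplacian_symbol \<xi>)) *
       (character (W (grid T n k) \<omega> - W T \<omega>) \<xi> *
         (cell_term (B i) (C i) T i n k \<omega> - B i * complex_of_real (2 * (T / 2 ^ n)))))"

text \<open>A majorant of all Riemann sums, independent of n: walk increments are at most noise
  increments, these add up to the noise at T, and the compensators add up to 2 T.\<close>

definition noise_bound :: "('n \<Rightarrow> complex) \<Rightarrow> ('n \<Rightarrow> complex) \<Rightarrow> real \<Rightarrow> 'w \<Rightarrow> real" where
  "noise_bound B C T \<omega> = (\<Sum>i\<in>UNIV. (cmod (B i) + cmod (C i)) * real (\<N> i T \<omega>) + cmod (B i) * (2 * T))"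

lemma integrable_noise:
  assumes "0 \<le> T" shows "integrable \<Omega> (\<lambda>\<omega>. real (\<N> i T \<omega>))"
proof -
  have "integrable \<Omega> (\<lambda>\<omega>. real (\<N> i T \<omega> - \<N> i 0 \<omega>))"
    using increment_mean[of 0 T i] assms by (simp add: has_bochner_integral_iff)
  then show ?thesis
    by (rule Bochner_Integration.integrable_cong[THEN iffD1, rotated 2]) (auto simp: noise_0)
qed

lemma integrable_noise_bound: "0 \<le> T \<Longrightarrow> integrable \<Omega> (noise_bound B C T)"
  unfolding noise_bound_def[abs_def]
  by (intro Bochner_Integration.integrable_sum Bochner_Integration.integrable_add integrable_mult_right integrable_noise integrable_const)

lemma cell_term_measurable:
  assumes "0 < T" shows "cell_term b c T i n k \<in> borel_measurable \<Omega>"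
proof -
  have [measurable]: "(\<lambda>\<omega>. real (increment T n i k \<omega>)) \<in> borel_measurable \<Omega>"
    using assms by (intro borel_measurable_nat_diff noise_measurable grid_nonneg) auto
  have w [measurable]: "(\<lambda>\<omega>. real_of_int (W (grid T n k) \<omega> $ i)) \<in> borel_measurable \<Omega>" for k
    using assms by (intro walk_component_measurable grid_nonneg) auto
  have eq: "cell_term b c T i n k = (\<lambda>\<omega>. b * complex_of_real (real (increment T n i k \<omega>))
     + c * complex_of_real (real_of_int (W (grid T n (Suc k)) \<omega> $ i) - real_of_int (W (grid T n k) \<omega> $ i)))"
    by (simp add: cell_term_def fun_eq_iff)
  show ?thesis unfolding eq by measurable
qed

lemma cmod_cell_term_le:
  assumes "0 < T"
    and "\<And>s t. 0 \<le> s \<Longrightarrow> s \<le> t \<Longrightarrow>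
     \<bar>real_of_int (W t \<omega> $ i) - real_of_int (W s \<omega> $ i)\<bar> \<le> real (\<N> i t \<omega> - \<N> i s \<omega>)"
  shows "cmod (cell_term b c T i n k \<omega>) \<le> (cmod b + cmod c) * real (increment T n i k \<omega>)"
proof -
  let ?d = "real (increment T n i k \<omega>)"
  let ?w = "W (grid T n (Suc k)) \<omega> $ i - W (grid T n k) \<omega> $ i"
  have "cmod (complex_of_int ?w) = \<bar>real_of_int (W (grid T n (Suc k)) \<omega> $ i) - real_of_int (W (grid T n k) \<omega> $ i)\<bar>"
    by (metis norm_of_int of_int_diff)
  also have "\<dots> \<le> ?d" using assms(1) by (intro assms(2) grid_nonneg grid_mono) auto
  finally have "cmod (c * of_int ?w) \<le> cmod c * ?d"
    unfolding norm_mult by (intro mult_left_mono) auto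
  moreover have "cmod (b * complex_of_real ?d) = cmod b * ?d" by (simp add: norm_mult)
  ultimately show ?thesis
    unfolding cell_term_def using norm_triangle_ineq[of "b * complex_of_real ?d" "c * of_int ?w"]
    by (simp only: distrib_right)
qed

lemma sum_noise_increments:
  assumes "0 < T" "\<omega> \<in> space \<Omega>"
  shows "(\<Sum>k<2^n. real (increment T n i k \<omega>)) = real (\<N> i T \<omega>)"
proof -
  have "(\<Sum>k\<in>{0..<2^n}. increment T n i k \<omega>) = \<N> i (grid T n (2^n)) \<omega> - \<N> i (grid T n 0) \<omega>"
    using assms by (intro sum_increments_nat(2)) (auto intro!: noise_mono grid_nonneg grid_mono)
  then have "(\<Sum>k<2^n. increment T n i k \<omega>) = \<N> i T \<omega>"
    using assms(2) by (simp add: noise_0 atLeast0LessThan)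
  then show ?thesis by (metis of_nat_sum)
qed

lemma exp_grid_le_1: "0 < T \<Longrightarrow> k \<le> 2^n \<Longrightarrow> exp (- (T - grid T n k) * neg_laplacian_symbol \<xi>) \<le> 1"
  using grid_le[of T k n] neg_laplacian_symbol_nonneg[of \<xi>] by (simp add: mult_nonpos_nonneg)

lemma cmod_riemann_le:
  assumes T: "0 < T" and \<omega>: "\<omega> \<in> space \<Omega>"
    and walk: "\<And>i s t. 0 \<le> s \<Longrightarrow> s \<le> t \<Longrightarrow>
     \<bar>real_of_int (W t \<omega> $ i) - real_of_int (W s \<omega> $ i)\<bar> \<le> real (\<N> i t \<omega> - \<N> i s \<omega>)"
  shows "cmod (riemann B C T \<xi> n \<omega>) \<le> noise_bound B C T \<omega>"
proof -
  let ?S = "\<Sum>i\<in>UNIV. \<Sum>k<2^n.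
     complex_of_real (exp (- (T - grid T n k) * neg_laplacian_symbol \<xi>)) *
       (character (W (grid T n k) \<omega> - W T \<omega>) \<xi> *
         (cell_term (B i) (C i) T i n k \<omega> - B i * complex_of_real (2 * (T / 2 ^ n))))"
  have "cmod ?S \<le> (\<Sum>i\<in>UNIV. \<Sum>k<2^n.
      (cmod (B i) + cmod (C i)) * real (increment T n i k \<omega>)
       + cmod (B i) * (2 * (T / 2^n)))"
  proof (intro order_trans[OF norm_sum] sum_mono)
    fix i :: 'n and k :: nat assume k: "k \<in> {..<2^n}"
    let ?t = "cell_term (B i) (C i) T i n k \<omega> - B i * complex_of_real (2 * (T / 2 ^ n))"
    have "cmod (complex_of_real (exp (- (T - grid T n k) * neg_laplacian_symbol \<xi>)) *
       (character (W (grid T n k) \<omega> - W T \<omega>) \<xi> * ?t))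
      = exp (- (T - grid T n k) * neg_laplacian_symbol \<xi>) * cmod ?t"
      by (simp add: norm_mult)
    also have "\<dots> \<le> 1 * cmod ?t"
      using k T by (intro mult_right_mono exp_grid_le_1) auto
    also have "\<dots> \<le> cmod (cell_term (B i) (C i) T i n k \<omega>) + cmod (B i * complex_of_real (2 * (T / 2 ^ n)))"
      using norm_triangle_ineq4 by simp
    also have "cmod (B i * complex_of_real (2 * (T / 2 ^ n))) = cmod (B i) * (2 * (T / 2^n))"
      unfolding norm_mult norm_of_real using T by simp
    also note cmod_cell_term_le[OF T walk]
    finally show "cmod (complex_of_real (exp (- (T - grid T n k) * neg_laplacian_symbol \<xi>)) *
       (character (W (grid T n k) \<omega> - W T \<omega>) \<xi> * ?t))
      \<le> (cmod (B i) + cmod (C i)) * real (increment T n i k \<omega>)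
       + cmod (B i) * (2 * (T / 2^n))" by simp
  qed
  also have "\<dots> = noise_bound B C T \<omega>"
    unfolding noise_bound_def sum.distrib sum_distrib_left[symmetric] sum_noise_increments[OF T \<omega>] by simp
  finally have "cmod ?S \<le> noise_bound B C T \<omega>" .
  moreover have "cmod (riemann B C T \<xi> n \<omega>) = 1/2 * cmod ?S"
    unfolding riemann_def norm_mult by simp
  ultimately show ?thesis using norm_ge_zero[of ?S] by linarith
qed

lemma AE_cmod_riemann_le:
  assumes "0 < T"
  shows "AE \<omega> in \<Omega>. \<forall>n \<xi>. cmod (riemann B C T \<xi> n \<omega>) \<le> noise_bound B C T \<omega>"
  using AE_walk_bound AE_space by eventually_elim (auto intro!: cmod_riemann_le assms)

lemma riemann_measurable: "0 < T \<Longrightarrow> riemann B C T \<xi> n \<in> borel_measurable \<Omega>"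
  unfolding riemann_def
  by (intro borel_measurable_times borel_measurable_sum borel_measurable_diff borel_measurable_const
      character_walk_measurable cell_term_measurable grid_nonneg) auto

lemma integrable_riemann:
  assumes "0 < T" shows "integrable \<Omega> (riemann B C T \<xi> n)"
proof (rule Bochner_Integration.integrable_bound)
  show "integrable \<Omega> (noise_bound B C T)" using assms by (intro integrable_noise_bound) simp
  show "AE \<omega> in \<Omega>. norm (riemann B C T \<xi> n \<omega>) \<le> norm (noise_bound B C T \<omega>)"
    using AE_cmod_riemann_le[OF assms, of B C] by eventually_elim (auto intro: order_trans[OF _ abs_ge_self])
qed (rule riemann_measurable[OF assms])

lemma integrable_cell_term:
  assumes T: "0 < T" shows "integrable \<Omega> (cell_term b c T i n k)"
proof (rule Bochner_Integration.integrable_bound)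
  show "integrable \<Omega> (\<lambda>\<omega>. (cmod b + cmod c) * real (increment T n i k \<omega>))"
    using increment_mean[of "grid T n k" "grid T n (Suc k)" i] T
    by (auto simp: has_bochner_integral_iff grid_nonneg grid_mono)
  show "AE \<omega> in \<Omega>. norm (cell_term b c T i n k \<omega>) \<le> norm ((cmod b + cmod c) * real (increment T n i k \<omega>))"
    using AE_walk_bound by eventually_elim (use cmod_cell_term_le[OF T] in \<open>auto simp: abs_mult\<close>)
qed (rule cell_term_measurable[OF T])


text \<open>The Poisson generating functions at the cosines multiply to the symbol of the heat
  semigroup: with intensity 2 and fair signs, the Laplacian is the generator of the walk.\<close>

lemma exp_sum_cos:
  "exp (\<Sum>j\<in>UNIV. 2 * t * (cos (2 * pi * \<xi> $ j) - 1)) = exp (- t * neg_laplacian_symbol \<xi>)"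
  unfolding neg_laplacian_symbol_def sum_distrib_left by (intro arg_cong[where f = exp] sum.cong refl) (simp add: algebra_simps)

lemma cmod_expectation_le:
  fixes f :: "'w \<Rightarrow> complex"
  assumes "integrable \<Omega> g" "AE \<omega> in \<Omega>. cmod (f \<omega>) \<le> g \<omega>"
  shows "cmod (\<integral>\<omega>. f \<omega> \<partial>\<Omega>) \<le> (\<integral>\<omega>. g \<omega> \<partial>\<Omega>)"
proof -
  have "(\<integral>\<omega>. cmod (f \<omega>) \<partial>\<Omega>) \<le> (\<integral>\<omega>. g \<omega> \<partial>\<Omega>)"
    using assms(2) by (intro integral_mono_AE' assms(1)) (auto elim: eventually_mono intro: order_trans[OF norm_ge_zero])
  then show ?thesis using integral_norm_bound[of \<Omega> f] by linarith
qed

text \<open>The expectation of the Riemann sum if the condition of at most one jump per cell is ignored.\<close>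

definition riemann_main :: "('n \<Rightarrow> complex) \<Rightarrow> ('n \<Rightarrow> complex) \<Rightarrow> real \<Rightarrow> real ^ 'n \<Rightarrow> nat \<Rightarrow> complex" where
  "riemann_main B C T \<xi> n = 1/2 * (\<Sum>i\<in>UNIV. \<Sum>k<2^n.
     complex_of_real (exp (- (T - grid T n k) * neg_laplacian_symbol \<xi>)) *
       ((B i * complex_of_real (cos (2 * pi * \<xi> $ i)) - \<i> * C i * complex_of_real (sin (2 * pi * \<xi> $ i)))
          * complex_of_real (2 * (T / 2 ^ n) * exp (- (T - grid T n (Suc k)) * neg_laplacian_symbol \<xi>))
        - B i * complex_of_real (2 * (T / 2 ^ n)) * complex_of_real (exp (- (T - grid T n k) * neg_laplacian_symbol \<xi>))))"

text \<open>Averaging over the signs leaves Poisson expectations restricted to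
  \<open>single\<close>. Dropping the restriction makes them explicit and costs the remainders
  \<open>ra\<close> and \<open>rb\<close>, which live where some cell has two jumps; bounding the
  cosines by 1, these add up to the mean of \<open>noise_bound\<close> there.\<close>

lemma expectation_riemann_single:
  assumes T: "0 < T"
  shows "cmod ((\<integral>\<omega>. of_bool (single T n \<omega>) * riemann B C T \<xi> n \<omega> \<partial>\<Omega>) - riemann_main B C T \<xi> n)
    \<le> (\<integral>\<omega>. noise_bound B C T \<omega> * of_bool (\<not> single T n \<omega>) \<partial>\<Omega>)"
proof -
  define h where "h = T / 2 ^ n"
  define L where "L = neg_laplacian_symbol \<xi>"
  define e where "e k = exp (- (T - grid T n k) * L)" for k
  define dN where "dN i k \<omega> = real (increment T n i k \<omega>)" for i k \<omega>
  define P where "P k \<omega> = (\<Prod>j\<in>UNIV. cos (2 * pi * \<xi> $ j) ^ (\<N> j T \<omega> - \<N> j (grid T n k) \<omega>))" for k \<omega>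
  define s where "s \<omega> = (of_bool (single T n \<omega>) :: real)" for \<omega>
  define q where "q i = B i * complex_of_real (cos (2 * pi * \<xi> $ i)) - \<i> * C i * complex_of_real (sin (2 * pi * \<xi> $ i))" for i
  define ns where "ns \<omega> = (of_bool (\<not> single T n \<omega>) :: real)" for \<omega>
  define X where "X k \<omega> = character (W (grid T n k) \<omega> - W T \<omega>) \<xi>" for k \<omega>
  define ra where "ra i k = (\<integral>\<omega>. ns \<omega> * (dN i k \<omega> * P (Suc k) \<omega>) \<partial>\<Omega>)" for i k
  define rb where "rb k = (\<integral>\<omega>. ns \<omega> * P k \<omega> \<partial>\<Omega>)" for k
  have h: "0 < h" using T by (simp add: h_def)
  have sm [measurable]: "s \<in> borel_measurable \<Omega>" "ns \<in> borel_measurable \<Omega>"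
    unfolding s_def ns_def using single_measurable[OF T, of n]
    by (auto intro!: borel_measurable_of_bool pred_intros_logic)
  have dNi: "integrable \<Omega> (dN i k)" for i k
    using increment_mean[of "grid T n k" "grid T n (Suc k)" i] T
    by (simp add: dN_def[abs_def] has_bochner_integral_iff grid_nonneg grid_mono)
  have dN0: "0 \<le> dN i k \<omega>" for i k \<omega> by (simp add: dN_def)
  have P1: "\<bar>P k \<omega>\<bar> \<le> 1" for k \<omega>
    unfolding P_def abs_prod power_abs by (intro prod_le_1 conjI power_le_one) auto
  have gk: "grid T n k \<le> T" if "k \<le> 2 ^ n" for k using that T by (intro grid_le) auto
  have aE: "has_bochner_integral \<Omega> (\<lambda>\<omega>. dN i k \<omega> * P (Suc k) \<omega>) (2 * h * e (Suc k))" if "k < 2 ^ n" for i k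
    using increments_mean_power[of "grid T n k" "grid T n (Suc k)" T i "\<lambda>j. cos (2 * pi * \<xi> $ j)"] that T gk[of "Suc k"]
    unfolding exp_sum_cos by (simp add: dN_def P_def h_def L_def e_def grid_nonneg grid_mono) (simp add: grid_Suc)
  have bE: "has_bochner_integral \<Omega> (P k) (e k)" if "k < 2 ^ n" for k
    using increments_power[of "grid T n k" T "\<lambda>j. cos (2 * pi * \<xi> $ j)"] that T gk[of k]
    unfolding exp_sum_cos by (simp add: P_def[abs_def] L_def e_def grid_nonneg)
  have bounded: "integrable \<Omega> (\<lambda>\<omega>. w \<omega> * f \<omega>)"
    if "integrable \<Omega> f" "w \<in> borel_measurable \<Omega>" "\<And>\<omega>. \<bar>w \<omega>\<bar> \<le> 1" for w f :: "'w \<Rightarrow> real"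
    by (rule Bochner_Integration.integrable_bound[OF that(1)])
       (use that in \<open>auto simp: abs_mult intro!: mult_left_le_one_le\<close>)
  have s1: "\<bar>s \<omega>\<bar> \<le> 1" "\<bar>ns \<omega>\<bar> \<le> 1" "0 \<le> ns \<omega>" "ns \<omega> \<le> 1" for \<omega> by (auto simp: s_def ns_def)
  have split: "s \<omega> = 1 - ns \<omega>" for \<omega> by (auto simp: s_def ns_def)
  have a: "(\<integral>\<omega>. s \<omega> * (dN i k \<omega> * P (Suc k) \<omega>) \<partial>\<Omega>) = 2 * h * e (Suc k) - ra i k" if "k < 2 ^ n" for i k
    unfolding split left_diff_distrib ra_def using aE[OF that] bounded[OF _ sm(2) s1(2)]
    by (subst Bochner_Integration.integral_diff) (auto simp: has_bochner_integral_iff)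
  have b: "(\<integral>\<omega>. s \<omega> * P k \<omega> \<partial>\<Omega>) = e k - rb k" if "k < 2 ^ n" for k
    unfolding split left_diff_distrib rb_def using bE[OF that] bounded[OF _ sm(2) s1(2)]
    by (subst Bochner_Integration.integral_diff) (auto simp: has_bochner_integral_iff)
  have cB: "complex_of_real (s \<omega>) = of_bool (single T n \<omega>)" for \<omega> by (simp add: s_def)
  have Xm: "X k \<in> borel_measurable \<Omega>" for k
    unfolding X_def using T by (intro character_walk_measurable grid_nonneg) auto
  have Xn: "cmod (X k \<omega>) = 1" for k \<omega> by (simp add: X_def)
  have iX: "integrable \<Omega> (\<lambda>\<omega>. complex_of_real (s \<omega>) * X k \<omega>)" for k
    by (rule Bochner_Integration.integrable_bound[of _ "\<lambda>_. 1 :: real"])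
       (use Xm s1 in \<open>auto simp: norm_mult Xn\<close>)
  have iXc: "integrable \<Omega> (\<lambda>\<omega>. complex_of_real (s \<omega>) * (X k \<omega> * cell_term (B i) (C i) T i n k \<omega>))" for i k
    by (rule Bochner_Integration.integrable_bound[OF integrable_cell_term[OF T, of "B i" "C i" i n k]])
       (use Xm s1 cell_term_measurable[OF T] in \<open>auto simp: norm_mult Xn intro!: mult_left_le_one_le\<close>)
  have "(\<integral>\<omega>. of_bool (single T n \<omega>) * riemann B C T \<xi> n \<omega> \<partial>\<Omega>)
     = (\<integral>\<omega>. 1/2 * (\<Sum>i\<in>UNIV. \<Sum>k<2^n. complex_of_real (e k) *
        (complex_of_real (s \<omega>) * (X k \<omega> * cell_term (B i) (C i) T i n k \<omega>)
          - B i * complex_of_real (2 * h) * (complex_of_real (s \<omega>) * X k \<omega>))) \<partial>\<Omega>)"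
    unfolding riemann_def cB[symmetric] X_def e_def L_def h_def
    by (intro Bochner_Integration.integral_cong refl) (simp add: sum_distrib_left algebra_simps)
  also have "\<dots> = 1/2 * (\<Sum>i\<in>UNIV. \<Sum>k<2^n. complex_of_real (e k) *
        ((\<integral>\<omega>. complex_of_real (s \<omega>) * (X k \<omega> * cell_term (B i) (C i) T i n k \<omega>) \<partial>\<Omega>)
          - B i * complex_of_real (2 * h) * (\<integral>\<omega>. complex_of_real (s \<omega>) * X k \<omega> \<partial>\<Omega>)))"
    using iX iXc by (simp add: Bochner_Integration.integral_sum del: of_real_mult)
  also have "\<dots> = 1/2 * (\<Sum>i\<in>UNIV. \<Sum>k<2^n. complex_of_real (e k) *
        (q i * complex_of_real (2 * h * e (Suc k) - ra i k)
          - B i * complex_of_real (2 * h) * complex_of_real (e k - rb k)))"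
  proof (intro arg_cong2[where f = "(*)"] arg_cong2[where f = "(-)"] sum.cong refl)
    fix i :: 'n and k :: nat assume "k \<in> {..<2^n}"
    then have k: "k < 2 ^ n" by simp
    show "(\<integral>\<omega>. complex_of_real (s \<omega>) * (X k \<omega> * cell_term (B i) (C i) T i n k \<omega>) \<partial>\<Omega>)
       = q i * complex_of_real (2 * h * e (Suc k) - ra i k)"
      unfolding a[OF k, of i, symmetric] q_def cB X_def cell_term_def expectation_character_increment[OF T k]
      by (simp add: s_def dN_def P_def)
    show "(\<integral>\<omega>. complex_of_real (s \<omega>) * X k \<omega> \<partial>\<Omega>) = complex_of_real (e k - rb k)"
      unfolding b[OF k, symmetric] cB X_def expectation_character[OF T k]
      by (simp add: s_def P_def)
  qed
  also have "\<dots> = riemann_main B C T \<xi> n + 1/2 * (\<Sum>i\<in>UNIV. \<Sum>k<2^n. complex_of_real (e k) *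
        (B i * complex_of_real (2 * h) * complex_of_real (rb k) - q i * complex_of_real (ra i k)))"
    unfolding riemann_main_def q_def[symmetric] L_def[symmetric] e_def[symmetric] h_def[symmetric]
    by (simp only: distrib_left[symmetric] sum.distrib[symmetric] of_real_diff right_diff_distrib)
       (simp add: algebra_simps)
  finally have eq: "(\<integral>\<omega>. of_bool (single T n \<omega>) * riemann B C T \<xi> n \<omega> \<partial>\<Omega>) - riemann_main B C T \<xi> n
     = 1/2 * (\<Sum>i\<in>UNIV. \<Sum>k<2^n. complex_of_real (e k) *
        (B i * complex_of_real (2 * h) * complex_of_real (rb k) - q i * complex_of_real (ra i k)))"
    by (simp only: add_diff_cancel_left')
  have qle: "cmod (q i) \<le> cmod (B i) + cmod (C i)" for i
  proof -
    have "cmod (q i) \<le> cmod (B i) * \<bar>cos (2 * pi * \<xi> $ i)\<bar> + cmod (C i) * \<bar>sin (2 * pi * \<xi> $ i)\<bar>"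
      unfolding q_def by (rule order_trans[OF norm_triangle_ineq4]) (simp add: norm_mult)
    also have "\<dots> \<le> cmod (B i) * 1 + cmod (C i) * 1"
      by (intro add_mono mult_left_mono) auto
    finally show ?thesis by simp
  qed
  have raB: "\<bar>ra i k\<bar> \<le> (\<integral>\<omega>. dN i k \<omega> * ns \<omega> \<partial>\<Omega>)" for i k
  proof -
    have "\<bar>ra i k\<bar> \<le> (\<integral>\<omega>. \<bar>ns \<omega> * (dN i k \<omega> * P (Suc k) \<omega>)\<bar> \<partial>\<Omega>)"
      unfolding ra_def using integral_norm_bound[of \<Omega> "\<lambda>\<omega>. ns \<omega> * (dN i k \<omega> * P (Suc k) \<omega>)"] by simp
    also have "\<dots> \<le> (\<integral>\<omega>. dN i k \<omega> * ns \<omega> \<partial>\<Omega>)"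
    proof (rule integral_mono')
      show "integrable \<Omega> (\<lambda>\<omega>. dN i k \<omega> * ns \<omega>)"
        using bounded[OF dNi sm(2) s1(2)] by (simp add: mult.commute)
      show "\<bar>ns \<omega> * (dN i k \<omega> * P (Suc k) \<omega>)\<bar> \<le> dN i k \<omega> * ns \<omega>" for \<omega>
        using mult_left_mono[OF P1[of "Suc k" \<omega>], of "dN i k \<omega> * ns \<omega>"] dN0[of i k \<omega>] s1(3)[of \<omega>]
        by (simp add: abs_mult mult_ac)
      show "0 \<le> dN i k \<omega> * ns \<omega>" for \<omega> using dN0[of i k \<omega>] s1(3)[of \<omega>] by simp
    qed
    finally show ?thesis .
  qed
  have rbB: "\<bar>rb k\<bar> \<le> (\<integral>\<omega>. ns \<omega> \<partial>\<Omega>)" for k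
  proof -
    have "\<bar>rb k\<bar> \<le> (\<integral>\<omega>. \<bar>ns \<omega> * P k \<omega>\<bar> \<partial>\<Omega>)"
      unfolding rb_def using integral_norm_bound[of \<Omega> "\<lambda>\<omega>. ns \<omega> * P k \<omega>"] by simp
    also have "\<dots> \<le> (\<integral>\<omega>. ns \<omega> \<partial>\<Omega>)"
    proof (rule integral_mono')
      show "integrable \<Omega> ns"
        using bounded[OF integrable_const sm(2) s1(2), of 1] by simp
      show "\<bar>ns \<omega> * P k \<omega>\<bar> \<le> ns \<omega>" for \<omega>
        using mult_left_mono[OF P1[of k \<omega>] s1(3)[of \<omega>]] s1(3)[of \<omega>] by (simp add: abs_mult)
    qed (rule s1)
    finally show ?thesis .
  qed
  have ns_i: "integrable \<Omega> ns" using bounded[OF integrable_const sm(2) s1(2), of 1] by simp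
  have dn_i: "integrable \<Omega> (\<lambda>\<omega>. dN i k \<omega> * ns \<omega>)" for i k
    using bounded[OF dNi sm(2) s1(2)] by (simp add: mult.commute)
  let ?R = "\<Sum>i\<in>UNIV. \<Sum>k<2^n. complex_of_real (e k) *
        (B i * complex_of_real (2 * h) * complex_of_real (rb k) - q i * complex_of_real (ra i k))"
  have "cmod ?R \<le> (\<Sum>i\<in>UNIV. \<Sum>k<2^n. cmod (B i) * (2 * h) * (\<integral>\<omega>. ns \<omega> \<partial>\<Omega>)
      + (cmod (B i) + cmod (C i)) * (\<integral>\<omega>. dN i k \<omega> * ns \<omega> \<partial>\<Omega>))"
  proof (intro order_trans[OF norm_sum] sum_mono)
    fix i :: 'n and k :: nat assume k: "k \<in> {..<2^n}"
    let ?t = "B i * complex_of_real (2 * h) * complex_of_real (rb k) - q i * complex_of_real (ra i k)"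
    have "cmod (complex_of_real (e k) * ?t) = e k * cmod ?t" by (simp add: norm_mult e_def)
    also have "\<dots> \<le> 1 * cmod ?t"
      unfolding e_def L_def using k T by (intro mult_right_mono exp_grid_le_1) auto
    also have "\<dots> \<le> cmod (B i * complex_of_real (2 * h) * complex_of_real (rb k)) + cmod (q i * complex_of_real (ra i k))"
      using norm_triangle_ineq4 by simp
    also have "\<dots> = cmod (B i) * (2 * h) * \<bar>rb k\<bar> + cmod (q i) * \<bar>ra i k\<bar>"
      unfolding norm_mult norm_of_real using h by simp
    also have "\<dots> \<le> cmod (B i) * (2 * h) * (\<integral>\<omega>. ns \<omega> \<partial>\<Omega>)
      + (cmod (B i) + cmod (C i)) * (\<integral>\<omega>. dN i k \<omega> * ns \<omega> \<partial>\<Omega>)"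
      using h by (intro add_mono mult_left_mono mult_mono rbB raB qle) auto
    finally show "cmod (complex_of_real (e k) * ?t) \<le> cmod (B i) * (2 * h) * (\<integral>\<omega>. ns \<omega> \<partial>\<Omega>)
      + (cmod (B i) + cmod (C i)) * (\<integral>\<omega>. dN i k \<omega> * ns \<omega> \<partial>\<Omega>)" .
  qed
  also have "\<dots> = (\<integral>\<omega>. (\<Sum>i\<in>UNIV. \<Sum>k<2^n. cmod (B i) * (2 * h) * ns \<omega>
      + (cmod (B i) + cmod (C i)) * (dN i k \<omega> * ns \<omega>)) \<partial>\<Omega>)"
    using ns_i dn_i by simp
  also have "\<dots> = (\<integral>\<omega>. noise_bound B C T \<omega> * ns \<omega> \<partial>\<Omega>)"
  proof (intro Bochner_Integration.integral_cong refl)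
    fix \<omega> assume \<omega>: "\<omega> \<in> space \<Omega>"
    have "(\<Sum>k<2^n. cmod (B i) * (2 * h) * ns \<omega> + (cmod (B i) + cmod (C i)) * (dN i k \<omega> * ns \<omega>))
      = ((cmod (B i) + cmod (C i)) * real (\<N> i T \<omega>) + cmod (B i) * (2 * T)) * ns \<omega>" for i
      unfolding sum.distrib sum_distrib_left[symmetric] sum_distrib_right[symmetric]
        sum_noise_increments[OF T \<omega>, of i n, folded dN_def]
      by (simp add: h_def algebra_simps)
    then show "(\<Sum>i\<in>UNIV. \<Sum>k<2^n. cmod (B i) * (2 * h) * ns \<omega> + (cmod (B i) + cmod (C i)) * (dN i k \<omega> * ns \<omega>))
      = noise_bound B C T \<omega> * ns \<omega>"
      unfolding noise_bound_def by (simp only: sum_distrib_right)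
  qed
  finally have "cmod ?R \<le> (\<integral>\<omega>. noise_bound B C T \<omega> * ns \<omega> \<partial>\<Omega>)" .
  moreover have "cmod ((\<integral>\<omega>. of_bool (single T n \<omega>) * riemann B C T \<xi> n \<omega> \<partial>\<Omega>) - riemann_main B C T \<xi> n) = 1/2 * cmod ?R"
    unfolding eq norm_mult by simp
  ultimately show ?thesis unfolding ns_def using norm_ge_zero[of ?R] by linarith
qed

text \<open>The heat extension and the averaged character each contribute e^(-(T - t) L), hence the
  2 in the exponent. The second is taken at the right end of the cell when it accompanies a jump,
  which causes a factor \<open>exp (T / 2 ^ n * L)\<close> tending to 1.\<close>

lemma riemann_main_tendsto:
  assumes T: "0 < T"
  shows "(\<lambda>n. riemann_main B C T \<xi> n) \<longlonglongrightarrow>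
    1/2 * (\<Sum>i\<in>UNIV. B i * two_symbol i \<xi> - C i * zero_symbol i \<xi>)
      * complex_of_real (LBINT s:{0..T}. exp (- 2 * (T - s) * neg_laplacian_symbol \<xi>))"
proof -
  define L where "L = neg_laplacian_symbol \<xi>"
  have L: "0 \<le> L" by (simp add: L_def neg_laplacian_symbol_nonneg)
  define K where "K s = exp (- 2 * (T - s) * L)" for s
  define S where "S n = (\<Sum>k<2^n. K (grid T n k) * (T / 2 ^ n))" for n
  have S: "S \<longlonglongrightarrow> (LBINT s:{0..T}. K s)"
    unfolding S_def
  proof (rule grid_sum_tendsto_lebesgue[OF T, where C = 1])
    show "\<bar>K s\<bar> \<le> 1" if "0 \<le> s" "s \<le> T" for s
      using that L by (simp add: K_def mult_nonpos_nonneg)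
    show "(K \<longlongrightarrow> K s) (at_left s)" for s
      unfolding K_def by (intro tendsto_intros)
  qed
  have h0: "(\<lambda>n. T / 2 ^ n) \<longlonglongrightarrow> 0"
    using LIMSEQ_divide_realpow_zero[of 2 T] by simp
  have eh: "(\<lambda>n. exp (T / 2 ^ n * L)) \<longlonglongrightarrow> 1"
    using tendsto_exp[OF tendsto_mult[OF h0 tendsto_const[of L]]] by simp
  define q where "q i = B i * complex_of_real (cos (2 * pi * \<xi> $ i)) - \<i> * C i * complex_of_real (sin (2 * pi * \<xi> $ i))" for i
  have eq: "riemann_main B C T \<xi> n = 1/2 * (\<Sum>i\<in>UNIV.
      2 * q i * complex_of_real (exp (T / 2 ^ n * L) * S n) - 2 * B i * complex_of_real (S n))" for n
  proof -
    have "complex_of_real (exp (- (T - grid T n k) * L)) *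
       (q i * complex_of_real (2 * (T / 2 ^ n) * exp (- (T - grid T n (Suc k)) * L))
        - B i * complex_of_real (2 * (T / 2 ^ n)) * complex_of_real (exp (- (T - grid T n k) * L)))
      = 2 * q i * complex_of_real (exp (T / 2 ^ n * L) * (K (grid T n k) * (T / 2 ^ n)))
        - 2 * B i * complex_of_real (K (grid T n k) * (T / 2 ^ n))" for i k
    proof -
      have K: "exp (- (T - grid T n k) * L) * exp (- (T - grid T n k) * L) = K (grid T n k)"
        unfolding K_def mult_exp_exp by (simp add: algebra_simps)
      have E: "exp (- (T - grid T n (Suc k)) * L) = exp (T / 2 ^ n * L) * exp (- (T - grid T n k) * L)"
        unfolding mult_exp_exp grid_Suc by (simp add: algebra_simps)
      show ?thesis
        unfolding E K[symmetric] of_real_mult by (simp add: algebra_simps)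
    qed
    then show ?thesis
      unfolding riemann_main_def q_def[symmetric] L_def[symmetric]
      by (simp only: S_def sum_subtractf sum_distrib_left of_real_sum)
  qed
  have "(\<lambda>n. riemann_main B C T \<xi> n) \<longlonglongrightarrow> 1/2 * (\<Sum>i\<in>UNIV.
      2 * q i * complex_of_real (1 * (LBINT s:{0..T}. K s)) - 2 * B i * complex_of_real (LBINT s:{0..T}. K s))"
    unfolding eq by (intro tendsto_intros tendsto_of_real S eh)
  \<comment> \<open>In the limit jump term and compensator combine to 2 q_i - 2 B_i = B_i (2 cos
    theta_i - 2) - C_i 2 i sin theta_i, which are the symbols of the second and of the symmetric
    difference.\<close>
  also have "1/2 * (\<Sum>i\<in>UNIV. 2 * q i * complex_of_real (1 * (LBINT s:{0..T}. K s)) - 2 * B i * complex_of_real (LBINT s:{0..T}. K s))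
     = 1/2 * (\<Sum>i\<in>UNIV. B i * two_symbol i \<xi> - C i * zero_symbol i \<xi>) * complex_of_real (LBINT s:{0..T}. K s)"
    unfolding sum_distrib_right mult.assoc
    by (intro arg_cong2[where f = "(*)"] refl sum.cong)
       (simp add: q_def two_symbol_eq zero_symbol_eq algebra_simps)
  finally show ?thesis unfolding K_def L_def .
qed

text \<open>The event \<open>single\<close> is removed twice, from the Poisson expectations and from
  the Riemann sum itself. Each removal costs at most the mean of \<open>noise_bound\<close> over the
  bad event, which explains the factor 2 in the error.\<close>

lemma expectation_riemann_tendsto:
  assumes T: "0 < T"
  shows "(\<lambda>n. \<integral>\<omega>. riemann B C T \<xi> n \<omega> \<partial>\<Omega>) \<longlonglongrightarrow>
    1/2 * (\<Sum>i\<in>UNIV. B i * two_symbol i \<xi> - C i * zero_symbol i \<xi>)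
      * complex_of_real (LBINT s:{0..T}. exp (- 2 * (T - s) * neg_laplacian_symbol \<xi>))"
proof -
  let ?b = "\<lambda>n. \<integral>\<omega>. noise_bound B C T \<omega> * of_bool (\<not> single T n \<omega>) \<partial>\<Omega>"
  have nb: "integrable \<Omega> (noise_bound B C T)" using T by (intro integrable_noise_bound) simp
  have b0: "?b \<longlonglongrightarrow> 0" by (rule expectation_not_single_tendsto[OF T nb])
  have sm: "(\<lambda>\<omega>. of_bool (single T n \<omega>) :: complex) \<in> borel_measurable \<Omega>"
    "(\<lambda>\<omega>. of_bool (\<not> single T n \<omega>) :: complex) \<in> borel_measurable \<Omega>"
    "(\<lambda>\<omega>. of_bool (\<not> single T n \<omega>) :: real) \<in> borel_measurable \<Omega>" for n
    using single_measurable[OF T, of n] by (auto intro!: borel_measurable_of_bool pred_intros_logic)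
  have bound: "cmod ((\<integral>\<omega>. riemann B C T \<xi> n \<omega> \<partial>\<Omega>) - riemann_main B C T \<xi> n) \<le> 2 * ?b n" for n
  proof -
    have i1: "integrable \<Omega> (\<lambda>\<omega>. of_bool (single T n \<omega>) * riemann B C T \<xi> n \<omega>)"
      "integrable \<Omega> (\<lambda>\<omega>. of_bool (\<not> single T n \<omega>) * riemann B C T \<xi> n \<omega>)"
      by (rule Bochner_Integration.integrable_bound[OF integrable_riemann[OF T, of B C \<xi> n]],
          intro borel_measurable_times sm riemann_measurable[OF T], simp add: norm_mult)+
    have "(\<integral>\<omega>. riemann B C T \<xi> n \<omega> \<partial>\<Omega>)
       = (\<integral>\<omega>. of_bool (single T n \<omega>) * riemann B C T \<xi> n \<omega> + of_bool (\<not> single T n \<omega>) * riemann B C T \<xi> n \<omega> \<partial>\<Omega>)"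
      by (intro Bochner_Integration.integral_cong refl) (simp add: of_bool_def)
    also have "\<dots> = (\<integral>\<omega>. of_bool (single T n \<omega>) * riemann B C T \<xi> n \<omega> \<partial>\<Omega>)
        + (\<integral>\<omega>. of_bool (\<not> single T n \<omega>) * riemann B C T \<xi> n \<omega> \<partial>\<Omega>)"
      by (rule Bochner_Integration.integral_add[OF i1])
    finally have eq: "(\<integral>\<omega>. riemann B C T \<xi> n \<omega> \<partial>\<Omega>) - riemann_main B C T \<xi> n
       = ((\<integral>\<omega>. of_bool (single T n \<omega>) * riemann B C T \<xi> n \<omega> \<partial>\<Omega>) - riemann_main B C T \<xi> n)
        + (\<integral>\<omega>. of_bool (\<not> single T n \<omega>) * riemann B C T \<xi> n \<omega> \<partial>\<Omega>)" by simp
    have "cmod (\<integral>\<omega>. of_bool (\<not> single T n \<omega>) * riemann B C T \<xi> n \<omega> \<partial>\<Omega>) \<le> ?b n"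
    proof (rule cmod_expectation_le)
      show "integrable \<Omega> (\<lambda>\<omega>. noise_bound B C T \<omega> * of_bool (\<not> single T n \<omega>))"
        by (rule Bochner_Integration.integrable_bound[OF nb]) (use nb sm in \<open>auto simp: abs_mult\<close>)
      show "AE \<omega> in \<Omega>. cmod (of_bool (\<not> single T n \<omega>) * riemann B C T \<xi> n \<omega>) \<le> noise_bound B C T \<omega> * of_bool (\<not> single T n \<omega>)"
        using AE_cmod_riemann_le[OF T, of B C] by eventually_elim (simp add: norm_mult)
    qed
    then show ?thesis
      unfolding eq using norm_triangle_le expectation_riemann_single[OF T, of n B C \<xi>]
      by (smt (verit) norm_triangle_ineq)
  qed
  have "(\<lambda>n. (\<integral>\<omega>. riemann B C T \<xi> n \<omega> \<partial>\<Omega>) - riemann_main B C T \<xi> n) \<longlonglongrightarrow> 0"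
    by (rule Lim_null_comparison[OF always_eventually, of _ "\<lambda>n. 2 * ?b n"])
       (use bound tendsto_mult_right_zero[OF b0, of 2] in auto)
  from tendsto_add[OF this riemann_main_tendsto[OF T, of B C \<xi>]] show ?thesis by simp
qed

end

lemma exp_integral:
  fixes L :: real
  assumes "0 < T" "L \<noteq> 0"
  shows "(LBINT s:{0..T}. exp (- 2 * (T - s) * L)) = (1 - exp (- 2 * T * L)) / (2 * L)"
proof -
  let ?F = "\<lambda>s. exp (- 2 * (T - s) * L) / (2 * L)"
  have "has_bochner_integral lborel (\<lambda>s. indicator {0..T} s *\<^sub>R exp (- 2 * (T - s) * L)) (?F T - ?F 0)"
  proof (rule has_bochner_integral_FTC_Icc)
    show "(?F has_vector_derivative exp (- 2 * (T - s) * L)) (at s within {0..T})" for s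
      unfolding has_real_derivative_iff_has_vector_derivative[symmetric]
      using assms by (auto intro!: derivative_eq_intros)
  qed (use assms in \<open>auto intro!: continuous_intros\<close>)
  then show ?thesis
    by (simp add: set_lebesgue_integral_def has_bochner_integral_iff diff_divide_distrib)
qed

section \<open>The conditional expectation\<close>

text \<open>Enumerate the values of V by \<open>to_nat\<close>. Dominated convergence gives the sum
  of the series, and the bound by the mean of |Z| gives absolute summability, which turns the
  ordered series into an unordered one.\<close>

lemma (in prob_space) has_sum_expectation:
  fixes V :: "'a \<Rightarrow> 'c::countable" and Z :: "'a \<Rightarrow> real"
  assumes V [measurable]: "V \<in> measurable M (count_space UNIV)" and Z: "integrable M Z"
  shows "((\<lambda>v. \<integral>\<omega>. Z \<omega> * indicator {\<omega>. V \<omega> = v} \<omega> \<partial>M) has_sum (\<integral>\<omega>. Z \<omega> \<partial>M)) UNIV"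
proof -
  define U where "U \<omega> = to_nat (V \<omega>)" for \<omega>
  have Um: "U \<in> measurable M (count_space UNIV)"
    unfolding U_def by (rule measurable_compose[OF V]) simp
  have ind: "(\<lambda>\<omega>. indicator {\<omega>. P (U \<omega>)} \<omega> :: real) \<in> borel_measurable M" for P
    using measurable_compose[OF Um, of "\<lambda>m. of_bool (P m) :: real" borel] by (simp add: indicator_def of_bool_def)
  have int: "integrable M (\<lambda>\<omega>. Z \<omega> * indicator {\<omega>. P (U \<omega>)} \<omega>)" for P
    by (rule Bochner_Integration.integrable_bound[OF Z])
       (use Z ind[of P] in \<open>auto simp: abs_mult indicator_def\<close>)
  define t where "t m = (\<integral>\<omega>. Z \<omega> * indicator {\<omega>. U \<omega> = m} \<omega> \<partial>M)" for m
  have part: "(\<Sum>m<N. c * indicator {\<omega>. U \<omega> = m} \<omega>) = c * indicator {\<omega>. U \<omega> < N} \<omega>"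
    for N \<omega> and c :: real
    unfolding sum_distrib_left[symmetric] by (simp add: indicator_def sum.delta)
  have sum_t: "(\<Sum>m<N. t m) = (\<integral>\<omega>. Z \<omega> * indicator {\<omega>. U \<omega> < N} \<omega> \<partial>M)" for N
    unfolding t_def part[symmetric] using int[of "\<lambda>u. u = _"] by (intro Bochner_Integration.integral_sum[symmetric]) auto
  have "(\<lambda>N. \<integral>\<omega>. Z \<omega> * indicator {\<omega>. U \<omega> < N} \<omega> \<partial>M) \<longlonglongrightarrow> (\<integral>\<omega>. Z \<omega> \<partial>M)"
  proof (rule integral_dominated_convergence[where w = "\<lambda>\<omega>. \<bar>Z \<omega>\<bar>"])
    show "AE \<omega> in M. (\<lambda>N. Z \<omega> * indicator {\<omega>. U \<omega> < N} \<omega>) \<longlonglongrightarrow> Z \<omega>"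
    proof (intro AE_I2 tendsto_eventually)
      fix \<omega>
      show "\<forall>\<^sub>F N in sequentially. Z \<omega> * indicator {\<omega>. U \<omega> < N} \<omega> = Z \<omega>"
        using eventually_gt_at_top[of "U \<omega>"] by eventually_elim simp
    qed
    show "(\<lambda>\<omega>. Z \<omega> * indicator {\<omega>. U \<omega> < N} \<omega>) \<in> borel_measurable M" for N
      using int[of "\<lambda>u. u < N"] by simp
  qed (use Z in \<open>auto simp: abs_mult indicator_def\<close>)
  then have sums: "t sums (\<integral>\<omega>. Z \<omega> \<partial>M)"
    unfolding sums_def sum_t .
  have "summable (\<lambda>m. norm (t m))"
  proof (rule summableI_nonneg_bounded)
    fix N
    have "(\<Sum>m<N. norm (t m)) \<le> (\<Sum>m<N. \<integral>\<omega>. \<bar>Z \<omega>\<bar> * indicator {\<omega>. U \<omega> = m} \<omega> \<partial>M)"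
    proof (rule sum_mono)
      fix m
      show "norm (t m) \<le> (\<integral>\<omega>. \<bar>Z \<omega>\<bar> * indicator {\<omega>. U \<omega> = m} \<omega> \<partial>M)"
        unfolding t_def using integral_norm_bound[of M "\<lambda>\<omega>. Z \<omega> * indicator {\<omega>. U \<omega> = m} \<omega>"]
        by (simp add: abs_mult)
    qed
    also have "\<dots> = (\<integral>\<omega>. \<bar>Z \<omega>\<bar> * indicator {\<omega>. U \<omega> < N} \<omega> \<partial>M)"
    proof -
      have "integrable M (\<lambda>\<omega>. \<bar>Z \<omega>\<bar> * indicator {\<omega>. U \<omega> = m} \<omega>)" for m
        using integrable_abs[OF int[of "\<lambda>u. u = m"]] by (simp add: abs_mult)
      then show ?thesis
        unfolding part[symmetric] by (intro Bochner_Integration.integral_sum[symmetric]) auto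
    qed
    also have "\<dots> \<le> (\<integral>\<omega>. \<bar>Z \<omega>\<bar> \<partial>M)"
      using Z by (intro integral_mono') (auto simp: indicator_def)
    finally show "(\<Sum>m<N. norm (t m)) \<le> (\<integral>\<omega>. \<bar>Z \<omega>\<bar> \<partial>M)" .
  qed simp
  then have "(t has_sum (\<integral>\<omega>. Z \<omega> \<partial>M)) UNIV"
    by (rule norm_summable_imp_has_sum[OF _ sums])
  \<comment> \<open>Numbers that encode no value of the type index empty events, so the sum over all
    naturals is a sum over the encoded values.\<close>
  moreover have "t m = 0" if "m \<notin> range (to_nat :: 'c \<Rightarrow> nat)" for m
  proof -
    have "U \<omega> \<noteq> m" for \<omega> using that by (auto simp: U_def)
    then show ?thesis by (simp add: t_def)
  qed
  ultimately have "(t has_sum (\<integral>\<omega>. Z \<omega> \<partial>M)) (range (to_nat :: 'c \<Rightarrow> nat))"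
    by (subst has_sum_cong_neutral[where T = UNIV and g = t]) auto
  then have "((t \<circ> to_nat) has_sum (\<integral>\<omega>. Z \<omega> \<partial>M)) (UNIV :: 'c set)"
    by (subst (asm) has_sum_reindex) auto
  then show ?thesis
    by (simp add: t_def[abs_def] U_def comp_def inj_eq[OF inj_to_nat])
qed

section \<open>Symbols attached to a matrix\<close>

definition matrix_symbol_two :: "real ^ 'n ^ 'n \<Rightarrow> real ^ 'n \<Rightarrow> 'n::finite \<Rightarrow> complex" where
  "matrix_symbol_two A \<xi> i = (\<Sum>j\<in>UNIV. complex_of_real (A $ i $ j) * two_symbol j \<xi>)"

definition matrix_symbol_zero :: "real ^ 'n ^ 'n \<Rightarrow> real ^ 'n \<Rightarrow> 'n::finite \<Rightarrow> complex" where
  "matrix_symbol_zero A \<xi> i = (\<Sum>j\<in>UNIV. complex_of_real (A $ i $ j) * zero_symbol j \<xi>)"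

definition matrix_riesz_symbol :: "real ^ 'n ^ 'n \<Rightarrow> real ^ 'n \<Rightarrow> complex" where
  "matrix_riesz_symbol A \<xi> = (\<Sum>i\<in>UNIV. \<Sum>j\<in>UNIV. complex_of_real (A $ i $ j) * riesz_symbol i j (\<xi> :: real ^ 'n::finite))"

text \<open>A bound on both matrix symbols that is uniform in the frequency. It is complex so that
  it can be inserted into \<open>noise_bound\<close>, which then gives one majorant for all
  frequencies.\<close>

definition row_bound :: "real ^ 'n ^ 'n \<Rightarrow> 'n::finite \<Rightarrow> complex" where
  "row_bound A i = complex_of_real (\<Sum>j\<in>UNIV. \<bar>A $ i $ j\<bar> * 4)"

lemma cmod_matrix_symbol_le:
  "cmod (matrix_symbol_two A \<xi> i) \<le> cmod (row_bound A i)"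
  "cmod (matrix_symbol_zero A \<xi> i) \<le> cmod (row_bound A i)"
proof -
  have r: "cmod (row_bound A i) = (\<Sum>j\<in>UNIV. \<bar>A $ i $ j\<bar> * 4)"
    unfolding row_bound_def norm_of_real by (intro abs_of_nonneg sum_nonneg) simp
  show "cmod (matrix_symbol_two A \<xi> i) \<le> cmod (row_bound A i)"
    unfolding r matrix_symbol_two_def
    by (intro order_trans[OF norm_sum] sum_mono) (simp add: norm_mult mult_left_mono cmod_two_symbol_le)
  show "cmod (matrix_symbol_zero A \<xi> i) \<le> cmod (row_bound A i)"
    unfolding r matrix_symbol_zero_def
    by (intro order_trans[OF norm_sum] sum_mono) (simp add: norm_mult mult_left_mono cmod_zero_symbol_le)
qed

lemma matrix_symbol_measurable [measurable]:
  "(\<lambda>\<xi>. matrix_symbol_two A \<xi> i) \<in> borel_measurable torus"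
  "(\<lambda>\<xi>. matrix_symbol_zero A \<xi> i) \<in> borel_measurable torus"
  unfolding matrix_symbol_two_def matrix_symbol_zero_def by measurable

text \<open>The time integral is (1 - e^(-2TL)) / (2L); with the prefactor 1/2 it meets exactly the
  4L in the denominator of \<open>riesz_symbol_eq\<close>. Where L = 0 all difference symbols vanish
  and both sides are 0.\<close>

lemma matrix_riesz_symbol_eq:
  assumes "0 < T"
  shows "1/2 * (\<Sum>i\<in>UNIV. matrix_symbol_two A \<xi> i * two_symbol i \<xi> - matrix_symbol_zero A \<xi> i * zero_symbol i \<xi>)
      * complex_of_real (LBINT s:{0..T}. exp (- 2 * (T - s) * neg_laplacian_symbol \<xi>))
    = - (complex_of_real (1 - exp (- 2 * T * neg_laplacian_symbol \<xi>)) * matrix_riesz_symbol A \<xi>)"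
proof (cases "neg_laplacian_symbol \<xi> = 0")
  case True
  have "two_symbol i \<xi> = 0" "zero_symbol i \<xi> = 0" for i
    using cmod_two_symbol_le(1)[of i \<xi>] cmod_zero_symbol_le(1)[of i \<xi>] True by auto
  then show ?thesis using True by simp
next
  case False
  have "(\<Sum>i\<in>UNIV. matrix_symbol_two A \<xi> i * two_symbol i \<xi> - matrix_symbol_zero A \<xi> i * zero_symbol i \<xi>)
     = (\<Sum>i\<in>UNIV. \<Sum>j\<in>UNIV. complex_of_real (A $ i $ j) * (two_symbol i \<xi> * two_symbol j \<xi> - zero_symbol i \<xi> * zero_symbol j \<xi>))"
    unfolding matrix_symbol_two_def matrix_symbol_zero_def sum_distrib_right sum_subtractf[symmetric]
    by (intro sum.cong refl) (simp add: algebra_simps)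
  also have "\<dots> = (\<Sum>i\<in>UNIV. \<Sum>j\<in>UNIV. - complex_of_real (4 * neg_laplacian_symbol \<xi>) * (complex_of_real (A $ i $ j) * riesz_symbol i j \<xi>))"
    using False by (intro sum.cong refl) (simp add: riesz_symbol_eq field_simps)
  also have "\<dots> = - complex_of_real (4 * neg_laplacian_symbol \<xi>) * matrix_riesz_symbol A \<xi>"
    unfolding matrix_riesz_symbol_def sum_distrib_left ..
  finally show ?thesis
    using False unfolding exp_integral[OF assms False] by (simp add: field_simps)
qed

lemma matrix_riesz_symbol_measurable [measurable]: "matrix_riesz_symbol A \<in> borel_measurable torus"
  unfolding matrix_riesz_symbol_def by measurable

lemma cmod_matrix_riesz_symbol_le: "cmod (matrix_riesz_symbol A \<xi>) \<le> (\<Sum>i\<in>UNIV. \<Sum>j\<in>UNIV. \<bar>A $ i $ j\<bar>)"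
  unfolding matrix_riesz_symbol_def
  by (intro order_trans[OF norm_sum] sum_mono)
     (simp add: norm_mult mult_left_le cmod_riesz_symbol_le)

section \<open>The transform started from the random point that leads to x\<close>

context walk_noise
begin

context
  fixes f :: "int ^ 'n \<Rightarrow> real" and A :: "real ^ 'n ^ 'n" and T :: real and x :: "int ^ 'n" and F
  assumes f: "in_l2 f" and T: "0 < T"
  defines "F \<equiv> fourier (\<lambda>y. complex_of_real (f y))"
begin

abbreviation "B \<equiv> matrix_symbol_two A"
abbreviation "C \<equiv> matrix_symbol_zero A"

text \<open>The start is chosen after the noise so that the walk ends at x. Conditioning on the end
  point is thereby turned into an ordinary expectation over the noise.\<close>

definition endpoint_transform :: "'w \<Rightarrow> real" where
  "endpoint_transform \<omega> = mtransform \<N> \<tau> A f T (x - W T \<omega>) T \<omega>"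

definition endpoint_approx :: "nat \<Rightarrow> 'w \<Rightarrow> real" where
  "endpoint_approx n \<omega> = 1/2 * (\<Sum>i\<in>UNIV. \<Sum>k<2^n.
      (A *v grad_two (heat (T - grid T n k) f) (x + (W (grid T n k) \<omega> - W T \<omega>))) $ i
        * (real (increment T n i k \<omega>) - 2 * (T / 2 ^ n))
      + (A *v grad_zero (heat (T - grid T n k) f) (x + (W (grid T n k) \<omega> - W T \<omega>))) $ i
        * real_of_int (W (grid T n (Suc k)) \<omega> $ i - W (grid T n k) \<omega> $ i))"

lemma endpoint_approx_tendsto:
  assumes \<omega>: "\<omega> \<in> space \<Omega>"
  shows "(\<lambda>n. endpoint_approx n \<omega>) \<longlonglongrightarrow> endpoint_transform \<omega>"
proof -
  have w: "walk \<N> \<tau> (x - W T \<omega>) t \<omega> = x + (W t \<omega> - W T \<omega>)" for t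
    using walk_translate[of \<N> \<omega>, OF counting[OF \<omega>], of \<tau> "x - W T \<omega>" t] by (simp add: algebra_simps)
  have N: "real (increment T n i k \<omega>) = real (\<N> i (grid T n (Suc k)) \<omega>) - real (\<N> i (grid T n k) \<omega>)" for i n k
    using noise_mono[OF \<omega>, of "grid T n k" "grid T n (Suc k)" i] T by (simp add: grid_nonneg grid_mono of_nat_diff)
  show ?thesis
    using mtransform_approx[of \<N> \<omega>, OF counting[OF \<omega>] f T, of A \<tau> "x - W T \<omega>"]
    unfolding endpoint_transform_def endpoint_approx_def w N by simp
qed

lemma F_square_integrable: "square_integrable torus F"
  unfolding F_def using is_fourierD(1)[OF is_fourier_fourier[OF in_l2_of_real[OF f]]] .

lemma F_measurable [measurable]: "F \<in> borel_measurable torus"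
  using F_square_integrable by (simp add: square_integrable_def)

lemma F_integrable: "integrable torus (\<lambda>\<xi>. cmod (F \<xi>))"
  using torus.square_integrable_imp_integrable_complex[OF F_square_integrable] by simp

lemma matrix_grad_eq_integral:
  assumes "0 \<le> t"
  shows "complex_of_real ((A *v grad_two (heat t f) y) $ i)
      = (\<integral>\<xi>. (B \<xi> i * complex_of_real (exp (- t * neg_laplacian_symbol \<xi>))) * F \<xi> * character y \<xi> \<partial>torus)"
    and "complex_of_real ((A *v grad_zero (heat t f) y) $ i)
      = (\<integral>\<xi>. (C \<xi> i * complex_of_real (exp (- t * neg_laplacian_symbol \<xi>))) * F \<xi> * character y \<xi> \<partial>torus)"
proof -
  have *: "(\<Sum>j\<in>UNIV. complex_of_real (A $ i $ j) * (\<integral>\<xi>. (s j \<xi> * complex_of_real (exp (- t * neg_laplacian_symbol \<xi>))) * F \<xi> * character y \<xi> \<partial>torus))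
      = (\<integral>\<xi>. ((\<Sum>j\<in>UNIV. complex_of_real (A $ i $ j) * s j \<xi>) * complex_of_real (exp (- t * neg_laplacian_symbol \<xi>))) * F \<xi> * character y \<xi> \<partial>torus)"
    if [measurable]: "\<And>j. s j \<in> borel_measurable torus" and s: "\<And>j \<xi>. cmod (s j \<xi>) \<le> 4" for s :: "'n \<Rightarrow> _"
  proof -
    have int: "integrable torus (\<lambda>\<xi>. (s j \<xi> * complex_of_real (exp (- t * neg_laplacian_symbol \<xi>))) * F \<xi> * character y \<xi>)" for j
    proof (rule torus_integrable_mult[OF F_square_integrable, where B = "4 * 1"])
      fix \<xi> :: "real ^ 'n"
      show "cmod (s j \<xi> * complex_of_real (exp (- t * neg_laplacian_symbol \<xi>))) \<le> 4 * 1"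
        unfolding norm_mult using assms neg_laplacian_symbol_nonneg[of \<xi>]
        by (intro mult_mono s) (auto simp: mult_nonneg_nonneg)
    qed measurable
    have "(\<Sum>j\<in>UNIV. complex_of_real (A $ i $ j) * (\<integral>\<xi>. (s j \<xi> * complex_of_real (exp (- t * neg_laplacian_symbol \<xi>))) * F \<xi> * character y \<xi> \<partial>torus))
      = (\<integral>\<xi>. (\<Sum>j\<in>UNIV. complex_of_real (A $ i $ j) * ((s j \<xi> * complex_of_real (exp (- t * neg_laplacian_symbol \<xi>))) * F \<xi> * character y \<xi>)) \<partial>torus)"
      using int by (simp add: Bochner_Integration.integral_sum)
    then show ?thesis by (simp only: sum_distrib_right mult.assoc)
  qed
  show "complex_of_real ((A *v grad_two (heat t f) y) $ i)
      = (\<integral>\<xi>. (B \<xi> i * complex_of_real (exp (- t * neg_laplacian_symbol \<xi>))) * F \<xi> * character y \<xi> \<partial>torus)"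
    unfolding matrix_symbol_two_def
    by (subst *[symmetric]) (auto simp: cmod_two_symbol_le matrix_vector_mult_def grad_two_def diff_heat_eq_integral(1)[OF f assms] F_def)
  show "complex_of_real ((A *v grad_zero (heat t f) y) $ i)
      = (\<integral>\<xi>. (C \<xi> i * complex_of_real (exp (- t * neg_laplacian_symbol \<xi>))) * F \<xi> * character y \<xi> \<partial>torus)"
    unfolding matrix_symbol_zero_def
    by (subst *[symmetric]) (auto simp: cmod_zero_symbol_le matrix_vector_mult_def grad_zero_def diff_heat_eq_integral(2)[OF f assms] F_def)
qed

text \<open>At the grid points the walk is at x plus W_t - W_T, and the character splits
  accordingly. The sums are finite, so the identity holds on every single path.\<close>

lemma endpoint_approx_eq_integral:
  "complex_of_real (endpoint_approx n \<omega>)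
    = (\<integral>\<xi>. riemann (B \<xi>) (C \<xi>) T \<xi> n \<omega> * F \<xi> * character x \<xi> \<partial>torus)"
proof -
  let ?e = "\<lambda>k \<xi>. complex_of_real (exp (- (T - grid T n k) * neg_laplacian_symbol \<xi>))"
  let ?v = "\<lambda>k. W (grid T n k) \<omega> - W T \<omega>"
  let ?dN = "\<lambda>i k. complex_of_real (real (increment T n i k \<omega>) - 2 * (T / 2 ^ n))"
  let ?dW = "\<lambda>i k. complex_of_int (W (grid T n (Suc k)) \<omega> $ i - W (grid T n k) \<omega> $ i)"
  have t0: "0 \<le> T - grid T n k" if "k < 2 ^ n" for k using grid_le[of T k n] T that by simp
  have int: "integrable torus (\<lambda>\<xi>. (b \<xi> * ?e k \<xi>) * F \<xi> * character y \<xi>)"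
    if [measurable]: "b \<in> borel_measurable torus" and b: "\<And>\<xi>. cmod (b \<xi>) \<le> M" and k: "k < 2 ^ n" for b M k y
  proof (rule torus_integrable_mult[OF F_square_integrable, where B = "M * 1"])
    fix \<xi> :: "real ^ 'n"
    have "0 \<le> M" using b[of 0] norm_ge_zero order_trans by blast
    then show "cmod (b \<xi> * ?e k \<xi>) \<le> M * 1"
      unfolding norm_mult using exp_grid_le_1[OF T less_imp_le[OF k], of \<xi>] by (intro mult_mono b) auto
  qed measurable
  have i2: "integrable torus (\<lambda>\<xi>. (B \<xi> i * ?e k \<xi>) * F \<xi> * character y \<xi>)" if "k < 2 ^ n" for i k y
    by (rule int[OF _ cmod_matrix_symbol_le(1) that]) measurable
  have i0: "integrable torus (\<lambda>\<xi>. (C \<xi> i * ?e k \<xi>) * F \<xi> * character y \<xi>)" if "k < 2 ^ n" for i k y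
    by (rule int[OF _ cmod_matrix_symbol_le(2) that]) measurable
  have "complex_of_real (endpoint_approx n \<omega>) = 1/2 * (\<Sum>i\<in>UNIV. \<Sum>k<2^n.
     (\<integral>\<xi>. (B \<xi> i * ?e k \<xi>) * F \<xi> * character (x + ?v k) \<xi> \<partial>torus) * ?dN i k
     + (\<integral>\<xi>. (C \<xi> i * ?e k \<xi>) * F \<xi> * character (x + ?v k) \<xi> \<partial>torus) * ?dW i k)"
    unfolding endpoint_approx_def of_real_mult of_real_sum of_real_add
    by (intro arg_cong2[where f = "(*)"] sum.cong refl)
       (simp_all add: matrix_grad_eq_integral[OF t0])
  also have "\<dots> = 1/2 * (\<Sum>i\<in>UNIV. \<Sum>k<2^n.
     (\<integral>\<xi>. (B \<xi> i * ?e k \<xi>) * F \<xi> * character (x + ?v k) \<xi> * ?dN i k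
      + (C \<xi> i * ?e k \<xi>) * F \<xi> * character (x + ?v k) \<xi> * ?dW i k \<partial>torus))"
    by (intro arg_cong2[where f = "(*)"] sum.cong refl)
       (simp only: lessThan_iff integral_mult_left_zero[symmetric]
          Bochner_Integration.integral_add[OF integrable_mult_left[OF i2] integrable_mult_left[OF i0]])
  also have "\<dots> = (\<integral>\<xi>. 1/2 * (\<Sum>i\<in>UNIV. \<Sum>k<2^n.
      (B \<xi> i * ?e k \<xi>) * F \<xi> * character (x + ?v k) \<xi> * ?dN i k
      + (C \<xi> i * ?e k \<xi>) * F \<xi> * character (x + ?v k) \<xi> * ?dW i k) \<partial>torus)"
    unfolding integral_mult_right_zero
    by (intro arg_cong2[where f = "(*)"] refl)
       (subst Bochner_Integration.integral_sum;
        (intro sum.cong refl Bochner_Integration.integral_sum[symmetric])?;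
        intro Bochner_Integration.integrable_sum Bochner_Integration.integrable_add integrable_mult_left i2 i0; simp)
  also have "\<dots> = (\<integral>\<xi>. riemann (B \<xi>) (C \<xi>) T \<xi> n \<omega> * F \<xi> * character x \<xi> \<partial>torus)"
    unfolding riemann_def cell_term_def character_add
    by (intro Bochner_Integration.integral_cong refl)
       (simp add: sum_distrib_left sum_distrib_right algebra_simps)
  finally show ?thesis .
qed


lemma noise_bound_mono:
  assumes "\<And>i. cmod (b i) \<le> cmod (b' i)" "\<And>i. cmod (c i) \<le> cmod (c' i)"
  shows "noise_bound b c T \<omega> \<le> noise_bound b' c' T \<omega>"
  unfolding noise_bound_def using assms T
  by (intro sum_mono add_mono mult_right_mono) auto

abbreviation "majorant \<equiv> noise_bound (row_bound A) (row_bound A) T"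

lemma AE_cmod_riemann_le_majorant:
  "AE \<omega> in \<Omega>. \<forall>n \<xi>. cmod (riemann (B \<xi>) (C \<xi>) T \<xi> n \<omega>) \<le> majorant \<omega>"
  using AE_walk_bound AE_space
  by eventually_elim
     (auto intro!: order_trans[OF cmod_riemann_le[OF T] noise_bound_mono] cmod_matrix_symbol_le)

lemma integrable_majorant: "integrable \<Omega> majorant"
  using T by (intro integrable_noise_bound) simp

text \<open>Needed for Fubini. The walk has countably many values, so the character may be treated
  with the two positions fixed; a cell term is linear in its coefficients, which separates its
  dependence on the path from that on the frequency.\<close>

lemma riemann_joint_measurable:
  "(\<lambda>p. riemann (B (snd p)) (C (snd p)) T (snd p) n (fst p)) \<in> borel_measurable (\<Omega> \<Otimes>\<^sub>M torus)"
proof -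
  have g0: "0 \<le> grid T n k" for k using T by (simp add: grid_nonneg)
  have char: "(\<lambda>p. character (W s (fst p) - W t (fst p)) (snd p)) \<in> borel_measurable (\<Omega> \<Otimes>\<^sub>M torus)"
    if "0 \<le> s" "0 \<le> t" for s t
    by (rule measurable_compose_countable[OF _ measurable_compose[OF measurable_fst walk_measurable[OF that(1)]]],
        rule measurable_compose_countable[OF _ measurable_compose[OF measurable_fst walk_measurable[OF that(2)]]],
        rule measurable_compose[OF measurable_snd]) (rule character_torus)
  have cell: "(\<lambda>p. cell_term (B (snd p) i) (C (snd p) i) T i n k (fst p)) \<in> borel_measurable (\<Omega> \<Otimes>\<^sub>M torus)" for i k
  proof -
    have 1: "cell_term 1 0 T i n k \<in> borel_measurable \<Omega>" "cell_term 0 1 T i n k \<in> borel_measurable \<Omega>"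
      by (intro cell_term_measurable T)+
    have "(\<lambda>p. B (snd p) i * cell_term 1 0 T i n k (fst p) + C (snd p) i * cell_term 0 1 T i n k (fst p)) \<in> borel_measurable (\<Omega> \<Otimes>\<^sub>M torus)"
      by (intro borel_measurable_add borel_measurable_times
          measurable_compose[OF measurable_snd matrix_symbol_measurable(1)]
          measurable_compose[OF measurable_snd matrix_symbol_measurable(2)]
          measurable_compose[OF measurable_fst 1(1)] measurable_compose[OF measurable_fst 1(2)])
    then show ?thesis by (simp add: cell_term_def)
  qed
  have e: "(\<lambda>p. complex_of_real (exp (- (T - grid T n k) * neg_laplacian_symbol (snd p)))) \<in> borel_measurable (\<Omega> \<Otimes>\<^sub>M torus)" for k
    by measurable
  show ?thesis
    unfolding riemann_def
    by (intro borel_measurable_times borel_measurable_sum borel_measurable_diff borel_measurable_const char cell e g0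
          measurable_compose[OF measurable_snd matrix_symbol_measurable(1)]) (use T in simp)
qed

text \<open>Fubini applies because the integrand is dominated by
  \<open>majorant \<omega> * cmod (F \<xi>)\<close>, a product of integrable functions of one
  variable each.\<close>

lemma expectation_endpoint_approx:
  "complex_of_real (\<integral>\<omega>. endpoint_approx n \<omega> \<partial>\<Omega>)
    = (\<integral>\<xi>. (\<integral>\<omega>. riemann (B \<xi>) (C \<xi>) T \<xi> n \<omega> \<partial>\<Omega>) * F \<xi> * character x \<xi> \<partial>torus)"
proof -
  interpret P: pair_sigma_finite \<Omega> "torus :: (real ^ 'n) measure" ..
  define g where "g \<omega> \<xi> = riemann (B \<xi>) (C \<xi>) T \<xi> n \<omega> * F \<xi> * character x \<xi>" for \<omega> \<xi>
  have gm [measurable]: "case_prod g \<in> borel_measurable (\<Omega> \<Otimes>\<^sub>M torus)"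
  proof -
    have "(\<lambda>p. riemann (B (snd p)) (C (snd p)) T (snd p) n (fst p) * F (snd p) * character x (snd p)) \<in> borel_measurable (\<Omega> \<Otimes>\<^sub>M torus)"
      by (intro borel_measurable_times riemann_joint_measurable measurable_compose[OF measurable_snd F_measurable]
          measurable_compose[OF measurable_snd character_torus])
    then show ?thesis by (simp add: g_def case_prod_beta')
  qed
  have AEg: "AE \<omega> in \<Omega>. \<forall>\<xi>. cmod (g \<omega> \<xi>) \<le> majorant \<omega> * cmod (F \<xi>)"
    using AE_cmod_riemann_le_majorant by eventually_elim (auto simp: g_def norm_mult intro!: mult_right_mono)
  have g_int: "integrable torus (g \<omega>)" if "\<omega> \<in> space \<Omega>" "\<forall>\<xi>. cmod (g \<omega> \<xi>) \<le> majorant \<omega> * cmod (F \<xi>)" for \<omega>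
  proof (rule Bochner_Integration.integrable_bound)
    show "integrable torus (\<lambda>\<xi>. majorant \<omega> * cmod (F \<xi>))" using F_integrable by simp
    show "g \<omega> \<in> borel_measurable torus" using measurable_Pair2[OF gm that(1)] by simp
    show "AE \<xi> in torus. norm (g \<omega> \<xi>) \<le> norm (majorant \<omega> * cmod (F \<xi>))"
      using that(2) by (intro AE_I2 order_trans[OF spec[OF that(2)]]) (simp add: abs_ge_self)
  qed
  have int: "integrable (\<Omega> \<Otimes>\<^sub>M torus) (case_prod g)"
  proof (rule P.Fubini_integrable[OF gm])
    show "AE \<omega> in \<Omega>. integrable torus (\<lambda>\<xi>. case_prod g (\<omega>, \<xi>))"
      using AEg AE_space by eventually_elim (simp add: g_int)
    show "integrable \<Omega> (\<lambda>\<omega>. \<integral>\<xi>. norm (case_prod g (\<omega>, \<xi>)) \<partial>torus)"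
    proof (rule Bochner_Integration.integrable_bound)
      show "integrable \<Omega> (\<lambda>\<omega>. majorant \<omega> * (\<integral>\<xi>. cmod (F \<xi>) \<partial>torus))"
        using integrable_majorant by simp
      show "(\<lambda>\<omega>. \<integral>\<xi>. norm (case_prod g (\<omega>, \<xi>)) \<partial>torus) \<in> borel_measurable \<Omega>"
        by (rule torus.borel_measurable_lebesgue_integral) (use gm in measurable)
      show "AE \<omega> in \<Omega>. norm (\<integral>\<xi>. norm (case_prod g (\<omega>, \<xi>)) \<partial>torus) \<le> norm (majorant \<omega> * (\<integral>\<xi>. cmod (F \<xi>) \<partial>torus))"
        using AEg AE_space
      proof eventually_elim
        case (elim \<omega>)
        have "(\<integral>\<xi>. cmod (g \<omega> \<xi>) \<partial>torus) \<le> (\<integral>\<xi>. majorant \<omega> * cmod (F \<xi>) \<partial>torus)"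
          using elim F_integrable by (intro integral_mono integrable_norm g_int) auto
        also have "\<dots> = majorant \<omega> * (\<integral>\<xi>. cmod (F \<xi>) \<partial>torus)" by simp
        finally show ?case by (simp add: order_trans[OF _ abs_ge_self])
      qed
    qed
  qed
  have "complex_of_real (\<integral>\<omega>. endpoint_approx n \<omega> \<partial>\<Omega>) = (\<integral>\<omega>. (\<integral>\<xi>. g \<omega> \<xi> \<partial>torus) \<partial>\<Omega>)"
    unfolding g_def endpoint_approx_eq_integral[symmetric] by (rule integral_complex_of_real[symmetric])
  also have "\<dots> = (\<integral>\<xi>. (\<integral>\<omega>. g \<omega> \<xi> \<partial>\<Omega>) \<partial>torus)"
    by (rule P.Fubini_integral[OF int, symmetric])
  also have "\<dots> = (\<integral>\<xi>. (\<integral>\<omega>. riemann (B \<xi>) (C \<xi>) T \<xi> n \<omega> \<partial>\<Omega>) * F \<xi> * character x \<xi> \<partial>torus)"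
    unfolding g_def by (simp only: integral_mult_left_zero)
  finally show ?thesis .
qed

definition endpoint_value :: complex where
  "endpoint_value = - (\<integral>\<xi>. complex_of_real (1 - exp (- 2 * T * neg_laplacian_symbol \<xi>)) * matrix_riesz_symbol A \<xi> * F \<xi> * character x \<xi> \<partial>torus)"

text \<open>For each frequency the expected Riemann sums converge, and the mean of
  \<open>majorant\<close> bounds them uniformly in frequency and n, so the limit passes under the
  integral over the torus.\<close>

lemma expectation_endpoint_approx_tendsto:
  "(\<lambda>n. complex_of_real (\<integral>\<omega>. endpoint_approx n \<omega> \<partial>\<Omega>)) \<longlonglongrightarrow> endpoint_value"
proof -
  interpret P: pair_sigma_finite "torus :: (real ^ 'n) measure" \<Omega> ..
  define E where "E n \<xi> = (\<integral>\<omega>. riemann (B \<xi>) (C \<xi>) T \<xi> n \<omega> \<partial>\<Omega>)" for n and \<xi> :: "real ^ 'n"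
  define H where "H \<xi> = - (complex_of_real (1 - exp (- 2 * T * neg_laplacian_symbol \<xi>)) * matrix_riesz_symbol A \<xi>)" for \<xi>
  have lim: "(\<lambda>n. E n \<xi>) \<longlonglongrightarrow> H \<xi>" for \<xi>
    unfolding E_def H_def matrix_riesz_symbol_eq[OF T, symmetric] by (rule expectation_riemann_tendsto[OF T])
  have Em [measurable]: "E n \<in> borel_measurable torus" for n
  proof -
    have "(\<lambda>p. riemann (B (fst p)) (C (fst p)) T (fst p) n (snd p)) \<in> borel_measurable (torus \<Otimes>\<^sub>M \<Omega>)"
      using measurable_compose[OF measurable_pair_swap' riemann_joint_measurable[of n]] by (simp add: case_prod_beta')
    then have "(\<lambda>(\<xi>, \<omega>). riemann (B \<xi>) (C \<xi>) T \<xi> n \<omega>) \<in> borel_measurable (torus \<Otimes>\<^sub>M \<Omega>)"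
      by (simp add: case_prod_beta')
    then show ?thesis unfolding E_def by (rule borel_measurable_lebesgue_integral)
  qed
  have Hm [measurable]: "H \<in> borel_measurable torus"
    unfolding H_def by measurable
  have EB: "cmod (E n \<xi>) \<le> (\<integral>\<omega>. majorant \<omega> \<partial>\<Omega>)" for n \<xi>
    unfolding E_def using AE_cmod_riemann_le_majorant
    by (intro cmod_expectation_le integrable_majorant) (auto elim: eventually_mono)
  have "(\<lambda>n. \<integral>\<xi>. E n \<xi> * F \<xi> * character x \<xi> \<partial>torus) \<longlonglongrightarrow> (\<integral>\<xi>. H \<xi> * F \<xi> * character x \<xi> \<partial>torus)"
  proof (rule integral_dominated_convergence[where w = "\<lambda>\<xi>. (\<integral>\<omega>. majorant \<omega> \<partial>\<Omega>) * cmod (F \<xi>)"])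
    show "integrable torus (\<lambda>\<xi>. (\<integral>\<omega>. majorant \<omega> \<partial>\<Omega>) * cmod (F \<xi>))" using F_integrable by simp
    show "AE \<xi> in torus. (\<lambda>n. E n \<xi> * F \<xi> * character x \<xi>) \<longlonglongrightarrow> H \<xi> * F \<xi> * character x \<xi>"
      by (intro AE_I2 tendsto_intros lim)
    show "AE \<xi> in torus. norm (E n \<xi> * F \<xi> * character x \<xi>) \<le> (\<integral>\<omega>. majorant \<omega> \<partial>\<Omega>) * cmod (F \<xi>)" for n
      by (intro AE_I2) (simp add: norm_mult mult_right_mono EB)
  qed measurable
  also have "(\<integral>\<xi>. H \<xi> * F \<xi> * character x \<xi> \<partial>torus) = endpoint_value"
    unfolding endpoint_value_def H_def integral_minus[symmetric]
    by (intro Bochner_Integration.integral_cong refl) (simp only: mult_minus_left)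
  finally show ?thesis unfolding expectation_endpoint_approx E_def .
qed

lemma AE_endpoint_approx_le:
  "AE \<omega> in \<Omega>. \<forall>n. \<bar>endpoint_approx n \<omega>\<bar> \<le> (\<integral>\<xi>. cmod (F \<xi>) \<partial>torus) * majorant \<omega>"
  using AE_cmod_riemann_le_majorant
proof eventually_elim
  case (elim \<omega>)
  show ?case
  proof
    fix n
    have "\<bar>endpoint_approx n \<omega>\<bar> = cmod (complex_of_real (endpoint_approx n \<omega>))" by simp
    also have "\<dots> \<le> (\<integral>\<xi>. majorant \<omega> * cmod (F \<xi>) \<partial>torus)"
      unfolding endpoint_approx_eq_integral
      by (rule cmod_integral_le) (use F_integrable elim in \<open>auto simp: norm_mult intro!: mult_right_mono\<close>)
    also have "\<dots> = (\<integral>\<xi>. cmod (F \<xi>) \<partial>torus) * majorant \<omega>" by simp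
    finally show "\<bar>endpoint_approx n \<omega>\<bar> \<le> (\<integral>\<xi>. cmod (F \<xi>) \<partial>torus) * majorant \<omega>" .
  qed
qed

lemma endpoint_approx_measurable: "endpoint_approx n \<in> borel_measurable \<Omega>"
proof -
  have g0: "0 \<le> grid T n k" for k using T by (simp add: grid_nonneg)
  have K: "(\<lambda>\<omega>. \<phi> (W s \<omega> - W t \<omega>)) \<in> borel_measurable \<Omega>" if "0 \<le> s" "0 \<le> t" for \<phi> :: "int ^ 'n \<Rightarrow> real" and s t
    by (rule measurable_compose_countable[OF _ walk_measurable[OF that(1)]],
        rule measurable_compose[OF walk_measurable[OF that(2)]]) simp
  have dW: "(\<lambda>\<omega>. real_of_int (W (grid T n (Suc k)) \<omega> $ i - W (grid T n k) \<omega> $ i)) \<in> borel_measurable \<Omega>" for i k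
    unfolding of_int_diff by (intro borel_measurable_diff walk_component_measurable g0)
  have "(\<lambda>\<omega>. endpoint_approx n \<omega>) \<in> borel_measurable \<Omega>"
    unfolding endpoint_approx_def
    by (intro borel_measurable_times borel_measurable_sum borel_measurable_add borel_measurable_diff borel_measurable_const dW
        borel_measurable_nat_diff noise_measurable g0
        K[of _ _ "\<lambda>v. (A *v grad_two (heat (T - grid T n _) f) (x + v)) $ _"]
        K[of _ _ "\<lambda>v. (A *v grad_zero (heat (T - grid T n _) f) (x + v)) $ _"]) (use T in auto)
  then show ?thesis .
qed

text \<open>The same Riemann sums converge on every path to the transform, under an integrable
  majorant, while their means converge to the value computed in Fourier space. Uniqueness of limits
  identifies the two.\<close>

lemma expectation_endpoint_transform:
  shows "integrable \<Omega> endpoint_transform"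
    and "complex_of_real (\<integral>\<omega>. endpoint_transform \<omega> \<partial>\<Omega>) = endpoint_value"
proof -
  let ?w = "\<lambda>\<omega>. (\<integral>\<xi>. cmod (F \<xi>) \<partial>torus) * majorant \<omega>"
  have wi: "integrable \<Omega> ?w" using integrable_majorant by simp
  have m: "endpoint_transform \<in> borel_measurable \<Omega>"
    by (rule borel_measurable_LIMSEQ_real[OF endpoint_approx_tendsto endpoint_approx_measurable])
  have lim: "AE \<omega> in \<Omega>. (\<lambda>n. endpoint_approx n \<omega>) \<longlonglongrightarrow> endpoint_transform \<omega>"
    using AE_space by eventually_elim (rule endpoint_approx_tendsto)
  have le: "AE \<omega> in \<Omega>. norm (endpoint_approx n \<omega>) \<le> ?w \<omega>" for n
    using AE_endpoint_approx_le by eventually_elim simp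
  show "integrable \<Omega> endpoint_transform"
    by (rule integrable_dominated_convergence[OF m endpoint_approx_measurable wi lim le])
  have "(\<lambda>n. \<integral>\<omega>. endpoint_approx n \<omega> \<partial>\<Omega>) \<longlonglongrightarrow> (\<integral>\<omega>. endpoint_transform \<omega> \<partial>\<Omega>)"
    by (rule integral_dominated_convergence[OF m endpoint_approx_measurable wi lim le])
  then have "(\<lambda>n. complex_of_real (\<integral>\<omega>. endpoint_approx n \<omega> \<partial>\<Omega>)) \<longlonglongrightarrow> complex_of_real (\<integral>\<omega>. endpoint_transform \<omega> \<partial>\<Omega>)"
    by (rule tendsto_of_real)
  then show "complex_of_real (\<integral>\<omega>. endpoint_transform \<omega> \<partial>\<Omega>) = endpoint_value"
    using expectation_endpoint_approx_tendsto by (rule LIMSEQ_unique)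
qed

lemma mtransform_endpoint:
  assumes "\<omega> \<in> space \<Omega>"
  shows "mtransform \<N> \<tau> A f T x0 T \<omega> * indicator {\<omega>. walk \<N> \<tau> x0 T \<omega> = x} \<omega>
    = endpoint_transform \<omega> * indicator {\<omega>. x - W T \<omega> = x0} \<omega>"
proof -
  have "walk \<N> \<tau> x0 T \<omega> = x \<longleftrightarrow> x - W T \<omega> = x0"
    using walk_translate[of \<N> \<omega>, OF counting[OF assms], of \<tau> x0 T] by (auto simp: algebra_simps)
  then show ?thesis by (auto simp: indicator_def endpoint_transform_def)
qed

text \<open>The walk from x0 ends at x exactly when x - W_T = x0, and on this event the transform
  from x0 is \<open>endpoint_transform\<close>. The sum over starting points is therefore the
  disintegration of one expectation along x - W_T; its integrability yields the existence
  claim.\<close>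

lemma cond_expect_mtransform:
  shows "cond_expect_exists \<Omega> (\<lambda>x0. mtransform \<N> \<tau> A f T x0 T) (\<lambda>x0. walk \<N> \<tau> x0 T) x"
    and "complex_of_real (cond_expect \<Omega> (\<lambda>x0. mtransform \<N> \<tau> A f T x0 T) (\<lambda>x0. walk \<N> \<tau> x0 T) x) = endpoint_value"
proof -
  have Vm: "(\<lambda>\<omega>. x - W T \<omega>) \<in> measurable \<Omega> (count_space UNIV)"
    using T by (intro measurable_compose[OF walk_measurable]) auto
  have eq: "(\<integral>\<omega>. mtransform \<N> \<tau> A f T x0 T \<omega> * indicator {\<omega>. walk \<N> \<tau> x0 T \<omega> = x} \<omega> \<partial>\<Omega>)
      = (\<integral>\<omega>. endpoint_transform \<omega> * indicator {\<omega>. x - W T \<omega> = x0} \<omega> \<partial>\<Omega>)" for x0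
    by (intro Bochner_Integration.integral_cong refl mtransform_endpoint)
  have hs: "((\<lambda>x0. \<integral>\<omega>. mtransform \<N> \<tau> A f T x0 T \<omega> * indicator {\<omega>. walk \<N> \<tau> x0 T \<omega> = x} \<omega> \<partial>\<Omega>)
      has_sum (\<integral>\<omega>. endpoint_transform \<omega> \<partial>\<Omega>)) UNIV"
    unfolding eq by (rule has_sum_expectation[OF Vm expectation_endpoint_transform(1)])
  have int: "integrable \<Omega> (\<lambda>\<omega>. mtransform \<N> \<tau> A f T x0 T \<omega> * indicator {\<omega>. walk \<N> \<tau> x0 T \<omega> = x} \<omega>)" for x0
  proof -
    have "(\<lambda>\<omega>. indicator {\<omega>. x - W T \<omega> = x0} \<omega> :: real) \<in> borel_measurable \<Omega>"
      using measurable_compose[OF Vm, of "\<lambda>v. of_bool (v = x0) :: real" borel] by (simp add: indicator_def of_bool_def)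
    then have "integrable \<Omega> (\<lambda>\<omega>. endpoint_transform \<omega> * indicator {\<omega>. x - W T \<omega> = x0} \<omega>)"
      using expectation_endpoint_transform(1)
      by (intro Bochner_Integration.integrable_bound[OF expectation_endpoint_transform(1)])
         (auto simp: abs_mult indicator_def)
    then show ?thesis
      by (rule Bochner_Integration.integrable_cong[THEN iffD2, rotated 2]) (auto intro: mtransform_endpoint)
  qed
  show "cond_expect_exists \<Omega> (\<lambda>x0. mtransform \<N> \<tau> A f T x0 T) (\<lambda>x0. walk \<N> \<tau> x0 T) x"
    unfolding cond_expect_exists_def using int hs by (auto simp: summable_on_def)
  show "complex_of_real (cond_expect \<Omega> (\<lambda>x0. mtransform \<N> \<tau> A f T x0 T) (\<lambda>x0. walk \<N> \<tau> x0 T) x) = endpoint_value"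
    unfolding cond_expect_def infsumI[OF hs] by (rule expectation_endpoint_transform(2))
qed

end

end

section \<open>The limit of large times\<close>

lemma riesz_integral_tendsto:
  fixes A :: "real ^ 'n::finite ^ 'n"
  assumes g: "square_integrable torus F"
  shows "((\<lambda>T. \<integral>\<xi>. complex_of_real (1 - exp (- 2 * T * neg_laplacian_symbol \<xi>)) * matrix_riesz_symbol A \<xi> * F \<xi> * character x \<xi> \<partial>torus)
    \<longlongrightarrow> (\<integral>\<xi>. matrix_riesz_symbol A \<xi> * F \<xi> * character x \<xi> \<partial>torus)) at_top"
proof (rule integral_dominated_convergence_at_top)
  let ?M = "\<Sum>i\<in>UNIV. \<Sum>j\<in>UNIV. \<bar>A $ i $ j\<bar>"
  have [measurable]: "F \<in> borel_measurable torus" using g by (simp add: square_integrable_def)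
  show "(\<lambda>\<xi>. complex_of_real (1 - exp (- 2 * T * neg_laplacian_symbol \<xi>)) * matrix_riesz_symbol A \<xi> * F \<xi> * character x \<xi>) \<in> borel_measurable torus" for T
    by measurable
  show "(\<lambda>\<xi>. matrix_riesz_symbol A \<xi> * F \<xi> * character x \<xi>) \<in> borel_measurable torus"
    by measurable
  show "integrable torus (\<lambda>\<xi>. ?M * cmod (F \<xi>))"
    using torus.square_integrable_imp_integrable_complex[OF g] by simp
  show "\<forall>\<^sub>F T in at_top. AE \<xi> in torus. norm (complex_of_real (1 - exp (- 2 * T * neg_laplacian_symbol \<xi>)) * matrix_riesz_symbol A \<xi> * F \<xi> * character x \<xi>)
      \<le> ?M * cmod (F \<xi>)"
    using eventually_ge_at_top[of "0 :: real"]
  proof eventually_elim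
    case (elim T)
    show ?case
    proof (rule AE_I2)
      fix \<xi> :: "real ^ 'n"
      have "\<bar>1 - exp (- 2 * T * neg_laplacian_symbol \<xi>)\<bar> \<le> 1"
        using elim neg_laplacian_symbol_nonneg[of \<xi>] by (simp add: mult_nonneg_nonneg)
      then have "\<bar>1 - exp (- 2 * T * neg_laplacian_symbol \<xi>)\<bar> * cmod (matrix_riesz_symbol A \<xi>) \<le> 1 * ?M"
        by (intro mult_mono cmod_matrix_riesz_symbol_le) auto
      then have "\<bar>1 - exp (- 2 * T * neg_laplacian_symbol \<xi>)\<bar> * cmod (matrix_riesz_symbol A \<xi>) * cmod (F \<xi>) \<le> ?M * cmod (F \<xi>)"
        by (intro mult_right_mono) auto
      then show "norm (complex_of_real (1 - exp (- 2 * T * neg_laplacian_symbol \<xi>)) * matrix_riesz_symbol A \<xi> * F \<xi> * character x \<xi>)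
        \<le> ?M * cmod (F \<xi>)"
        by (simp only: norm_mult norm_of_real norm_character mult_1_right)
    qed
  qed
  show "AE \<xi> in torus. ((\<lambda>T. complex_of_real (1 - exp (- 2 * T * neg_laplacian_symbol \<xi>)) * matrix_riesz_symbol A \<xi> * F \<xi> * character x \<xi>)
      \<longlongrightarrow> matrix_riesz_symbol A \<xi> * F \<xi> * character x \<xi>) at_top"
  proof (rule AE_I2)
    fix \<xi> :: "real ^ 'n"
    show "((\<lambda>T. complex_of_real (1 - exp (- 2 * T * neg_laplacian_symbol \<xi>)) * matrix_riesz_symbol A \<xi> * F \<xi> * character x \<xi>)
      \<longlongrightarrow> matrix_riesz_symbol A \<xi> * F \<xi> * character x \<xi>) at_top"
    proof (cases "neg_laplacian_symbol \<xi> = 0")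
      case True
      \<comment> \<open>Here the factor is 0 for all T and does not tend to 1, but the Riesz symbol
        is a quotient by 0 and hence 0 as well.\<close>
      then show ?thesis by (simp add: matrix_riesz_symbol_def riesz_symbol_def)
    next
      case False
      then have pos: "0 < 2 * neg_laplacian_symbol \<xi>" using neg_laplacian_symbol_nonneg[of \<xi>] by simp
      have "filterlim (\<lambda>T. (2 * neg_laplacian_symbol \<xi>) * T) at_top at_top"
        by (rule filterlim_tendsto_pos_mult_at_top[OF tendsto_const pos filterlim_ident])
      then have "((\<lambda>T. exp (- ((2 * neg_laplacian_symbol \<xi>) * T))) \<longlongrightarrow> 0) at_top"
        by (intro filterlim_compose[OF exp_at_bot] filterlim_compose[OF filterlim_uminus_at_bot_at_top])
      then have "((\<lambda>T. exp (- 2 * T * neg_laplacian_symbol \<xi>)) \<longlongrightarrow> 0) at_top"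
        by (simp add: mult_ac)
      then have "((\<lambda>T. complex_of_real (1 - exp (- 2 * T * neg_laplacian_symbol \<xi>)) * matrix_riesz_symbol A \<xi> * F \<xi> * character x \<xi>)
        \<longlongrightarrow> complex_of_real (1 - 0) * matrix_riesz_symbol A \<xi> * F \<xi> * character x \<xi>) at_top"
        by (intro tendsto_intros)
      then show ?thesis by simp
    qed
  qed
qed

section \<open>From matrices to combinations of second order Riesz transforms\<close>

lemma riesz2_commute: "riesz2 i j g x = riesz2 j i g x"
  by (simp add: riesz2_def algebra_simps)

text \<open>It is linear in the matrix, so \<open>comb_matrix\<close> can be compared with
  \<open>riesz2_comb\<close> one elementary matrix at a time.\<close>

definition matrix_riesz2 :: "real ^ 'n ^ 'n \<Rightarrow> (int ^ 'n::finite \<Rightarrow> complex) \<Rightarrow> int ^ 'n \<Rightarrow> complex" where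
  "matrix_riesz2 A g x = (\<Sum>i\<in>UNIV. \<Sum>j\<in>UNIV. complex_of_real (A $ i $ j) * riesz2 i j g x)"

lemma matrix_riesz2_eq_integral:
  assumes g: "in_l2 g"
  shows "matrix_riesz2 A g x = (\<integral>\<xi>. matrix_riesz_symbol A \<xi> * fourier g \<xi> * character x \<xi> \<partial>torus)"
proof -
  have int: "integrable torus (\<lambda>\<xi>. riesz_symbol i j \<xi> * fourier g \<xi> * character x \<xi>)" for i j
    by (rule torus_integrable_mult[OF is_fourierD(1)[OF is_fourier_fourier[OF g]] _ cmod_riesz_symbol_le]) measurable
  have "(\<integral>\<xi>. matrix_riesz_symbol A \<xi> * fourier g \<xi> * character x \<xi> \<partial>torus)
    = (\<integral>\<xi>. (\<Sum>i\<in>UNIV. \<Sum>j\<in>UNIV. complex_of_real (A $ i $ j) * (riesz_symbol i j \<xi> * fourier g \<xi> * character x \<xi>)) \<partial>torus)"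
    by (simp only: matrix_riesz_symbol_def sum_distrib_right mult.assoc)
  also have "\<dots> = (\<Sum>i\<in>UNIV. \<Sum>j\<in>UNIV. complex_of_real (A $ i $ j) * (\<integral>\<xi>. riesz_symbol i j \<xi> * fourier g \<xi> * character x \<xi> \<partial>torus))"
    using int by (simp add: Bochner_Integration.integral_sum)
  finally show ?thesis by (simp add: matrix_riesz2_def riesz2_eq_integral[OF g])
qed

lemma matrix_riesz2_add: "matrix_riesz2 (A + B) g x = matrix_riesz2 A g x + matrix_riesz2 B g x"
  by (simp add: matrix_riesz2_def distrib_right sum.distrib)

lemma matrix_riesz2_scaleR: "matrix_riesz2 (c *\<^sub>R A) g x = complex_of_real c * matrix_riesz2 A g x"
  by (simp add: matrix_riesz2_def sum_distrib_left mult.assoc)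

lemma matrix_riesz2_sum: "matrix_riesz2 (\<Sum>k\<in>K. A k) g x = (\<Sum>k\<in>K. matrix_riesz2 (A k) g x)"
proof (induction K rule: infinite_finite_induct)
  case (insert k K)
  then show ?case by (simp add: matrix_riesz2_add)
qed (simp_all add: matrix_riesz2_def)

lemma matrix_riesz2_outer: "matrix_riesz2 (outer (axis i 1) (axis j 1)) g x = riesz2 i j g x"
proof -
  have "matrix_riesz2 (outer (axis i 1) (axis j 1)) g x
    = (\<Sum>k\<in>UNIV. \<Sum>l\<in>UNIV. if k = i then (if l = j then riesz2 k l g x else 0) else 0)"
    unfolding matrix_riesz2_def outer_def by (intro sum.cong refl) (auto simp: axis_def)
  also have "\<dots> = (\<Sum>k\<in>UNIV. if k = i then (\<Sum>l\<in>UNIV. if l = j then riesz2 k l g x else 0) else 0)"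
    by (intro sum.cong refl) auto
  also have "\<dots> = riesz2 i j g x" by simp
  finally show ?thesis .
qed

text \<open>For distinct indices the matrix has the entries (i, j) and (j, i), and
  \<open>riesz2\<close> is symmetric. This produces the factor 2 that \<open>riesz2_comb\<close>
  attaches to pairs but not to single indices.\<close>

lemma matrix_riesz2_pair_matrix:
  "matrix_riesz2 (pair_matrix i j) g x = (if i = j then riesz2 i i g x else 2 * riesz2 i j g x)"
  by (simp add: pair_matrix_def matrix_riesz2_add matrix_riesz2_outer riesz2_commute[of j i])

text \<open>Both sides use the same chosen enumeration of each unordered pair, so the summands match
  pair by pair. Irreflexivity guarantees that the two chosen indices differ, whichever enumeration
  was chosen.\<close>

lemma matrix_riesz2_comb_matrix:
  assumes "irrefl A"
  shows "matrix_riesz2 (comb_matrix \<alpha> A) g x = riesz2_comb \<alpha> A g x"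
proof -
  have "matrix_riesz2 (case_prod (\<lambda>i j. \<alpha> $ i *\<^sub>R pair_matrix i j) (SOME p. {fst p, snd p} = e)) g x
     = case_prod (\<lambda>i j. 2 * complex_of_real (\<alpha> $ i) * riesz2 i j g x) (SOME p. {fst p, snd p} = e)"
    if "e \<in> (\<lambda>(i, j). {i, j}) ` A" for e
  proof -
    obtain i j where ij: "(i, j) \<in> A" "e = {i, j}" using \<open>e \<in> _\<close> by auto
    then have "i \<noteq> j" using assms by (auto simp: irrefl_def)
    let ?p = "SOME p. {fst p, snd p} = e"
    have "{fst ?p, snd ?p} = e"
      by (rule someI[where x = "(i, j)"]) (simp add: ij)
    then have "fst ?p \<noteq> snd ?p" using ij \<open>i \<noteq> j\<close> by (auto simp: doubleton_eq_iff)
    then show ?thesis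
      by (simp add: case_prod_beta' matrix_riesz2_scaleR matrix_riesz2_pair_matrix)
  qed
  then show ?thesis
    unfolding comb_matrix_def riesz2_comb_def sum_unordered_def
    by (simp add: matrix_riesz2_add matrix_riesz2_sum matrix_riesz2_scaleR matrix_riesz2_pair_matrix)
qed

section \<open>The case of two indices\<close>

lemma some_doubleton:
  assumes "i \<noteq> j"
  obtains "(SOME p. {fst p, snd p} = {i, j}) = (i, j)" | "(SOME p. {fst p, snd p} = {i, j}) = (j, i)"
proof -
  have "{fst (SOME p. {fst p, snd p} = {i, j}), snd (SOME p. {fst p, snd p} = {i, j})} = {i, j}"
    by (rule someI[where x = "(i, j)"]) simp
  then show ?thesis using that by (auto simp: doubleton_eq_iff prod_eq_iff)
qed

lemma sum_unordered_pair:
  assumes "i \<noteq> j" "h i j = h j i"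
  shows "sum_unordered {(i, j), (j, i)} h = h i j"
proof -
  have "(\<lambda>(i, j). {i, j}) ` {(i, j), (j, i)} = {{i, j}}" by auto
  then have "sum_unordered {(i, j), (j, i)} h = case_prod h (SOME p. {fst p, snd p} = {i, j})"
    by (simp add: sum_unordered_def)
  then show ?thesis using assms by (cases rule: some_doubleton[OF assms(1)]) auto
qed

text \<open>Every index belongs to the pair, so no diagonal terms remain. The four products in
  \<open>riesz2\<close> agree in pairs, and 2 * 1/4 * 2 = 1.\<close>

lemma riesz2_comb_pair:
  assumes "i \<noteq> j" "UNIV = {i, j}" and g: "in_l2 g"
  shows "riesz2_comb (\<chi> _. -1) {(i, j), (j, i)} g x
    = - riesz_plus i (riesz_minus j g) x - riesz_minus i (riesz_plus j g) x"
proof -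
  have "- Field {(i, j), (j, i)} = {}" using assms(2) by (auto simp: Field_def)
  then have eq: "riesz2_comb (\<chi> _. -1) {(i, j), (j, i)} g x = - 2 * riesz2 i j g x"
    using assms(1) by (simp add: riesz2_comb_def sum_unordered_pair riesz2_commute[of j i])
  show ?thesis
    unfolding eq unfolding riesz2_def riesz_plus_minus[OF g] by simp
qed

lemma comb_matrix_pair:
  fixes i j :: "'n::finite"
  assumes "i \<noteq> j" "UNIV = {i, j}"
  shows "comb_matrix (\<chi> _. -1) {(i, j), (j, i)} = - pair_matrix i j"
proof -
  have "- Field {(i, j), (j, i)} = {}" using assms(2) by (auto simp: Field_def)
  moreover have "pair_matrix j i = pair_matrix i j"
    using assms(1) by (simp add: pair_matrix_def add.commute)
  ultimately show ?thesis
    using assms(1) by (simp add: comb_matrix_def sum_unordered_pair)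
qed

lemma mtransform_uminus: "mtransform \<N> \<tau> (- A) f T x0 t \<omega> = - mtransform \<N> \<tau> A f T x0 t \<omega>"
proof -
  have "((- A) *v v) $ i = - ((A *v v) $ i)" for v :: "real ^ 'a" and i
    by (simp add: matrix_vector_mult_def sum_negf)
  then show ?thesis
    by (simp add: mtransform_def Let_def stieltjes_int_def sum_negf set_lebesgue_integral_def sum_distrib_left
        algebra_simps sum_subtractf sum.distrib)
qed

theorem lemma3:
  fixes \<Omega> :: "'w measure"
    and \<N> :: "'n::finite \<Rightarrow> real \<Rightarrow> 'w \<Rightarrow> nat"
    and \<tau> :: "nat \<Rightarrow> 'w \<Rightarrow> int"
    and A :: "('n \<times> 'n) set"
    and \<alpha> :: "real ^ 'n"
    and f :: "int ^ 'n \<Rightarrow> real"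
  assumes "walk_noise \<Omega> \<N> \<tau>"
    and "sym A" and "irrefl A" and "\<And>i j k. (i, j) \<in> A \<Longrightarrow> (i, k) \<in> A \<Longrightarrow> j = k"
    and "\<And>i. \<bar>\<alpha> $ i\<bar> \<le> 1"
    and "\<And>i j. (i, j) \<in> A \<Longrightarrow> \<alpha> $ i = \<alpha> $ j"
    and "in_l2 f"
  shows "(\<forall>x.
       (\<forall>T>0. cond_expect_exists \<Omega> (\<lambda>x\<^sub>0. mtransform \<N> \<tau> (comb_matrix \<alpha> A) f T x\<^sub>0 T)
                (\<lambda>x\<^sub>0. walk \<N> \<tau> x\<^sub>0 T) x) \<and>
       (\<exists>l. ((\<lambda>T. cond_expect \<Omega> (\<lambda>x\<^sub>0. mtransform \<N> \<tau> (comb_matrix \<alpha> A) f T x\<^sub>0 T)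
                (\<lambda>x\<^sub>0. walk \<N> \<tau> x\<^sub>0 T) x) \<longlongrightarrow> l) at_top \<and>
            riesz2_comb \<alpha> A (\<lambda>y. complex_of_real (f y)) x = - complex_of_real l))
    \<and> (\<forall>i j. i \<noteq> j \<and> UNIV = {i, j} \<longrightarrow>
         (let B = {(i, j), (j, i)}; \<beta> = (\<chi> _. -1) in
            (\<forall>g x. in_l2 g \<longrightarrow> riesz2_comb \<beta> B g x =
                - riesz_plus i (riesz_minus j g) x - riesz_minus i (riesz_plus j g) x) \<and>
            (\<forall>T>0. \<forall>x\<^sub>0. \<forall>t\<in>{0..T}. \<forall>\<omega>\<in>space \<Omega>.
                mtransform \<N> \<tau> (pair_matrix i j) f T x\<^sub>0 t \<omega>
                  = - mtransform \<N> \<tau> (comb_matrix \<beta> B) f T x\<^sub>0 t \<omega>)))"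
proof -
  interpret walk_noise \<Omega> \<N> \<tau> by fact
  note f = \<open>in_l2 f\<close>
  have F: "square_integrable torus (fourier (\<lambda>y. complex_of_real (f y)))"
    using is_fourierD(1)[OF is_fourier_fourier[OF in_l2_of_real[OF f]]] .
  let ?E = "\<lambda>x T. cond_expect \<Omega> (\<lambda>x\<^sub>0. mtransform \<N> \<tau> (comb_matrix \<alpha> A) f T x\<^sub>0 T) (\<lambda>x\<^sub>0. walk \<N> \<tau> x\<^sub>0 T) x"
  have "(\<forall>T>0. cond_expect_exists \<Omega> (\<lambda>x\<^sub>0. mtransform \<N> \<tau> (comb_matrix \<alpha> A) f T x\<^sub>0 T) (\<lambda>x\<^sub>0. walk \<N> \<tau> x\<^sub>0 T) x) \<and>
     (\<exists>l. (?E x \<longlongrightarrow> l) at_top \<and> riesz2_comb \<alpha> A (\<lambda>y. complex_of_real (f y)) x = - complex_of_real l)" for x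
  proof (intro conjI allI impI)
    show "cond_expect_exists \<Omega> (\<lambda>x\<^sub>0. mtransform \<N> \<tau> (comb_matrix \<alpha> A) f T x\<^sub>0 T) (\<lambda>x\<^sub>0. walk \<N> \<tau> x\<^sub>0 T) x"
      if "0 < T" for T
      by (rule cond_expect_mtransform(1)[OF f that])
    define r where "r = riesz2_comb \<alpha> A (\<lambda>y. complex_of_real (f y)) x"
    have "((\<lambda>T. - (\<integral>\<xi>. complex_of_real (1 - exp (- 2 * T * neg_laplacian_symbol \<xi>)) * matrix_riesz_symbol (comb_matrix \<alpha> A) \<xi>
        * fourier (\<lambda>y. complex_of_real (f y)) \<xi> * character x \<xi> \<partial>torus)) \<longlongrightarrow> - r) at_top"
      unfolding r_def matrix_riesz2_comb_matrix[OF \<open>irrefl A\<close>, symmetric] matrix_riesz2_eq_integral[OF in_l2_of_real[OF f]]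
      by (intro tendsto_minus riesz_integral_tendsto F)
    moreover have "\<forall>\<^sub>F T in at_top. - (\<integral>\<xi>. complex_of_real (1 - exp (- 2 * T * neg_laplacian_symbol \<xi>)) * matrix_riesz_symbol (comb_matrix \<alpha> A) \<xi>
        * fourier (\<lambda>y. complex_of_real (f y)) \<xi> * character x \<xi> \<partial>torus) = complex_of_real (?E x T)"
      using eventually_gt_at_top[of 0]
      by eventually_elim (simp only: cond_expect_mtransform(2)[OF f] endpoint_value_def[OF f])
    ultimately have lim: "((\<lambda>T. complex_of_real (?E x T)) \<longlongrightarrow> - r) at_top"
      by (rule Lim_transform_eventually)
    \<comment> \<open>The conditional expectations are real, so their complex limit has imaginary
      part 0; this is what permits a real limit l in the conclusion.\<close>
    have "((\<lambda>T. 0) \<longlongrightarrow> Im (- r)) (at_top :: real filter)"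
      using tendsto_Im[OF lim] by simp
    then have "Im (- r) = 0"
      using tendsto_unique[OF trivial_limit_at_top_linorder] tendsto_const by metis
    moreover have "(?E x \<longlongrightarrow> Re (- r)) at_top"
      using tendsto_Re[OF lim] by simp
    ultimately show "\<exists>l. (?E x \<longlongrightarrow> l) at_top \<and> riesz2_comb \<alpha> A (\<lambda>y. complex_of_real (f y)) x = - complex_of_real l"
      by (intro exI[of _ "Re (- r)"]) (simp add: r_def[symmetric] complex_eq_iff)
  qed
  moreover have "let B = {(i, j), (j, i)}; \<beta> = (\<chi> _. -1) in
            (\<forall>g x. in_l2 g \<longrightarrow> riesz2_comb \<beta> B g x =
                - riesz_plus i (riesz_minus j g) x - riesz_minus i (riesz_plus j g) x) \<and>
            (\<forall>T>0. \<forall>x\<^sub>0. \<forall>t\<in>{0..T}. \<forall>\<omega>\<in>space \<Omega>.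
                mtransform \<N> \<tau> (pair_matrix i j) f T x\<^sub>0 t \<omega>
                  = - mtransform \<N> \<tau> (comb_matrix \<beta> B) f T x\<^sub>0 t \<omega>)"
    if "i \<noteq> j \<and> UNIV = {i, j}" for i j
    using that unfolding Let_def by (simp add: riesz2_comb_pair comb_matrix_pair mtransform_uminus)
  ultimately show ?thesis by blast
qed

end
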